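(* Let $\varphi_h^{n-1}\in Q_h$ be given. Solving the discrete problem (P) is equivalent to solving the minimization problem (M), i.e. $(\varphi_h^n,\boldsymbol u_h^n)$ solves (M) if and only if there is $\mu_h^n\in Q_h$ such that $(\varphi_h^n,\mu_h^n,\boldsymbol u_h^n)$ solves (P), where: (P) Find $\varphi_h^n,\mu_h^n\in Q_h$ and $\boldsymbol u_h^n\in \boldsymbol V_h$ such that $$\left(\frac{\varphi_h^n-\varphi_h^{n-1}}{\tau},q_h^\varphi\right)+(m\nabla\mu_h^n,\nabla q_h^\varphi)-(R^n,q_h^\varphi)=0,$$ $$(\mu_h^n,q_h^\mu)-\gamma\ell(\nabla\varphi_h^n,\nabla q_h^\mu)-\frac{\gamma}{\ell}\left(\Psi_c'(\varphi_h^n)-\Psi_e'(\varphi_h^{n-1}),q_h^\mu\right)+\left(\mathbb C(\boldsymbol\varepsilon(\boldsymbol u_h^n)-\xi\varphi_h^n\boldsymbol I);q_h^\mu\xi\boldsymbol I\right)=0,$$ $$\left(\mathbb C(\boldsymbol\varepsilon(\boldsymbol u_h^n)-\xi\varphi_h^n\boldsymbol I);\boldsymbol\varepsilon(\boldsymbol v_h)\right)-(\boldsymbol f^n,\boldsymbol v_h)=0$$ for all $q_h^\varphi,q_h^\mu\in Q_h$ and all $\boldsymbol v_h\in\boldsymbol V_h$. (M) Find $$(\varphi_h^n,\boldsymbol u_h^n)=\arg\min_{s_h\in\bar Q_h^n,\ \boldsymbol w_h\in\boldsymbol V_h}\mathcal H_\tau^n(s_h,\boldsymbol w_h),$$ where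 $$\bar Q_h^n:=\left\{s_h\in Q_h\ :\ \int_\Omega\frac{s_h-\varphi_h^{n-1}}{\tau}\,dx=\int_\Omega R^n\,dx\right\},$$ $$\mathcal H_\tau^n(s_h,\boldsymbol w_h):=\frac{\|s_h-\varphi_h^{n-1}-\tau R^n\|_{Q_{h,m}^*}^2}{2\tau}+\mathcal E_c(s_h,\boldsymbol w_h)-\frac{\gamma}{\ell}\left(\Psi_e'(\varphi_h^{n-1}),s_h\right)-(\boldsymbol f^n,\boldsymbol w_h),$$ $$\mathcal E_c(s_h,\boldsymbol w_h):=\int_\Omega\frac{\gamma}{\ell}\Psi_c(s_h)+\gamma\ell\frac{|\nabla s_h|^2}{2}+\frac12\left(\boldsymbol\varepsilon(\boldsymbol w_h)-\xi s_h\boldsymbol I\right):\mathbb C\left(\boldsymbol\varepsilon(\boldsymbol w_h)-\xi s_h\boldsymbol I\right)dx.$$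
   Context: Domain and spaces: $\Omega\subset\mathbb R^d$ is a bounded (connected) domain with Lipschitz boundary. $Q_h\subseteq H^1(\Omega)$ and $\boldsymbol V_h\subseteq (H^1_0(\Omega))^d$ are conforming finite element spaces (finite-dimensional spaces of piecewise polynomial functions; $Q_h$ contains the constants). $(\cdot,\cdot)$ is the $L^2(\Omega)$ inner product of scalar or vector functions, $(\cdot;\cdot)$ the $L^2(\Omega)$ inner product of second-order tensor functions, $:$ the pointwise contraction of second-order tensors. $\boldsymbol I$ is the identity tensor in $\mathbb R^{d\times d}$ and $\boldsymbol\varepsilon(\boldsymbol u)=\frac12(\nabla\boldsymbol u+\nabla\boldsymbol u^\top)$. Parameters and data: constants $\gamma,\ell,\tau,m>0$, $\xi\in\mathbb R$; $R^n\in L^2(\Omega)$, $\boldsymbol f^n\in L^2(\Omega)^d$. Dual norm: $Q_{h,0}:=\{q_h\in Q_h:\int_\Omega q_h\,dx=0\}$ with norm $\|q_h\|_{h,m}:=\|m^{1/2}\nabla q_h\|_{L^2(\Omega)}$; its dual space is $Q_{h,m}^*$, with norm $\|s\|_{Q_{h,m}^*}:=\sup_{0\neq q_h\in Q_{h,0}}\langle s,q_h\rangle/\|q_h\|_{h,m}$. An $L^2(\Omega)$ function $s$ is identified with the functional $q_h\mapsto(s,q_h)$. Assumption on the double-well potential: $\Psi=\Psi_c-\Psi_e$ with $\Psi_c,\Psi_e:\mathbb R\to\mathbb R$ convex and differentiable, and $(\Psi_c'(a)-\Psi_c'(b))(a-b)\le L_{\Psi_c}(a-b)^2$ for all $a,b\in\mathbb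 R$, for a constant $L_{\Psi_c}$. Assumption on the elasticity tensor: $\mathbb C$ is a constant (phase-field-independent) fourth-order tensor for which there are constants $c_{\mathbb C},C_{\mathbb C}>0$ with $c_{\mathbb C}\|\boldsymbol e\|_{L^2(\Omega)}^2\le(\mathbb C\boldsymbol e;\boldsymbol e)\le C_{\mathbb C}\|\boldsymbol e\|_{L^2(\Omega)}^2$ for all symmetric second-order tensor functions $\boldsymbol e\in L^2(\Omega)$, and $(\boldsymbol e,\boldsymbol w)\mapsto(\mathbb C\boldsymbol e;\boldsymbol w)$ is an inner product (in particular symmetric). *)

theory Defs
  imports "HOL-Analysis.Analysis"
begin

section \<open>Lipschitz domains\<close>

text \<open>Near each boundary point, the set is the strict subgraph, in some direction \<open>e\<close>, of a
  Lipschitz function of the component orthogonal to \<open>e\<close>.\<close>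

definition lipschitz_boundary :: "(real^'d) set \<Rightarrow> bool" where
  "lipschitz_boundary \<Omega> \<longleftrightarrow>
     (\<forall>p \<in> frontier \<Omega>. \<exists>e r L (g :: real^'d \<Rightarrow> real).
        norm e = 1 \<and> r > 0 \<and> L-lipschitz_on {y. y \<bullet> e = 0} g \<and>
        \<Omega> \<inter> ball p r = {x \<in> ball p r. x \<bullet> e < g (x - (x \<bullet> e) *\<^sub>R e)})"

definition lipschitz_domain :: "(real^'d) set \<Rightarrow> bool" where
  "lipschitz_domain \<Omega> \<longleftrightarrow>
     open \<Omega> \<and> connected \<Omega> \<and> bounded \<Omega> \<and> \<Omega> \<noteq> {} \<and> lipschitz_boundary \<Omega>"


section \<open>Lebesgue and Sobolev spaces\<close>

text \<open>Elements of function spaces are represented by functions on the whole space, of which only the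
  values almost everywhere in \<open>\<Omega>\<close> matter. The inner product of \<^typ>\<open>real^'d^'d\<close> is the contraction
  of second-order tensors, so that \<open>L2_inner\<close> covers scalar, vector and tensor functions.\<close>

definition L2 :: "(real^'d) set \<Rightarrow> (real^'d \<Rightarrow> 'b::euclidean_space) set" where
  "L2 \<Omega> = {f. f \<in> borel_measurable (lebesgue_on \<Omega>) \<and>
             integrable (lebesgue_on \<Omega>) (\<lambda>x. (norm (f x))\<^sup>2)}"

definition L2_inner ::
    "(real^'d) set \<Rightarrow> (real^'d \<Rightarrow> 'b::euclidean_space) \<Rightarrow> (real^'d \<Rightarrow> 'b) \<Rightarrow> real" where
  "L2_inner \<Omega> f g = (LINT x|lebesgue_on \<Omega>. f x \<bullet> g x)"

definition L2_norm :: "(real^'d) set \<Rightarrow> (real^'d \<Rightarrow> 'b::euclidean_space) \<Rightarrow> real" where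
  "L2_norm \<Omega> f = sqrt (L2_inner \<Omega> f f)"

definition partial_deriv :: "'d \<Rightarrow> (real^'d \<Rightarrow> real) \<Rightarrow> real^'d \<Rightarrow> real" where
  "partial_deriv i f x = frechet_derivative f (at x) (axis i 1)"

primrec C_k :: "nat \<Rightarrow> (real^'d \<Rightarrow> real) \<Rightarrow> bool" where
  "C_k 0 f \<longleftrightarrow> continuous_on UNIV f"
| "C_k (Suc k) f \<longleftrightarrow> (\<forall>x. f differentiable (at x)) \<and> (\<forall>i. C_k k (partial_deriv i f))"

definition test_functions :: "(real^'d) set \<Rightarrow> (real^'d \<Rightarrow> real) set" where
  "test_functions \<Omega> = {\<phi>. (\<forall>k. C_k k \<phi>) \<and> compact (closure {x. \<phi> x \<noteq> 0}) \<and>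
                          closure {x. \<phi> x \<noteq> 0} \<subseteq> \<Omega>}"

definition has_weak_gradient ::
    "(real^'d) set \<Rightarrow> (real^'d \<Rightarrow> real) \<Rightarrow> (real^'d \<Rightarrow> real^'d) \<Rightarrow> bool" where
  "has_weak_gradient \<Omega> f g \<longleftrightarrow>
     (\<forall>\<phi> \<in> test_functions \<Omega>. \<forall>i.
        (LINT x|lebesgue_on \<Omega>. f x * partial_deriv i \<phi> x) =
        - (LINT x|lebesgue_on \<Omega>. g x $ i * \<phi> x))"

definition H1 :: "(real^'d) set \<Rightarrow> (real^'d \<Rightarrow> real) set" where
  "H1 \<Omega> = {f \<in> L2 \<Omega>. \<exists>g \<in> L2 \<Omega>. has_weak_gradient \<Omega> f g}"

text \<open>The weak gradient of a function in \<open>H1 \<Omega>\<close> is determined up to null sets; this is a choice of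
  representative.\<close>

definition weak_grad :: "(real^'d) set \<Rightarrow> (real^'d \<Rightarrow> real) \<Rightarrow> real^'d \<Rightarrow> real^'d" where
  "weak_grad \<Omega> f = (SOME g. g \<in> L2 \<Omega> \<and> has_weak_gradient \<Omega> f g)"

text \<open>The closure of the test functions in \<open>H1 \<Omega>\<close>.\<close>

definition H1_0 :: "(real^'d) set \<Rightarrow> (real^'d \<Rightarrow> real) set" where
  "H1_0 \<Omega> = {f \<in> H1 \<Omega>. \<exists>\<phi> :: nat \<Rightarrow> real^'d \<Rightarrow> real.
      (\<forall>k. \<phi> k \<in> test_functions \<Omega>) \<and>
      (\<lambda>k. L2_norm \<Omega> (\<lambda>x. \<phi> k x - f x)) \<longlonglongrightarrow> 0 \<and>
      (\<lambda>k. L2_norm \<Omega> (\<lambda>x. (\<chi> i. partial_deriv i (\<phi> k) x) - weak_grad \<Omega> f x)) \<longlonglongrightarrow> 0}"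

definition H1_0_vec :: "(real^'d) set \<Rightarrow> (real^'d \<Rightarrow> real^'d) set" where
  "H1_0_vec \<Omega> = {u. \<forall>i. (\<lambda>x. u x $ i) \<in> H1_0 \<Omega>}"

text \<open>The entry \<open>(i, j)\<close> is the \<open>j\<close>-th weak partial derivative of the \<open>i\<close>-th component.\<close>

definition weak_jacobian :: "(real^'d) set \<Rightarrow> (real^'d \<Rightarrow> real^'d) \<Rightarrow> real^'d \<Rightarrow> real^'d^'d" where
  "weak_jacobian \<Omega> u x = (\<chi> i. weak_grad \<Omega> (\<lambda>y. u y $ i) x)"

definition strain :: "(real^'d) set \<Rightarrow> (real^'d \<Rightarrow> real^'d) \<Rightarrow> real^'d \<Rightarrow> real^'d^'d" where
  "strain \<Omega> u x = (1/2) *\<^sub>R (weak_jacobian \<Omega> u x + transpose (weak_jacobian \<Omega> u x))"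


section \<open>Finite element spaces\<close>

text \<open>The members of a mesh are the open cells, for instance the interiors of the simplices of a
  triangulation; their shape is not restricted.\<close>

definition mesh :: "(real^'d) set \<Rightarrow> (real^'d) set set \<Rightarrow> bool" where
  "mesh \<Omega> \<T> \<longleftrightarrow> finite \<T> \<and> (\<forall>K \<in> \<T>. open K \<and> K \<noteq> {} \<and> K \<subseteq> \<Omega>) \<and>
               pairwise disjnt \<T> \<and> negligible (\<Omega> - \<Union>\<T>)"

text \<open>A finite-dimensional linear space of functions that are piecewise polynomial on a common mesh.
  The generating family need not be linearly independent.\<close>

definition finite_element_space ::
    "(real^'d) set \<Rightarrow> (real^'d \<Rightarrow> 'b::euclidean_space) set \<Rightarrow> bool" where
  "finite_element_space \<Omega> S \<longleftrightarrow>
     (\<exists>(N::nat) b. S = {f. \<exists>c. f = (\<lambda>x. \<Sum>i<N. c i *\<^sub>R b i x)}) \<and>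
     (\<exists>\<T>. mesh \<Omega> \<T> \<and>
        (\<forall>f \<in> S. \<forall>K \<in> \<T>. \<exists>p. polynomial_function p \<and> (\<forall>x \<in> K. f x = p x)))"


section \<open>The discrete dual norm\<close>

definition mean_zero :: "(real^'d) set \<Rightarrow> (real^'d \<Rightarrow> real) set \<Rightarrow> (real^'d \<Rightarrow> real) set" where
  "mean_zero \<Omega> Q = {q \<in> Q. (LINT x|lebesgue_on \<Omega>. q x) = 0}"

definition weighted_norm :: "(real^'d) set \<Rightarrow> real \<Rightarrow> (real^'d \<Rightarrow> real) \<Rightarrow> real" where
  "weighted_norm \<Omega> m q = L2_norm \<Omega> (\<lambda>x. sqrt m *\<^sub>R weak_grad \<Omega> q x)"

text \<open>The supremum is taken in the nonnegative reals. Inserting \<open>0\<close> only matters if \<open>mean_zero \<Omega> Q\<close>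
  is trivial: otherwise replacing \<open>q\<close> by \<open>-q\<close> shows that the supremum is nonnegative.\<close>

definition dual_norm ::
    "(real^'d) set \<Rightarrow> (real^'d \<Rightarrow> real) set \<Rightarrow> real \<Rightarrow> ((real^'d \<Rightarrow> real) \<Rightarrow> real) \<Rightarrow> real" where
  "dual_norm \<Omega> Q m F =
     Sup (insert 0 {F q / weighted_norm \<Omega> m q | q.
            q \<in> mean_zero \<Omega> Q \<and> \<not> (AE x in lebesgue_on \<Omega>. q x = 0)})"


section \<open>Assumptions on the potential and the elasticity tensor\<close>

definition convex_splitting ::
    "(real \<Rightarrow> real) \<Rightarrow> (real \<Rightarrow> real) \<Rightarrow> (real \<Rightarrow> real) \<Rightarrow> real \<Rightarrow> bool" where
  "convex_splitting \<Psi> \<Psi>\<^sub>c \<Psi>\<^sub>e L \<longleftrightarrow>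
     (\<forall>a. \<Psi> a = \<Psi>\<^sub>c a - \<Psi>\<^sub>e a) \<and>
     convex_on UNIV \<Psi>\<^sub>c \<and> convex_on UNIV \<Psi>\<^sub>e \<and>
     \<Psi>\<^sub>c differentiable_on UNIV \<and> \<Psi>\<^sub>e differentiable_on UNIV \<and>
     (\<forall>a b. (deriv \<Psi>\<^sub>c a - deriv \<Psi>\<^sub>c b) * (a - b) \<le> L * (a - b)\<^sup>2)"

definition L2_sym :: "(real^'d) set \<Rightarrow> (real^'d \<Rightarrow> real^'d^'d) set" where
  "L2_sym \<Omega> = {e \<in> L2 \<Omega>. \<forall>x \<in> \<Omega>. transpose (e x) = e x}"

text \<open>A constant fourth-order tensor is a linear map on second-order tensors. That it induces an inner
  product on \<open>L2_sym \<Omega>\<close> amounts to the symmetry condition, since bilinearity and definiteness are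
  consequences of the linearity and of the lower bound.\<close>

definition elasticity_tensor ::
    "(real^'d) set \<Rightarrow> (real^'d^'d \<Rightarrow> real^'d^'d) \<Rightarrow> real \<Rightarrow> real \<Rightarrow> bool" where
  "elasticity_tensor \<Omega> \<C> c\<^sub>l c\<^sub>u \<longleftrightarrow>
     linear \<C> \<and> 0 < c\<^sub>l \<and> 0 < c\<^sub>u \<and>
     (\<forall>e \<in> L2_sym \<Omega>.
        c\<^sub>l * (L2_norm \<Omega> e)\<^sup>2 \<le> L2_inner \<Omega> (\<lambda>x. \<C> (e x)) e \<and>
        L2_inner \<Omega> (\<lambda>x. \<C> (e x)) e \<le> c\<^sub>u * (L2_norm \<Omega> e)\<^sup>2) \<and>
     (\<forall>e \<in> L2_sym \<Omega>. \<forall>w \<in> L2_sym \<Omega>.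
        L2_inner \<Omega> (\<lambda>x. \<C> (e x)) w = L2_inner \<Omega> (\<lambda>x. \<C> (w x)) e)"


section \<open>The discrete problem and the minimization problem\<close>

definition elastic_strain ::
    "(real^'d) set \<Rightarrow> real \<Rightarrow> (real^'d \<Rightarrow> real) \<Rightarrow> (real^'d \<Rightarrow> real^'d) \<Rightarrow> real^'d \<Rightarrow> real^'d^'d" where
  "elastic_strain \<Omega> \<xi> s w x = strain \<Omega> w x - (\<xi> * s x) *\<^sub>R mat 1"

definition solves_discrete_problem ::
    "(real^'d) set \<Rightarrow> (real^'d \<Rightarrow> real) set \<Rightarrow> (real^'d \<Rightarrow> real^'d) set \<Rightarrow>
     real \<Rightarrow> real \<Rightarrow> real \<Rightarrow> real \<Rightarrow> real \<Rightarrow> (real \<Rightarrow> real) \<Rightarrow> (real \<Rightarrow> real) \<Rightarrow>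
     (real^'d^'d \<Rightarrow> real^'d^'d) \<Rightarrow> (real^'d \<Rightarrow> real) \<Rightarrow> (real^'d \<Rightarrow> real^'d) \<Rightarrow>
     (real^'d \<Rightarrow> real) \<Rightarrow> (real^'d \<Rightarrow> real) \<Rightarrow> (real^'d \<Rightarrow> real) \<Rightarrow> (real^'d \<Rightarrow> real^'d) \<Rightarrow> bool" where
  "solves_discrete_problem \<Omega> Q V \<gamma> l \<tau> m \<xi> \<Psi>\<^sub>c \<Psi>\<^sub>e \<C> R f \<phi>\<^sub>0 \<phi> \<mu> u \<longleftrightarrow>
     \<phi> \<in> Q \<and> \<mu> \<in> Q \<and> u \<in> V \<and>
     (\<forall>q \<in> Q.
        L2_inner \<Omega> (\<lambda>x. (\<phi> x - \<phi>\<^sub>0 x) / \<tau>) q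
        + L2_inner \<Omega> (\<lambda>x. m *\<^sub>R weak_grad \<Omega> \<mu> x) (weak_grad \<Omega> q)
        - L2_inner \<Omega> R q = 0) \<and>
     (\<forall>q \<in> Q.
        L2_inner \<Omega> \<mu> q
        - \<gamma> * l * L2_inner \<Omega> (weak_grad \<Omega> \<phi>) (weak_grad \<Omega> q)
        - \<gamma> / l * L2_inner \<Omega> (\<lambda>x. deriv \<Psi>\<^sub>c (\<phi> x) - deriv \<Psi>\<^sub>e (\<phi>\<^sub>0 x)) q
        + L2_inner \<Omega> (\<lambda>x. \<C> (elastic_strain \<Omega> \<xi> \<phi> u x)) (\<lambda>x. (q x * \<xi>) *\<^sub>R mat 1) = 0) \<and>
     (\<forall>v \<in> V.
        L2_inner \<Omega> (\<lambda>x. \<C> (elastic_strain \<Omega> \<xi> \<phi> u x)) (strain \<Omega> v) - L2_inner \<Omega> f v = 0)"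

definition admissible ::
    "(real^'d) set \<Rightarrow> (real^'d \<Rightarrow> real) set \<Rightarrow> real \<Rightarrow> (real^'d \<Rightarrow> real) \<Rightarrow> (real^'d \<Rightarrow> real) \<Rightarrow>
     (real^'d \<Rightarrow> real) set" where
  "admissible \<Omega> Q \<tau> R \<phi>\<^sub>0 =
     {s \<in> Q. (LINT x|lebesgue_on \<Omega>. (s x - \<phi>\<^sub>0 x) / \<tau>) = (LINT x|lebesgue_on \<Omega>. R x)}"

definition convex_energy ::
    "(real^'d) set \<Rightarrow> real \<Rightarrow> real \<Rightarrow> real \<Rightarrow> (real \<Rightarrow> real) \<Rightarrow> (real^'d^'d \<Rightarrow> real^'d^'d) \<Rightarrow>
     (real^'d \<Rightarrow> real) \<Rightarrow> (real^'d \<Rightarrow> real^'d) \<Rightarrow> real" where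
  "convex_energy \<Omega> \<gamma> l \<xi> \<Psi>\<^sub>c \<C> s w =
     (LINT x|lebesgue_on \<Omega>.
        \<gamma> / l * \<Psi>\<^sub>c (s x) + \<gamma> * l * ((norm (weak_grad \<Omega> s x))\<^sup>2 / 2)
        + 1/2 * (elastic_strain \<Omega> \<xi> s w x \<bullet> \<C> (elastic_strain \<Omega> \<xi> s w x)))"

definition incremental_energy ::
    "(real^'d) set \<Rightarrow> (real^'d \<Rightarrow> real) set \<Rightarrow>
     real \<Rightarrow> real \<Rightarrow> real \<Rightarrow> real \<Rightarrow> real \<Rightarrow> (real \<Rightarrow> real) \<Rightarrow> (real \<Rightarrow> real) \<Rightarrow>
     (real^'d^'d \<Rightarrow> real^'d^'d) \<Rightarrow> (real^'d \<Rightarrow> real) \<Rightarrow> (real^'d \<Rightarrow> real^'d) \<Rightarrow>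
     (real^'d \<Rightarrow> real) \<Rightarrow> (real^'d \<Rightarrow> real) \<Rightarrow> (real^'d \<Rightarrow> real^'d) \<Rightarrow> real" where
  "incremental_energy \<Omega> Q \<gamma> l \<tau> m \<xi> \<Psi>\<^sub>c \<Psi>\<^sub>e \<C> R f \<phi>\<^sub>0 s w =
     (dual_norm \<Omega> Q m (L2_inner \<Omega> (\<lambda>x. s x - \<phi>\<^sub>0 x - \<tau> * R x)))\<^sup>2 / (2 * \<tau>)
     + convex_energy \<Omega> \<gamma> l \<xi> \<Psi>\<^sub>c \<C> s w
     - \<gamma> / l * L2_inner \<Omega> (\<lambda>x. deriv \<Psi>\<^sub>e (\<phi>\<^sub>0 x)) s
     - L2_inner \<Omega> f w"

definition solves_minimization_problem ::
    "(real^'d) set \<Rightarrow> (real^'d \<Rightarrow> real) set \<Rightarrow> (real^'d \<Rightarrow> real^'d) set \<Rightarrow>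
     real \<Rightarrow> real \<Rightarrow> real \<Rightarrow> real \<Rightarrow> real \<Rightarrow> (real \<Rightarrow> real) \<Rightarrow> (real \<Rightarrow> real) \<Rightarrow>
     (real^'d^'d \<Rightarrow> real^'d^'d) \<Rightarrow> (real^'d \<Rightarrow> real) \<Rightarrow> (real^'d \<Rightarrow> real^'d) \<Rightarrow>
     (real^'d \<Rightarrow> real) \<Rightarrow> (real^'d \<Rightarrow> real) \<Rightarrow> (real^'d \<Rightarrow> real^'d) \<Rightarrow> bool" where
  "solves_minimization_problem \<Omega> Q V \<gamma> l \<tau> m \<xi> \<Psi>\<^sub>c \<Psi>\<^sub>e \<C> R f \<phi>\<^sub>0 \<phi> u \<longleftrightarrow>
     is_arg_min (\<lambda>(s, w). incremental_energy \<Omega> Q \<gamma> l \<tau> m \<xi> \<Psi>\<^sub>c \<Psi>\<^sub>e \<C> R f \<phi>\<^sub>0 s w)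
       (\<lambda>(s, w). s \<in> admissible \<Omega> Q \<tau> R \<phi>\<^sub>0 \<and> w \<in> V) (\<phi>, u)"

end

theory Submission
  imports Defs
begin

text \<open>
  Put \<open>a(p, q) = (m \<nabla>p, \<nabla>q)\<close>. On a connected domain \<open>a(q, q) = 0\<close> holds exactly for the constants
  (\<open>weak_grad_AE_const\<close>, \<open>AE_const_if_weak_grad_zero\<close>), and \<open>Q\<close> is finite-dimensional. Hence, if \<open>g\<close>
  has mean zero, the functional \<open>(g, \<cdot>)\<close> equals \<open>a(r, \<cdot>)\<close> on \<open>Q\<close> for some \<open>r \<in> Q\<close>
  (\<open>grad_representation\<close>), and its discrete dual norm is \<open>a(r, r)\<close> to the power \<open>1/2\<close>
  (\<open>dual_norm_eq\<close>). Therefore the squared dual norm is a quadratic function, and moving \<open>g\<close> by a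
  mean-zero \<open>t q\<close> changes it by \<open>2 t (q, r) + O(t\<^sup>2)\<close>.

  For \<open>g = \<phi> - \<phi>\<^sub>0 - \<tau> R\<close>, mean zero is admissibility of \<open>\<phi>\<close>. The other parts of the energy are affine
  or convex, and the one-sided Lipschitz bound on the derivative of the convex potential controls its
  second-order behaviour. So the energy increment in a direction \<open>(q, v)\<close> with step \<open>t\<close> lies between
  \<open>t D(q, v)\<close> and \<open>t D(q, v) + t\<^sup>2 K(q, v)\<close> (\<open>energy_increment\<close>). Consequently \<open>(\<phi>, u)\<close> is a minimizer
  iff \<open>D(q, v) = 0\<close> for all mean-zero \<open>q\<close> and all \<open>v\<close>: the upper bound gives necessity and the lower bound
  sufficiency (\<open>minimizer_iff_stationary\<close>). The condition in \<open>v\<close> is the elasticity equation.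
  With \<open>\<mu> = - r / \<tau>\<close>, the condition in \<open>q\<close> is the equation for the chemical potential, tested with
  mean-zero functions only; adding a constant to \<open>\<mu>\<close> makes it hold for the constant test function too.
  The remaining equation says that \<open>- \<tau> \<mu>\<close> represents \<open>(g, \<cdot>)\<close>; tested with constants it yields
  admissibility.

  Behind this stand facts about weak gradients. As \<open>weak_grad\<close> is a choice, its
  linearity up to null sets rests on uniqueness, that is on the fundamental lemma of the
  calculus of variations, for which bump functions on boxes are built. That a function with zero weak
  gradient is constant is deduced from the symmetry of convolution (\<open>zero_weak_gradient_imp_constant\<close>).
\<close>

section \<open>Smooth functions\<close>

lemma partial_deriv_eq:
  "(f has_derivative f') (at x) \<Longrightarrow> partial_deriv i f x = f' (axis i 1)"
  unfolding partial_deriv_def using frechet_derivative_at by metis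

lemma has_derivative_frechet:
  "f differentiable at x \<Longrightarrow> (f has_derivative frechet_derivative f (at x)) (at x)"
  using frechet_derivative_works by blast

lemma C_k_continuous: "C_k k f \<Longrightarrow> continuous_on UNIV f"
  by (cases k) (auto simp: differentiable_imp_continuous_within continuous_at_imp_continuous_on)

lemma C_k_SucD: "C_k (Suc k) f \<Longrightarrow> C_k k f"
proof (induction k arbitrary: f)
  case 0
  then show ?case using C_k_continuous[of "Suc 0" f] by simp
qed auto

lemma C_k_const: "C_k k (\<lambda>x::real^'d. c)"
proof (induction k arbitrary: c)
  case (Suc k)
  have "partial_deriv i (\<lambda>x::real^'d. c) = (\<lambda>x. 0)" for i
    by (rule ext) (subst partial_deriv_eq[of _ "\<lambda>h. 0"], auto)
  then show ?case using Suc by simp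
qed simp

lemma C_k_add:
  assumes "C_k k f" "C_k k g" shows "C_k k (\<lambda>x. f x + g x)"
  using assms
proof (induction k arbitrary: f g)
  case 0
  then show ?case by (auto intro: continuous_intros)
next
  case (Suc k)
  have "partial_deriv i (\<lambda>x. f x + g x) = (\<lambda>x. partial_deriv i f x + partial_deriv i g x)" for i
  proof
    fix x
    show "partial_deriv i (\<lambda>x. f x + g x) x = partial_deriv i f x + partial_deriv i g x"
      using partial_deriv_eq[OF has_derivative_add[OF has_derivative_frechet has_derivative_frechet],
          of f x g i] Suc.prems by (simp add: partial_deriv_def)
  qed
  then show ?case using Suc by (auto intro: differentiable_add)
qed

lemma C_k_mult:
  assumes "C_k k f" "C_k k g" shows "C_k k (\<lambda>x. f x * g x)"
  using assms
proof (induction k arbitrary: f g)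
  case 0
  then show ?case by (auto intro: continuous_intros)
next
  case (Suc k)
  have "partial_deriv i (\<lambda>x. f x * g x) =
      (\<lambda>x. f x * partial_deriv i g x + partial_deriv i f x * g x)" for i
  proof
    fix x
    show "partial_deriv i (\<lambda>x. f x * g x) x = f x * partial_deriv i g x + partial_deriv i f x * g x"
      using partial_deriv_eq[OF has_derivative_mult[OF has_derivative_frechet has_derivative_frechet],
          of f x g i] Suc.prems by (simp add: partial_deriv_def)
  qed
  moreover have "C_k k f" "C_k k g" using Suc.prems C_k_SucD by auto
  ultimately show ?case
    using Suc by (auto intro!: C_k_add intro: differentiable_mult)
qed

lemma C_k_prod:
  assumes "finite I" "\<And>i. i \<in> I \<Longrightarrow> C_k k (f i)" shows "C_k k (\<lambda>x. \<Prod>i\<in>I. f i x)"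
  using assms by (induction I rule: finite_induct) (auto intro: C_k_mult C_k_const)

lemma C_k_affine_coordinate: "C_k k (\<lambda>x. c * x $ j + d)"
proof (cases k)
  case 0
  then show ?thesis by (auto intro!: continuous_intros)
next
  case (Suc k')
  have der: "((\<lambda>x. c * x $ j + d) has_derivative (\<lambda>h. c * h $ j)) (at x)" for x :: "real^'a"
    by (auto intro!: derivative_eq_intros bounded_linear.has_derivative[OF bounded_linear_vec_nth])
  then have "partial_deriv i (\<lambda>x. c * x $ j + d) = (\<lambda>x. c * axis i 1 $ j)" for i
    using partial_deriv_eq by blast
  then show ?thesis using Suc der C_k_const by (auto simp: differentiable_def)
qed

text \<open>The powers are there to make the family closed under differentiation, up to linear combinations:
  see \<open>flat_deriv\<close>. Smoothness of \<open>flat 0\<close>, the classical flat function, then follows by an induction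
  over all \<open>n\<close> at once.\<close>

definition flat :: "nat \<Rightarrow> real \<Rightarrow> real" where
  "flat n t = (if t > 0 then (1/t)^n * exp (- (1/t)) else 0)"

lemma flat_tendsto_0: "(flat n \<longlongrightarrow> 0) (at 0)"
proof -
  have "((\<lambda>t::real. (1/t)^n / exp (1/t)) \<longlongrightarrow> 0) (at_right 0)"
    using filterlim_compose[OF tendsto_power_div_exp_0[of n] filterlim_inverse_at_top_right]
    by (simp add: inverse_eq_divide)
  then have "(flat n \<longlongrightarrow> 0) (at_right 0)"
    by (rule Lim_transform_eventually)
      (auto simp: flat_def eventually_at_right_field exp_minus field_simps intro: exI[of _ 1])
  moreover have "(flat n \<longlongrightarrow> 0) (at_left 0)"
    by (rule Lim_transform_eventually[OF tendsto_const])
      (auto simp: flat_def eventually_at_left_field intro: exI[of _ "-1"])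
  ultimately show ?thesis by (simp add: filterlim_at_split)
qed

lemma flat_deriv:
  "(flat n has_real_derivative flat (n+2) t - n * flat (n+1) t) (at t)"
proof (cases t "0::real" rule: linorder_cases)
  case less
  then have "((\<lambda>t. 0::real) has_real_derivative flat (n+2) t - n * flat (n+1) t) (at t)"
    by (simp add: flat_def)
  then show ?thesis
    by (rule has_field_derivative_transform_within_open[where S="{..<0}"]) (use less in \<open>auto simp: flat_def\<close>)
next
  case equal
  have "((\<lambda>h. flat n h / h) \<longlongrightarrow> 0) (at 0)"
    by (rule Lim_transform_eventually[OF flat_tendsto_0[of "Suc n"]])
      (auto simp: flat_def eventually_at_filter)
  then show ?thesis using equal by (simp add: has_field_derivative_iff flat_def)
next
  case greater
  have "((\<lambda>t. (1/t)^n * exp (-(1/t))) has_real_derivative flat (n+2) t - n * flat (n+1) t) (at t)"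
    using greater
    apply (auto intro!: derivative_eq_intros simp: flat_def)
    apply (cases n)
     apply (auto simp: field_simps power2_eq_square)
    done
  then show ?thesis
    by (rule has_field_derivative_transform_within_open[where S="{0<..}"]) (use greater in \<open>auto simp: flat_def\<close>)
qed

lemma C_k_flat:
  assumes "\<And>j. C_k j b" shows "C_k k (\<lambda>x. flat n (b x))"
proof (induction k arbitrary: n)
  case 0
  have "continuous_on UNIV (flat n)"
    using flat_deriv DERIV_isCont continuous_at_imp_continuous_on by blast
  then have "continuous_on UNIV (\<lambda>x. flat n (b x))"
    using continuous_on_compose2 C_k_continuous[OF assms[of 0]] by blast
  then show ?case by simp
next
  case (Suc k)
  have b: "b differentiable at x" and kb: "C_k k (partial_deriv i b)" for x i
    using assms[of "Suc k"] by auto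
  have der: "((\<lambda>x. flat n (b x)) has_derivative
       (\<lambda>h. (flat (n+2) (b x) - n * flat (n+1) (b x)) * frechet_derivative b (at x) h)) (at x)" for x
    using has_derivative_compose[OF has_derivative_frechet[OF b]
        flat_deriv[unfolded has_field_derivative_def]] by blast
  have "partial_deriv i (\<lambda>x. flat n (b x)) =
      (\<lambda>x. (flat (n+2) (b x) + (- real n) * flat (n+1) (b x)) * partial_deriv i b x)" for i
    by (rule ext) (subst partial_deriv_eq[OF der], simp add: partial_deriv_def)
  moreover have "(\<lambda>x. flat n (b x)) differentiable at x" for x
    using der differentiable_def by blast
  moreover have "C_k k (\<lambda>x. (flat (n+2) (b x) + (- real n) * flat (n+1) (b x)) * partial_deriv i b x)" for i
    by (intro C_k_mult C_k_add C_k_const Suc.IH kb)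
  ultimately show ?case by simp
qed

text \<open>As \<open>k\<close> grows, each factor tends to \<open>1\<close> where its argument is positive, so that these smooth functions
  approximate the indicator function of the box from below.\<close>

definition box_bump :: "real^'d \<Rightarrow> real^'d \<Rightarrow> nat \<Rightarrow> real^'d \<Rightarrow> real" where
  "box_bump a b k x = (\<Prod>i\<in>UNIV. flat 0 (real k * (x $ i - a $ i)) * flat 0 (real k * (b $ i - x $ i)))"

lemma C_k_box_bump: "C_k j (box_bump a b k)"
proof -
  have 1: "C_k j (\<lambda>x. flat 0 (real k * (x $ i - a $ i)))" for i
    using C_k_flat[OF C_k_affine_coordinate[of _ "real k" i "- real k * a $ i"], of j 0]
    by (simp add: algebra_simps)
  have 2: "C_k j (\<lambda>x. flat 0 (real k * (b $ i - x $ i)))" for i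
    using C_k_flat[OF C_k_affine_coordinate[of _ "- real k" i "real k * b $ i"], of j 0]
    by (simp add: algebra_simps)
  show ?thesis
    unfolding box_bump_def by (intro C_k_prod C_k_mult 1 2) auto
qed

lemma flat_0_bounds: "0 \<le> flat 0 t" "flat 0 t \<le> 1"
  by (auto simp: flat_def)

lemma box_bump_bounds: "0 \<le> box_bump a b k x" "box_bump a b k x \<le> 1"
  unfolding box_bump_def using flat_0_bounds
  by (auto intro!: prod_nonneg prod_le_1 mult_le_one)

lemma box_bump_pos_iff: "k > 0 \<Longrightarrow> box_bump a b k x \<noteq> 0 \<longleftrightarrow> x \<in> box a b"
  by (auto simp: box_bump_def mem_box_cart flat_def zero_less_mult_iff)

lemma box_bump_tendsto: "(\<lambda>k. box_bump a b (Suc k) x) \<longlonglongrightarrow> indicator (box a b) x"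
proof (cases "x \<in> box a b")
  case True
  have *: "(\<lambda>k. flat 0 (real (Suc k) * t)) \<longlonglongrightarrow> 1" if "t > 0" for t
  proof -
    have "(\<lambda>k. exp (- (inverse (real (Suc k)) * (1/t)))) \<longlonglongrightarrow> exp (- (0 * (1/t)))"
      by (intro tendsto_intros LIMSEQ_inverse_real_of_nat)
    then show ?thesis
      using that by (simp add: flat_def zero_less_mult_iff field_simps del: of_nat_Suc)
  qed
  have "(\<lambda>k. box_bump a b (Suc k) x) \<longlonglongrightarrow> (\<Prod>i\<in>(UNIV::'a set). 1 * 1)"
    unfolding box_bump_def using True by (intro tendsto_prod tendsto_mult *) (auto simp: mem_box_cart)
  then show ?thesis using True by simp
next
  case False
  then have "box_bump a b (Suc k) x = 0" for k
    using box_bump_pos_iff[of "Suc k" a b x] by auto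
  then show ?thesis using False by simp
qed

lemma box_bump_test_function:
  assumes "cbox a b \<subseteq> \<Omega>" shows "box_bump a b (Suc k) \<in> test_functions \<Omega>"
proof -
  have "closure {x. box_bump a b (Suc k) x \<noteq> 0} \<subseteq> cbox a b"
    using box_subset_cbox[of a b] by (intro closure_minimal) (auto simp: box_bump_pos_iff)
  then show ?thesis
    using assms C_k_box_bump compact_cbox
    unfolding test_functions_def
    by (auto simp: compact_eq_bounded_closed intro: bounded_subset[OF bounded_cbox])
qed

section \<open>The fundamental lemma of the calculus of variations\<close>

text \<open>By the Lindelof property, countably many of the given neighbourhoods suffice.\<close>

lemma AE_lborel_locally:
  fixes \<Omega> :: "'a::euclidean_space set"
  assumes "\<And>x. x \<in> \<Omega> \<Longrightarrow> \<exists>U. open U \<and> x \<in> U \<and> (AE y in lborel. y \<in> U \<longrightarrow> P y)"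
  shows "AE y in lborel. y \<in> \<Omega> \<longrightarrow> P y"
proof -
  define F where "F = {U. open U \<and> (AE y in lborel. y \<in> U \<longrightarrow> P y)}"
  obtain F' where F': "F' \<subseteq> F" "countable F'" "\<Union>F' = \<Union>F"
    using Lindelof[of F] unfolding F_def by blast
  have "AE y in lborel. \<forall>U\<in>F'. y \<in> U \<longrightarrow> P y"
    using F' by (subst AE_ball_countable) (auto simp: F_def)
  moreover have "\<Omega> \<subseteq> \<Union>F'"
    using assms F'(3) unfolding F_def by blast
  ultimately show ?thesis by (auto elim!: eventually_mono)
qed

lemma open_contains_box_cbox:
  fixes \<Omega> :: "'a::euclidean_space set"
  assumes "open \<Omega>" "x \<in> \<Omega>"
  obtains a b where "x \<in> box a b" "cbox a b \<subseteq> \<Omega>"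
proof -
  obtain e where e: "e > 0" "cball x e \<subseteq> \<Omega>"
    using assms open_contains_cball by blast
  obtain a b where ab: "x \<in> box a b" "box a b \<subseteq> ball x e"
    using rational_boxes[OF e(1), of x] by metis
  have "cbox a b = closure (box a b)"
    using ab closure_box by blast
  also have "\<dots> \<subseteq> cball x e"
    using ab ball_subset_cball by (intro closure_minimal) blast+
  finally show ?thesis using that ab e by blast
qed

text \<open>Dominated convergence along the bumps shows that \<open>g\<close> has integral zero over every box whose closure lies
  in \<open>\<Omega>\<close>. Boxes form an intersection-stable generator of the Borel sets, hence \<open>g\<close> has integral zero
  over every Borel subset of such a box and vanishes almost everywhere on it.\<close>

lemma fundamental_lemma_of_variations:
  fixes g :: "real^'d \<Rightarrow> real"
  assumes g: "integrable lborel g" and \<Omega>: "open \<Omega>"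
    and zero: "\<And>\<phi>. \<phi> \<in> test_functions \<Omega> \<Longrightarrow> (LINT x|lborel. g x * \<phi> x) = 0"
  shows "AE x in lborel. x \<in> \<Omega> \<longrightarrow> g x = 0"
proof (rule AE_lborel_locally)
  have [measurable]: "g \<in> borel_measurable borel" using g by auto
  have integral_box_zero: "(LINT x|lborel. g x * indicator (box a b) x) = 0" if ab: "cbox a b \<subseteq> \<Omega>" for a b
  proof -
    have [measurable]: "box_bump a b k \<in> borel_measurable borel" for k
      using C_k_continuous[OF C_k_box_bump] by (rule borel_measurable_continuous_onI)
    have "(\<lambda>k. LINT x|lborel. g x * box_bump a b (Suc k) x)
        \<longlonglongrightarrow> (LINT x|lborel. g x * indicator (box a b) x)"
    proof (rule integral_dominated_convergence[where w="\<lambda>x. norm (g x)"])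
      show "AE x in lborel. norm (g x * box_bump a b (Suc k) x) \<le> norm (g x)" for k
        using box_bump_bounds[of a b "Suc k"] by (auto simp: abs_mult intro!: mult_left_le)
    qed (use g in \<open>auto intro!: tendsto_intros box_bump_tendsto\<close>)
    then show ?thesis
      using zero[OF box_bump_test_function[OF ab]] by (simp add: LIMSEQ_const_iff)
  qed
  fix x assume "x \<in> \<Omega>"
  then obtain c d where cd: "x \<in> box c d" "cbox c d \<subseteq> \<Omega>"
    using open_contains_box_cbox \<Omega> by metis
  define h where "h x = g x * indicator (box c d) x" for x
  have h: "integrable lborel h"
    unfolding h_def using g by (rule Bochner_Integration.integrable_bound) (auto simp: indicator_def)
  have si: "set_integrable lborel A h" if "A \<in> sets borel" for A
    unfolding set_integrable_def using h that by (intro integrable_mult_indicator) auto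
  have "(LINT x:A|lborel. h x) = 0" if A: "A \<in> sets borel" for A
  proof -
    let ?G = "range (\<lambda>(a, b). box a b :: (real^'d) set)"
    have "A \<in> sigma_sets UNIV ?G" using A by (simp add: borel_eq_box)
    have stable: "Int_stable ?G" by (auto simp: Int_stable_def box_Int_box)
    have "?G \<subseteq> Pow UNIV" by simp
    from stable this \<open>A \<in> sigma_sets UNIV ?G\<close> show ?thesis
    proof (induction A rule: sigma_sets_induct_disjoint)
      case (basic A)
      then obtain a b where "A = box a b" by auto
      moreover obtain a' b' where ab': "box a b \<inter> box c d = box a' b'" "box a' b' \<subseteq> box c d"
      proof -
        have "\<exists>a' b'. box a b \<inter> box c d = box a' b'" unfolding box_Int_box by blast
        then show ?thesis using that Int_lower2 by metis
      qed
      moreover have "(LINT x|lborel. g x * indicator (box a' b') x) = 0"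
      proof (cases "box a' b' = {}")
        case False
        then have "cbox a' b' \<subseteq> cbox c d"
          using closure_mono[OF ab'(2)] closure_box[of a' b'] closure_minimal[OF box_subset_cbox[of c d]]
          by (auto simp: closed_cbox)
        then show ?thesis using integral_box_zero cd by blast
      qed simp
      ultimately show ?case
        by (simp add: set_lebesgue_integral_def h_def indicator_inter_arith[symmetric] mult_ac)
    next
      case (compl A)
      then have "A \<in> sets borel" by (simp add: borel_eq_box)
      have "(LINT x:UNIV|lborel. h x) = (LINT x:A \<union> (UNIV - A)|lborel. h x)" by simp
      also have "\<dots> = (LINT x:A|lborel. h x) + (LINT x:(UNIV - A)|lborel. h x)"
        using \<open>A \<in> sets borel\<close> by (intro set_integral_Un si) auto
      finally show ?case using compl integral_box_zero[OF cd(2)] by (simp add: h_def[abs_def] set_lebesgue_integral_def)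
    next
      case (union A)
      then have "A i \<in> sets borel" for i by (auto simp: borel_eq_box)
      then have "(LINT x:(\<Union>i. A i)|lborel. h x) = (\<Sum>i. (LINT x:A i|lborel. h x))"
        using union by (intro lebesgue_integral_countable_add si)
          (auto simp: disjoint_family_on_def)
      then show ?case using union by simp
    qed (simp add: set_lebesgue_integral_def)
  qed
  then have "AE x in lborel. h x = 0"
    using sigma_finite_measure.density_zero[OF sigma_finite_lborel h] by simp
  then have "AE y in lborel. y \<in> box c d \<longrightarrow> g y = 0"
    by eventually_elim (auto simp: h_def indicator_def split: if_splits)
  then show "\<exists>U. open U \<and> x \<in> U \<and> (AE y in lborel. y \<in> U \<longrightarrow> g y = 0)"
    using cd by blast
qed

text \<open>Integrals over a domain are taken with respect to the completed measure, whereas product measures and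
  translations call for Borel functions; this lemma passes from one to the other.\<close>

lemma lebesgue_on_borel_representative:
  fixes g :: "real^'d \<Rightarrow> real"
  assumes \<Omega>: "\<Omega> \<in> sets lebesgue" and g: "integrable (lebesgue_on \<Omega>) g"
  obtains g' where "integrable lborel g'" "AE x in lborel. x \<in> \<Omega> \<longrightarrow> g x = g' x"
    "\<forall>\<psi> \<in> borel_measurable borel.
       (LINT x|lebesgue_on \<Omega>. g x * \<psi> x) = (LINT x|lborel. g' x * \<psi> x)"
proof -
  let ?h = "\<lambda>x. indicator \<Omega> x * g x"
  have h: "integrable lebesgue ?h"
    using g \<Omega> by (simp add: integrable_restrict_space)
  then obtain g' where g': "g' \<in> borel_measurable lborel" "AE x in lborel. ?h x = g' x"
    using completion_ex_borel_measurable_real[of ?h lborel] by auto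
  have ae: "AE x in lebesgue. ?h x = g' x" using g'(2) by (rule AE_completion)
  have "integrable lebesgue g'"
    using integrable_cong_AE_imp[OF h, of g'] g' ae by (auto simp: eq_commute measurable_completion)
  then have "integrable lborel g'" using integrable_completion[OF g'(1)] by simp
  moreover have "AE x in lborel. x \<in> \<Omega> \<longrightarrow> g x = g' x"
    using g'(2) by eventually_elim auto
  moreover have "(LINT x|lebesgue_on \<Omega>. g x * \<psi> x) = (LINT x|lborel. g' x * \<psi> x)"
    if \<psi>: "\<psi> \<in> borel_measurable borel" for \<psi>
  proof -
    have "(LINT x|lebesgue_on \<Omega>. g x * \<psi> x) = (LINT x|lebesgue. ?h x * \<psi> x)"
      using \<Omega> by (simp add: integral_restrict_space mult.assoc)
    also have "\<dots> = (LINT x|lebesgue. g' x * \<psi> x)"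
    proof (rule integral_cong_AE)
      have "\<psi> \<in> borel_measurable lebesgue" using \<psi> by (simp add: measurable_completion)
      then show "(\<lambda>x. ?h x * \<psi> x) \<in> borel_measurable lebesgue"
          "(\<lambda>x. g' x * \<psi> x) \<in> borel_measurable lebesgue"
        using h g'(1) by (auto intro!: borel_measurable_times intro: measurable_completion)
    qed (use ae in \<open>auto elim: eventually_mono\<close>)
    also have "\<dots> = (LINT x|lborel. g' x * \<psi> x)"
      using g'(1) \<psi> by (intro integral_completion) auto
    finally show ?thesis .
  qed
  ultimately show ?thesis using that by blast
qed

lemma AE_lebesgue_on_iff:
  assumes "\<Omega> \<in> sets lebesgue"
  shows "(AE x in lebesgue_on \<Omega>. P x) \<longleftrightarrow> (AE x in lborel. x \<in> \<Omega> \<longrightarrow> P x)"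
  using assms by (simp add: AE_restrict_space_iff AE_completion_iff)

section \<open>Functions with zero weak gradient are constant\<close>

lemma test_function_C_k: "\<phi> \<in> test_functions \<Omega> \<Longrightarrow> C_k k \<phi>"
  by (simp add: test_functions_def)

lemma test_function_borel [measurable]:
  "\<phi> \<in> test_functions \<Omega> \<Longrightarrow> \<phi> \<in> borel_measurable borel"
  using C_k_continuous test_function_C_k borel_measurable_continuous_onI by metis

lemma test_functions_mono: "A \<subseteq> B \<Longrightarrow> test_functions A \<subseteq> test_functions B"
  by (auto simp: test_functions_def)

lemma test_function_bounded:
  assumes "\<phi> \<in> test_functions \<Omega>" obtains B where "0 \<le> B" "\<And>x. \<bar>\<phi> x\<bar> \<le> B"
proof -
  let ?K = "closure {x. \<phi> x \<noteq> 0}"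
  have "continuous_on ?K \<phi>"
    using C_k_continuous[OF test_function_C_k[OF assms]] continuous_on_subset by blast
  then have "bounded (\<phi> ` ?K)"
    using assms by (intro compact_imp_bounded compact_continuous_image) (auto simp: test_functions_def)
  then obtain B where B: "\<And>x. x \<in> ?K \<Longrightarrow> \<bar>\<phi> x\<bar> \<le> B" by (auto simp: bounded_iff)
  have "\<bar>\<phi> x\<bar> \<le> \<bar>B\<bar>" for x
    using B[of x] closure_subset[of "{x. \<phi> x \<noteq> 0}"] by (cases "\<phi> x = 0") auto
  then show ?thesis using that[of "\<bar>B\<bar>"] by auto
qed

lemma test_function_has_derivative:
  assumes "\<phi> \<in> test_functions \<Omega>"
  shows "(\<phi> has_derivative (\<lambda>h. \<Sum>i\<in>UNIV. h $ i * partial_deriv i \<phi> x)) (at x)"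
proof -
  have d: "(\<phi> has_derivative frechet_derivative \<phi> (at x)) (at x)"
    using test_function_C_k[OF assms, of "Suc 0"] by (intro has_derivative_frechet) simp
  have "frechet_derivative \<phi> (at x) h = (\<Sum>i\<in>UNIV. h $ i * partial_deriv i \<phi> x)" for h
  proof -
    have "h = (\<Sum>i\<in>UNIV. h $ i *\<^sub>R axis i 1)"
      by (simp add: basis_expansion[of h, unfolded scalar_mult_eq_scaleR])
    then have "frechet_derivative \<phi> (at x) h = frechet_derivative \<phi> (at x) (\<Sum>i\<in>UNIV. h $ i *\<^sub>R axis i 1)"
      by simp
    also have "\<dots> = (\<Sum>i\<in>UNIV. h $ i * partial_deriv i \<phi> x)"
      using has_derivative_linear[OF d] by (simp add: linear_sum linear_cmul partial_deriv_def)
    finally show ?thesis .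
  qed
  then have "frechet_derivative \<phi> (at x) = (\<lambda>h. \<Sum>i\<in>UNIV. h $ i * partial_deriv i \<phi> x)" by blast
  with d show ?thesis by simp
qed

lemma test_function_partial_deriv:
  assumes "\<phi> \<in> test_functions \<Omega>" shows "partial_deriv i \<phi> \<in> test_functions \<Omega>"
proof -
  let ?K = "closure {x. \<phi> x \<noteq> 0}"
  have "partial_deriv i \<phi> x = 0" if "x \<notin> ?K" for x
  proof -
    have "((\<lambda>x. 0) has_derivative (\<lambda>h. 0)) (at x)" by simp
    then have "(\<phi> has_derivative (\<lambda>h. 0)) (at x)"
      by (rule has_derivative_transform_within_open[where s="- ?K"])
        (use that closure_subset[of "{x. \<phi> x \<noteq> 0}"] in auto)
    then show ?thesis by (simp add: partial_deriv_eq)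
  qed
  then have sub: "closure {x. partial_deriv i \<phi> x \<noteq> 0} \<subseteq> ?K"
    by (intro closure_minimal) auto
  moreover have "compact (closure {x. partial_deriv i \<phi> x \<noteq> 0})"
    using sub assms by (auto simp: test_functions_def compact_eq_bounded_closed intro: bounded_subset)
  moreover have "C_k k (partial_deriv i \<phi>)" for k
    using test_function_C_k[OF assms, of "Suc k"] by simp
  ultimately show ?thesis using assms by (auto simp: test_functions_def)
qed

lemma test_function_translate:
  assumes "\<phi> \<in> test_functions A" "(\<lambda>y. y + x) ` A \<subseteq> B"
  shows "(\<lambda>y. \<phi> (y - x)) \<in> test_functions B"
    and "partial_deriv i (\<lambda>y. \<phi> (y - x)) = (\<lambda>y. partial_deriv i \<phi> (y - x))"
proof -
  have der: "((\<lambda>y. p (y - x)) has_derivative frechet_derivative p (at (y - x))) (at y)"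
    if "p differentiable at (y - x)" for p :: "real^'a \<Rightarrow> real" and y
  proof -
    have "((\<lambda>y. y - x) has_derivative (\<lambda>h. h)) (at y)"
      by (auto intro!: derivative_eq_intros)
    from has_derivative_compose[OF this has_derivative_frechet[OF that]] show ?thesis .
  qed
  have pd: "partial_deriv i (\<lambda>y. p (y - x)) = (\<lambda>y. partial_deriv i p (y - x))"
    if "\<And>y. p differentiable at y" for p :: "real^'a \<Rightarrow> real" and i
    using partial_deriv_eq[OF der[OF that]] by (auto simp: partial_deriv_def fun_eq_iff)
  have Ck: "C_k k (\<lambda>y. p (y - x))" if "C_k k p" for k and p :: "real^'a \<Rightarrow> real"
    using that
  proof (induction k arbitrary: p)
    case 0
    then show ?case by (auto intro!: continuous_intros intro: continuous_on_compose2[of UNIV p])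
  next
    case (Suc k)
    then have "\<And>y. p differentiable at y" by simp
    then have "(\<lambda>y. p (y - x)) differentiable at y" for y
      using der differentiable_def by blast
    then show ?case using Suc pd[of p] by auto
  qed
  show "partial_deriv i (\<lambda>y. \<phi> (y - x)) = (\<lambda>y. partial_deriv i \<phi> (y - x))"
    using pd test_function_C_k[OF assms(1), of "Suc 0"] by simp
  have "{y. \<phi> (y - x) \<noteq> 0} = (+) x ` {y. \<phi> y \<noteq> 0}"
    by (auto simp: image_iff) (metis add_diff_cancel_left' diff_add_cancel add.commute)
  then have cl: "closure {y. \<phi> (y - x) \<noteq> 0} = (+) x ` closure {y. \<phi> y \<noteq> 0}"
    by (simp add: closure_translation)
  have cpt: "compact ((+) x ` closure {y. \<phi> y \<noteq> 0})"
    using assms(1) unfolding test_functions_def by (intro compact_translation) blast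
  have sub: "(+) x ` closure {y. \<phi> y \<noteq> 0} \<subseteq> B"
    using assms unfolding test_functions_def by (auto simp: add.commute)
  have "C_k k (\<lambda>y. \<phi> (y - x))" for k using Ck test_function_C_k[OF assms(1)] .
  then show "(\<lambda>y. \<phi> (y - x)) \<in> test_functions B"
    unfolding test_functions_def mem_Collect_eq cl using cpt sub by blast
qed

lemma test_function_lipschitz:
  assumes "\<phi> \<in> test_functions \<Omega>" obtains K where "0 \<le> K" "\<And>x y. \<bar>\<phi> x - \<phi> y\<bar> \<le> K * norm (x - y)"
proof -
  have "\<forall>i. \<exists>B. 0 \<le> B \<and> (\<forall>x. \<bar>partial_deriv i \<phi> x\<bar> \<le> B)"
    using test_function_bounded test_function_partial_deriv[OF assms] by metis
  then obtain B where B: "\<And>i. 0 \<le> B i" "\<And>i x. \<bar>partial_deriv i \<phi> x\<bar> \<le> B i" by metis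
  let ?K = "\<Sum>i\<in>UNIV. B i"
  have "onorm (\<lambda>h. \<Sum>i\<in>UNIV. h $ i * partial_deriv i \<phi> x) \<le> ?K" for x
  proof (rule onorm_le)
    fix h
    have "norm (\<Sum>i\<in>UNIV. h $ i * partial_deriv i \<phi> x) \<le> (\<Sum>i\<in>UNIV. norm h * B i)"
      using B by (intro sum_norm_le) (auto simp: abs_mult intro!: mult_mono component_le_norm_cart)
    then show "norm (\<Sum>i\<in>UNIV. h $ i * partial_deriv i \<phi> x) \<le> ?K * norm h"
      by (simp add: sum_distrib_left mult.commute)
  qed
  then have "\<bar>\<phi> x - \<phi> y\<bar> \<le> ?K * norm (x - y)" for x y
    using differentiable_bound[of UNIV \<phi> "\<lambda>x h. \<Sum>i\<in>UNIV. h $ i * partial_deriv i \<phi> x"]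
      test_function_has_derivative[OF assms] by auto
  moreover have "0 \<le> ?K" using B by (simp add: sum_nonneg)
  ultimately show ?thesis using that by blast
qed

text \<open>The uniform quadratic remainder takes the place of differentiation under the integral sign.\<close>

lemma test_function_taylor:
  assumes "\<phi> \<in> test_functions \<Omega>"
  obtains K where "0 \<le> K"
    "\<And>z h. \<bar>\<phi> (z + h) - \<phi> z - (\<Sum>i\<in>UNIV. h $ i * partial_deriv i \<phi> z)\<bar> \<le> K * (norm h)\<^sup>2"
proof -
  have "\<forall>i. \<exists>B. 0 \<le> B \<and> (\<forall>x y. \<bar>partial_deriv i \<phi> x - partial_deriv i \<phi> y\<bar> \<le> B * norm (x - y))"
    using test_function_lipschitz test_function_partial_deriv[OF assms] by metis
  then obtain B where B: "\<And>i. 0 \<le> B i"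
    "\<And>i x y. \<bar>partial_deriv i \<phi> x - partial_deriv i \<phi> y\<bar> \<le> B i * norm (x - y)" by metis
  let ?K = "\<Sum>i\<in>UNIV. B i"
  let ?D = "\<lambda>x h. \<Sum>i\<in>UNIV. h $ i * partial_deriv i \<phi> x"
  have "\<bar>\<phi> (z + h) - \<phi> z - ?D z h\<bar> \<le> ?K * (norm h)\<^sup>2" for z h
  proof -
    have "norm (\<phi> (z + h) - \<phi> z - ?D z (z + h - z)) \<le> norm (z + h - z) * (?K * norm h)"
    proof (rule differentiable_bound_linearization[where S="cball z (norm h)"])
      show "z + t *\<^sub>R (z + h - z) \<in> cball z (norm h)" if "t \<in> {0..1}" for t
        using that by (simp add: dist_norm mult_left_le_one_le)
      show "(\<phi> has_derivative ?D x) (at x within cball z (norm h))" for x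
        using test_function_has_derivative[OF assms] has_derivative_at_withinI by blast
      show "onorm (?D x - ?D z) \<le> ?K * norm h" if x: "x \<in> cball z (norm h)" for x
      proof (rule onorm_le)
        fix k
        have "(?D x - ?D z) k = (\<Sum>i\<in>UNIV. k $ i * (partial_deriv i \<phi> x - partial_deriv i \<phi> z))"
          by (simp add: sum_subtractf right_diff_distrib)
        moreover have "norm (\<Sum>i\<in>UNIV. k $ i * (partial_deriv i \<phi> x - partial_deriv i \<phi> z))
            \<le> (\<Sum>i\<in>UNIV. norm k * (B i * norm h))"
        proof (rule sum_norm_le)
          fix i
          have "\<bar>partial_deriv i \<phi> x - partial_deriv i \<phi> z\<bar> \<le> B i * norm h"
            using B(2)[of i x z] x mult_left_mono[OF _ B(1)[of i], of "norm (x - z)" "norm h"]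
            by (auto simp: dist_norm norm_minus_commute)
          then show "norm (k $ i * (partial_deriv i \<phi> x - partial_deriv i \<phi> z)) \<le> norm k * (B i * norm h)"
            by (auto simp: abs_mult intro!: mult_mono component_le_norm_cart)
        qed
        ultimately show "norm ((?D x - ?D z) k) \<le> ?K * norm h * norm k"
          by (simp add: sum_distrib_right sum_distrib_left mult_ac)
      qed
    qed simp
    then show ?thesis by (simp add: power2_eq_square mult_ac)
  qed
  moreover have "0 \<le> ?K" using B by (simp add: sum_nonneg)
  ultimately show ?thesis using that by blast
qed

lemma integrable_mult_bounded:
  fixes f :: "'a \<Rightarrow> real"
  assumes "integrable M f" "g \<in> borel_measurable M" "\<And>x. \<bar>g x\<bar> \<le> B"
  shows "integrable M (\<lambda>x. f x * g x)"
proof (rule Bochner_Integration.integrable_bound[of M "\<lambda>x. B * f x"])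
  show "AE x in M. norm (f x * g x) \<le> norm (B * f x)"
  proof (rule AE_I2)
    fix x
    have "\<bar>g x\<bar> \<le> \<bar>B\<bar>" using assms(3)[of x] by linarith
    then show "norm (f x * g x) \<le> norm (B * f x)"
      by (simp add: abs_mult mult.commute[of "\<bar>f x\<bar>"] mult_right_mono)
  qed
qed (use assms in auto)

lemma integrable_mult_translated_test_function:
  assumes "integrable lborel f" "\<phi> \<in> test_functions \<Omega>"
  shows "integrable lborel (\<lambda>y. f y * \<phi> (y - x))"
proof -
  obtain B where "0 \<le> B" "\<And>x. \<bar>\<phi> x\<bar> \<le> B" using test_function_bounded assms by metis
  moreover have [measurable]: "\<phi> \<in> borel_measurable borel" using assms by auto
  ultimately show ?thesis using assms by (intro integrable_mult_bounded) auto
qed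

text \<open>As a function of the shift \<open>x\<close>, the average has derivative zero: the linear part of its increment is
  an integral of \<open>f\<close> against derivatives of test functions, and the Taylor remainder is
  quadratic.\<close>

lemma moving_average_constant:
  fixes f :: "real^'d \<Rightarrow> real"
  assumes f: "integrable lborel f"
    and zero: "\<And>\<psi> i. \<psi> \<in> test_functions (ball a (2*r)) \<Longrightarrow> (LINT y|lborel. f y * partial_deriv i \<psi> y) = 0"
    and \<phi>: "\<phi> \<in> test_functions (ball 0 r)" and x: "x \<in> ball a r"
  shows "(LINT y|lborel. f y * \<phi> (y - x)) = (LINT y|lborel. f y * \<phi> (y - a))"
proof -
  define G where "G x = (LINT y|lborel. f y * \<phi> (y - x))" for x
  obtain K where K: "0 \<le> K"
    "\<And>z h. \<bar>\<phi> (z + h) - \<phi> z - (\<Sum>i\<in>UNIV. h $ i * partial_deriv i \<phi> z)\<bar> \<le> K * (norm h)\<^sup>2"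
    using test_function_taylor[OF \<phi>] by metis
  let ?C = "K * (LINT y|lborel. \<bar>f y\<bar>)"
  have G: "\<bar>G (x + h) - G x\<bar> \<le> ?C * (norm h)\<^sup>2" if x: "x \<in> ball a r" for x h
  proof -
    let ?t = "\<lambda>y. \<phi> (y - (x + h)) - \<phi> (y - x) - (\<Sum>i\<in>UNIV. (- h) $ i * partial_deriv i \<phi> (y - x))"
    have i0: "(LINT y|lborel. f y * partial_deriv i \<phi> (y - x)) = 0" for i
    proof -
      have "(\<lambda>y. y + x) ` ball 0 r \<subseteq> ball a (2*r)"
      proof safe
        fix y :: "real^'d" assume "y \<in> ball 0 r"
        then show "y + x \<in> ball a (2*r)"
          using x norm_triangle_ineq[of "-y" "a - x"] by (simp add: dist_norm algebra_simps)
      qed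
      from test_function_translate[OF \<phi> this] zero[of "\<lambda>y. \<phi> (y - x)" i] show ?thesis by simp
    qed
    have int: "integrable lborel (\<lambda>y. f y * \<phi> (y - z))"
       "integrable lborel (\<lambda>y. f y * partial_deriv i \<phi> (y - z))" for z i
      using integrable_mult_translated_test_function[OF f \<phi>] integrable_mult_translated_test_function[OF f test_function_partial_deriv[OF \<phi>]] by auto
    have "G (x + h) - G x = (LINT y|lborel. f y * \<phi> (y - (x + h)) - f y * \<phi> (y - x)
        - (\<Sum>i\<in>UNIV. (- h $ i) * (f y * partial_deriv i \<phi> (y - x))))"
      unfolding G_def using int i0 by (subst Bochner_Integration.integral_diff | simp)+
    also have "\<dots> = (LINT y|lborel. f y * ?t y)"
      by (simp add: algebra_simps sum_distrib_left sum_negf)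
    finally have eq: "G (x + h) - G x = (LINT y|lborel. f y * ?t y)" .
    have "\<bar>LINT y|lborel. f y * ?t y\<bar> \<le> (LINT y|lborel. (K * (norm h)\<^sup>2) * \<bar>f y\<bar>)"
    proof (rule integral_abs_bound_integral)
      have "integrable lborel (\<lambda>y. f y * \<phi> (y - (x + h)) - f y * \<phi> (y - x)
        - (\<Sum>i\<in>UNIV. (- h $ i) * (f y * partial_deriv i \<phi> (y - x))))"
        using int by auto
      then show "integrable lborel (\<lambda>y. f y * ?t y)"
        by (simp add: algebra_simps sum_distrib_left sum_negf)
      show "\<bar>f y * ?t y\<bar> \<le> K * (norm h)\<^sup>2 * \<bar>f y\<bar>" for y
      proof -
        have "\<bar>?t y\<bar> \<le> K * (norm h)\<^sup>2" using K(2)[of "y - x" "- h"] by (simp add: algebra_simps)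
        then show ?thesis by (simp only: abs_mult mult.commute[of "\<bar>f y\<bar>"] mult_right_mono abs_ge_zero)
      qed
    qed (use f in auto)
    then show ?thesis unfolding eq by (simp add: mult_ac)
  qed
  have "(G has_derivative (\<lambda>h. 0)) (at x within ball a r)" if "x \<in> ball a r" for x
  proof -
    have "((\<lambda>y. (G y - G x) /\<^sub>R norm (y - x)) \<longlongrightarrow> 0) (at x)"
    proof (rule Lim_null_comparison)
      show "\<forall>\<^sub>F y in at x. norm ((G y - G x) /\<^sub>R norm (y - x)) \<le> ?C * norm (y - x)"
      proof (rule always_eventually, rule allI)
        fix y
        show "norm ((G y - G x) /\<^sub>R norm (y - x)) \<le> ?C * norm (y - x)"
          using G[OF that, of "y - x"]
          by (cases "y = x") (auto simp: field_simps power2_eq_square)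
      qed
      have "((\<lambda>y. ?C * norm (y - x)) \<longlongrightarrow> ?C * norm (x - x)) (at x)" by (intro tendsto_intros)
      then show "((\<lambda>y. ?C * norm (y - x)) \<longlongrightarrow> 0) (at x)" by simp
    qed
    then have "(G has_derivative (\<lambda>h. 0)) (at x)"
      by (simp add: has_derivative_at_within)
    then show ?thesis by (rule has_derivative_at_withinI)
  qed
  then obtain c where "\<And>x. x \<in> ball a r \<Longrightarrow> G x = c"
    using has_derivative_zero_constant[OF convex_ball] by blast
  moreover have "a \<in> ball a r" using x by (simp, metis dist_not_less_zero le_less_trans not_less zero_le_dist)
  ultimately show ?thesis using x unfolding G_def by metis
qed

lemma lborel_integral_reflect:
  fixes g :: "'a::euclidean_space \<Rightarrow> real"
  assumes [measurable]: "g \<in> borel_measurable borel"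
  shows "(LINT x|lborel. g (c - x)) = (LINT x|lborel. g x)"
proof -
  have eq: "lborel = distr lborel borel (\<lambda>x::'a. c - x)"
    using lborel_affine[of "-1" c] by (simp add: density_1)
  have "(LINT x|lborel. g x) = (LINT x|distr lborel borel (\<lambda>x::'a. c - x). g x)"
    using eq by simp
  also have "\<dots> = (LINT x|lborel. g (c - x))" by (intro integral_distr) auto
  finally show ?thesis by simp
qed

lemma test_function_integrable:
  assumes "\<phi> \<in> test_functions \<Omega>" shows "integrable lborel \<phi>"
proof -
  let ?K = "closure {x. \<phi> x \<noteq> 0}"
  obtain B where B: "0 \<le> B" "\<And>x. \<bar>\<phi> x\<bar> \<le> B" using test_function_bounded assms by metis
  have "compact ?K" using assms by (simp add: test_functions_def)
  then have "integrable lborel (\<lambda>x. indicator ?K x :: real)"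
    using emeasure_compact_finite[of ?K] by auto
  from integrable_mult_bounded[OF this _ B(2)] assms
  have "integrable lborel (\<lambda>x. indicator ?K x * \<phi> x)" by auto
  moreover have "(\<lambda>x. indicator ?K x * \<phi> x) = \<phi>"
    using closure_subset[of "{x. \<phi> x \<noteq> 0}"] by (auto simp: indicator_def fun_eq_iff)
  ultimately show ?thesis by simp
qed

text \<open>Both sides integrate \<open>f\<close> against the convolution of \<open>\<phi>\<close> and \<open>\<eta>\<close>, which is commutative.\<close>

lemma moving_average_symmetric:
  fixes f :: "real^'d \<Rightarrow> real"
  assumes f: "integrable lborel f"
    and \<phi>: "\<phi> \<in> test_functions A" and \<eta>: "\<eta> \<in> test_functions B"
  shows "(LINT x|lborel. \<eta> x * (LINT y|lborel. f y * \<phi> (y - (a + x)))) =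
         (LINT x|lborel. \<phi> x * (LINT y|lborel. f y * \<eta> (y - (a + x))))"
proof -
  have [measurable]: "f \<in> borel_measurable borel" "\<phi> \<in> borel_measurable borel" "\<eta> \<in> borel_measurable borel"
    using assms by auto
  have swap: "(LINT x|lborel. \<beta> x * (LINT y|lborel. f y * \<alpha> (y - (a + x)))) =
      (LINT y|lborel. f y * (LINT x|lborel. \<alpha> (y - (a + x)) * \<beta> x))"
    if \<alpha>: "\<alpha> \<in> test_functions A" and \<beta>: "\<beta> \<in> test_functions B" for \<alpha> \<beta> :: "real^'d \<Rightarrow> real" and A B
  proof -
    have [measurable]: "\<alpha> \<in> borel_measurable borel" "\<beta> \<in> borel_measurable borel"
      using \<alpha> \<beta> by auto
    obtain M where M: "0 \<le> M" "\<And>x. \<bar>\<alpha> x\<bar> \<le> M" using test_function_bounded \<alpha> by metis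
    have "integrable (lborel \<Otimes>\<^sub>M lborel) (\<lambda>(x, y). \<beta> x * f y)"
    proof (rule lborel_pair.Fubini_integrable)
      show "integrable lborel (\<lambda>x. LINT y|lborel. norm (case (x, y) of (x, y) \<Rightarrow> \<beta> x * f y))"
        using test_function_integrable[OF \<beta>] by (auto simp: abs_mult)
    qed (use f in auto)
    from integrable_mult_bounded[OF this, of "\<lambda>(x, y). \<alpha> (y - (a + x))" M] M(2)
    have "integrable (lborel \<Otimes>\<^sub>M lborel) (\<lambda>(x, y). \<beta> x * (f y * \<alpha> (y - (a + x))))"
      by (simp add: case_prod_unfold mult.assoc)
    from lborel_pair.Fubini_integral[OF this]
    have "(LINT x|lborel. LINT y|lborel. \<beta> x * (f y * \<alpha> (y - (a + x)))) =
      (LINT y|lborel. LINT x|lborel. f y * (\<alpha> (y - (a + x)) * \<beta> x))" by (simp add: mult_ac)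
    then show ?thesis by simp
  qed
  have "(LINT x|lborel. \<phi> (y - (a + x)) * \<eta> x) = (LINT x|lborel. \<eta> (y - (a + x)) * \<phi> x)" for y
    using lborel_integral_reflect[of "\<lambda>x. \<phi> (y - (a + x)) * \<eta> x" "y - a"]
    by (simp add: algebra_simps)
  then show ?thesis using swap[OF \<phi> \<eta>] swap[OF \<eta> \<phi>] by simp
qed

lemma AE_not_open:
  fixes U :: "'a::euclidean_space set"
  assumes "open U" "U \<noteq> {}" "AE x in lborel. x \<in> U \<longrightarrow> P" shows P
proof (rule ccontr)
  assume "\<not> P"
  with assms have "AE x in lborel. x \<notin> U" by auto
  then have "AE x in lebesgue. x \<notin> U" by (rule AE_completion)
  then have "negligible U"
    using assms(1) by (simp add: negligible_iff_null_sets AE_iff_null_sets[symmetric])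
  then show False using open_not_negligible assms by blast
qed

lemma test_function_nonzero_integral:
  assumes "0 < r" obtains \<eta> :: "real^'d \<Rightarrow> real"
  where "\<eta> \<in> test_functions (ball 0 r)" "(LINT x|lborel. \<eta> x) \<noteq> 0"
proof -
  obtain a b :: "real^'d" where ab: "0 \<in> box a b" "cbox a b \<subseteq> ball 0 r"
    using open_contains_box_cbox[OF open_ball, of 0 "0::real^'d" r] assms by auto
  let ?\<eta> = "box_bump a b (Suc 0)"
  have t: "?\<eta> \<in> test_functions (ball 0 r)" using box_bump_test_function[OF ab(2)] .
  have "(LINT x|lborel. ?\<eta> x) \<noteq> 0"
  proof
    assume "(LINT x|lborel. ?\<eta> x) = 0"
    then have "AE x in lborel. ?\<eta> x = 0"
      using integral_nonneg_eq_0_iff_AE[OF test_function_integrable[OF t]] box_bump_bounds(1)[of a b "Suc 0"]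
      by simp
    then have "AE x in lborel. x \<in> box a b \<longrightarrow> False"
      by eventually_elim (use box_bump_pos_iff[of "Suc 0" a b] in auto)
    from AE_not_open[OF open_box _ this] show False using ab by blast
  qed
  with t show ?thesis using that by blast
qed

text \<open>Let \<open>G \<phi> a\<close> be the average of \<open>f\<close> against \<open>\<phi>\<close> shifted to \<open>a\<close>. Since averages do not
  change under small shifts, symmetry of the convolution gives
  \<open>G \<phi> a \<cdot> \<integral>\<eta> = G \<eta> a \<cdot> \<integral>\<phi>\<close> for all \<open>\<phi>\<close> and \<open>\<eta>\<close> with small support. Fixing \<open>\<eta>\<close>, this says
  that \<open>f\<close> minus a constant is orthogonal to all test functions on a ball, so that \<open>f\<close> is constant there.
  Connectedness joins the local constants.\<close>

lemma zero_weak_gradient_imp_constant: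
  fixes f :: "real^'d \<Rightarrow> real"
  assumes f: "integrable lborel f" and \<Omega>: "open \<Omega>" "connected \<Omega>"
    and zero: "\<And>\<psi> i. \<psi> \<in> test_functions \<Omega> \<Longrightarrow> (LINT y|lborel. f y * partial_deriv i \<psi> y) = 0"
  obtains c where "AE x in lborel. x \<in> \<Omega> \<longrightarrow> f x = c"
proof -
  have loc: "\<exists>c. \<exists>r>0. ball a r \<subseteq> \<Omega> \<and> (AE x in lborel. x \<in> ball a r \<longrightarrow> f x = c)" if a: "a \<in> \<Omega>" for a
  proof -
    obtain e where e: "e > 0" "ball a e \<subseteq> \<Omega>" using \<Omega> a open_contains_ball by blast
    define r where "r = e / 2"
    have r: "0 < r" "ball a (2*r) \<subseteq> \<Omega>" "ball a r \<subseteq> \<Omega>" using e by (auto simp: r_def)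
    have zero': "(LINT y|lborel. f y * partial_deriv i \<psi> y) = 0" if "\<psi> \<in> test_functions (ball a (2*r))" for \<psi> i
      using zero that test_functions_mono[OF r(2)] by blast
    define G where "G \<phi> x = (LINT y|lborel. f y * \<phi> (y - x))" for \<phi> x
    have sym: "G \<phi> a * (LINT x|lborel. \<eta> x) = G \<eta> a * (LINT x|lborel. \<phi> x)"
      if t: "\<phi> \<in> test_functions (ball 0 r)" "\<eta> \<in> test_functions (ball 0 r)" for \<phi> \<eta>
    proof -
      have const: "\<beta> x * G \<alpha> (a + x) = \<beta> x * G \<alpha> a"
        if "\<alpha> \<in> test_functions (ball 0 r)" "\<beta> \<in> test_functions (ball 0 r)" for \<alpha> \<beta> x
      proof (cases "\<beta> x = 0")
        case False
        then have "x \<in> ball 0 r"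
          using that(2) closure_subset[of "{x. \<beta> x \<noteq> 0}"] by (auto simp: test_functions_def)
        then show ?thesis
          using moving_average_constant[OF f, of a r \<alpha> "a + x"] zero' that(1) unfolding G_def by (simp add: dist_norm)
      qed simp
      have "(LINT x|lborel. \<eta> x * G \<phi> (a + x)) = (LINT x|lborel. \<phi> x * G \<eta> (a + x))"
        unfolding G_def by (rule moving_average_symmetric[OF f t])
      then show ?thesis using const t by (simp add: mult.commute)
    qed
    obtain \<eta> :: "real^'d \<Rightarrow> real"
      where \<eta>: "\<eta> \<in> test_functions (ball 0 r)" "(LINT x|lborel. \<eta> x) \<noteq> 0"
      using test_function_nonzero_integral[OF r(1)] by metis
    define c where "c = G \<eta> a / (LINT x|lborel. \<eta> x)"
    \<comment> \<open>The factor makes the difference integrable; test functions on the ball do not see it.\<close>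
    define g where "g x = indicator (ball a r) x * (f x - c)" for x
    have int_ball: "integrable lborel (\<lambda>x. indicator (ball a r) x :: real)"
      using emeasure_bounded_finite[OF bounded_ball, of a r] by simp
    have "integrable lborel (\<lambda>x. indicator (ball a r) x * f x)"
      using integrable_mult_indicator[OF _ f, of "ball a r"] by simp
    then have g: "integrable lborel g"
      unfolding g_def using int_ball by (simp add: right_diff_distrib)
    have "AE x in lborel. x \<in> ball a r \<longrightarrow> g x = 0"
    proof (rule fundamental_lemma_of_variations[OF g open_ball])
      fix \<psi> :: "real^'d \<Rightarrow> real" assume \<psi>: "\<psi> \<in> test_functions (ball a r)"
      have t: "(\<lambda>y. \<psi> (y - - a)) \<in> test_functions (ball 0 r)"
        by (rule test_function_translate[OF \<psi>]) (auto simp: dist_norm norm_minus_commute)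
      have sup: "indicator (ball a r) y * \<psi> y = \<psi> y" for y
        using \<psi> closure_subset[of "{x. \<psi> x \<noteq> 0}"] by (auto simp: test_functions_def indicator_def)
      have [measurable]: "\<psi> \<in> borel_measurable borel" using \<psi> by auto
      have "(LINT x|lborel. \<psi> (x + a)) = (LINT x|lborel. \<psi> x)"
        using lborel_integral_reflect[of "\<lambda>x. \<psi> (a - x)" 0] lborel_integral_reflect[of \<psi> a]
        by (simp add: add.commute)
      moreover have "G (\<lambda>y. \<psi> (y - - a)) a = (LINT y|lborel. f y * \<psi> y)" by (simp add: G_def)
      ultimately have fc: "(LINT y|lborel. f y * \<psi> y) = c * (LINT x|lborel. \<psi> x)"
        using sym[OF t \<eta>(1)] \<eta>(2) by (simp add: c_def field_simps)
      have "g x * \<psi> x = f x * \<psi> x - c * \<psi> x" for x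
      proof -
        have "g x * \<psi> x = (f x - c) * (indicator (ball a r) x * \<psi> x)" by (simp add: g_def)
        then show ?thesis unfolding sup by (simp add: left_diff_distrib)
      qed
      then have "(LINT x|lborel. g x * \<psi> x) = (LINT x|lborel. f x * \<psi> x - c * \<psi> x)"
        by (simp only:)
      also have "\<dots> = (LINT x|lborel. f x * \<psi> x) - (LINT x|lborel. c * \<psi> x)"
        using integrable_mult_translated_test_function[OF f \<psi>, of 0] test_function_integrable[OF \<psi>]
        by (intro Bochner_Integration.integral_diff) simp_all
      finally show "(LINT x|lborel. g x * \<psi> x) = 0"
        using fc by simp
    qed
    then have "AE x in lborel. x \<in> ball a r \<longrightarrow> f x = c"
      by eventually_elim (auto simp: g_def)
    then show ?thesis using r by blast
  qed
  define C where "C a = (SOME c. \<exists>r>0. ball a r \<subseteq> \<Omega> \<and> (AE x in lborel. x \<in> ball a r \<longrightarrow> f x = c))" for a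
  have C: "\<exists>r>0. ball a r \<subseteq> \<Omega> \<and> (AE x in lborel. x \<in> ball a r \<longrightarrow> f x = C a)" if "a \<in> \<Omega>" for a
    using someI_ex[OF loc[OF that]] unfolding C_def .
  have "C constant_on \<Omega>"
  proof (rule locally_constant_imp_constant[OF \<Omega>(2)])
    fix a assume "a \<in> \<Omega>"
    then obtain r where r: "r > 0" "ball a r \<subseteq> \<Omega>" "AE x in lborel. x \<in> ball a r \<longrightarrow> f x = C a"
      using C by blast
    have "C x = C a" if x: "x \<in> ball a r" for x
    proof -
      obtain s where s: "s > 0" "AE y in lborel. y \<in> ball x s \<longrightarrow> f y = C x" using C x r by blast
      have "AE y in lborel. y \<in> ball a r \<inter> ball x s \<longrightarrow> C x = C a"
        using r(3) s(2) by eventually_elim auto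
      then show ?thesis
        by (rule AE_not_open[rotated 2]) (use x s in \<open>auto intro!: exI[of _ x]\<close>)
    qed
    then show "\<exists>T. openin (top_of_set \<Omega>) T \<and> a \<in> T \<and> (\<forall>x\<in>T. C x = C a)"
      using r open_subset[OF r(2) open_ball] centre_in_ball by blast
  qed
  then obtain c where c: "\<And>a. a \<in> \<Omega> \<Longrightarrow> C a = c" unfolding constant_on_def by blast
  have "AE x in lborel. x \<in> \<Omega> \<longrightarrow> f x = c"
  proof (rule AE_lborel_locally)
    fix x assume "x \<in> \<Omega>"
    then show "\<exists>U. open U \<and> x \<in> U \<and> (AE y in lborel. y \<in> U \<longrightarrow> f y = c)"
      using C[of x] c by (metis centre_in_ball open_ball)
  qed
  then show ?thesis using that by blast
qed

section \<open>Square-integrable functions\<close>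

lemma L2_measurable: "f \<in> L2 \<Omega> \<Longrightarrow> f \<in> borel_measurable (lebesgue_on \<Omega>)"
  by (simp add: L2_def)

lemma L2_square_integrable: "f \<in> L2 \<Omega> \<Longrightarrow> integrable (lebesgue_on \<Omega>) (\<lambda>x. (norm (f x))\<^sup>2)"
  by (simp add: L2_def)

lemma L2_I:
  assumes "f \<in> borel_measurable (lebesgue_on \<Omega>)" "integrable (lebesgue_on \<Omega>) g"
    and "\<And>x. (norm (f x))\<^sup>2 \<le> g x"
  shows "f \<in> L2 \<Omega>"
proof -
  have "integrable (lebesgue_on \<Omega>) (\<lambda>x. (norm (f x))\<^sup>2)"
  proof (rule Bochner_Integration.integrable_bound[OF assms(2)])
    show "(\<lambda>x. (norm (f x))\<^sup>2) \<in> borel_measurable (lebesgue_on \<Omega>)"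
      using assms(1) by measurable
    show "AE x in lebesgue_on \<Omega>. norm ((norm (f x))\<^sup>2) \<le> norm (g x)"
      using assms(3) by (intro AE_I2) (simp add: order_trans[OF _ abs_ge_self])
  qed
  then show ?thesis using assms(1) by (simp add: L2_def)
qed

lemma L2_zero: "(\<lambda>x. 0) \<in> L2 \<Omega>"
  by (simp add: L2_def)

lemma L2_lincomb:
  assumes f: "f \<in> L2 \<Omega>" and g: "g \<in> L2 \<Omega>" shows "(\<lambda>x. f x + c *\<^sub>R g x) \<in> L2 \<Omega>"
proof -
  have [measurable]: "f \<in> borel_measurable (lebesgue_on \<Omega>)" "g \<in> borel_measurable (lebesgue_on \<Omega>)"
    using f g by (simp_all add: L2_measurable)
  have "(norm (f x + c *\<^sub>R g x))\<^sup>2 \<le> 2 * (norm (f x))\<^sup>2 + 2 * c\<^sup>2 * (norm (g x))\<^sup>2" for x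
  proof -
    have "(norm (f x + c *\<^sub>R g x))\<^sup>2 \<le> (norm (f x) + \<bar>c\<bar> * norm (g x))\<^sup>2"
      using norm_triangle_ineq[of "f x" "c *\<^sub>R g x"] by (intro power_mono) auto
    also have "\<dots> \<le> 2 * (norm (f x))\<^sup>2 + 2 * (\<bar>c\<bar> * norm (g x))\<^sup>2"
      using sum_squares_bound[of "norm (f x)" "\<bar>c\<bar> * norm (g x)"] by (simp add: power2_sum)
    finally show ?thesis by (simp add: power_mult_distrib)
  qed
  then show ?thesis
    by (intro L2_I[where g="\<lambda>x. 2 * (norm (f x))\<^sup>2 + 2 * c\<^sup>2 * (norm (g x))\<^sup>2"])
      (measurable, simp_all add: f g L2_square_integrable)
qed

lemma L2_scaleR: "g \<in> L2 \<Omega> \<Longrightarrow> (\<lambda>x. c *\<^sub>R g x) \<in> L2 \<Omega>"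
  using L2_lincomb[OF L2_zero] by simp

lemma L2_sum:
  assumes "finite I" "\<And>i. i \<in> I \<Longrightarrow> f i \<in> L2 \<Omega>" shows "(\<lambda>x. \<Sum>i\<in>I. f i x) \<in> L2 \<Omega>"
  using assms
proof (induction I rule: finite_induct)
  case empty
  then show ?case by (simp add: L2_zero)
next
  case (insert i I)
  then show ?case using L2_lincomb[of "f i" \<Omega> "\<lambda>x. \<Sum>i\<in>I. f i x" 1] by simp
qed

lemma L2_linear_image:
  fixes A :: "'b::euclidean_space \<Rightarrow> 'c::euclidean_space"
  assumes A: "linear A" and f: "f \<in> L2 \<Omega>" shows "(\<lambda>x. A (f x)) \<in> L2 \<Omega>"
proof -
  obtain K where K: "\<And>x. norm (A x) \<le> norm x * K"
    using bounded_linear.bounded A linear_conv_bounded_linear by blast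
  have [measurable]: "f \<in> borel_measurable (lebesgue_on \<Omega>)" using f by (simp add: L2_def)
  have "A \<in> borel_measurable borel"
    using A by (intro borel_measurable_continuous_onI linear_continuous_on) (simp add: linear_conv_bounded_linear)
  then have m: "(\<lambda>x. A (f x)) \<in> borel_measurable (lebesgue_on \<Omega>)" by measurable
  have "(norm (A (f x)))\<^sup>2 \<le> K\<^sup>2 * (norm (f x))\<^sup>2" for x
    using power_mono[OF K[of "f x"], of 2] by (simp add: power_mult_distrib mult.commute)
  with m show ?thesis
    by (intro L2_I[where g="\<lambda>x. K\<^sup>2 * (norm (f x))\<^sup>2"]) (simp_all add: f L2_square_integrable)
qed

lemma L2_inner_integrable:
  assumes f: "f \<in> L2 \<Omega>" and g: "g \<in> L2 \<Omega>" shows "integrable (lebesgue_on \<Omega>) (\<lambda>x. f x \<bullet> g x)"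
proof (rule Bochner_Integration.integrable_bound[of _ "\<lambda>x. (norm (f x))\<^sup>2 + (norm (g x))\<^sup>2"])
  show "AE x in lebesgue_on \<Omega>. norm (f x \<bullet> g x) \<le> norm ((norm (f x))\<^sup>2 + (norm (g x))\<^sup>2)"
  proof (rule AE_I2)
    fix x
    have "\<bar>f x \<bullet> g x\<bar> \<le> norm (f x) * norm (g x)" by (rule Cauchy_Schwarz_ineq2)
    moreover have "norm (f x) * norm (g x) \<le> (norm (f x))\<^sup>2 + (norm (g x))\<^sup>2"
      using sum_squares_bound[of "norm (f x)" "norm (g x)"]
        mult_nonneg_nonneg[OF norm_ge_zero[of "f x"] norm_ge_zero[of "g x"]] by linarith
    ultimately show "norm (f x \<bullet> g x) \<le> norm ((norm (f x))\<^sup>2 + (norm (g x))\<^sup>2)" by simp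
  qed
next
  have [measurable]: "f \<in> borel_measurable (lebesgue_on \<Omega>)" "g \<in> borel_measurable (lebesgue_on \<Omega>)"
    using f g by (simp_all add: L2_measurable)
  show "(\<lambda>x. f x \<bullet> g x) \<in> borel_measurable (lebesgue_on \<Omega>)" by measurable
  show "integrable (lebesgue_on \<Omega>) (\<lambda>x. (norm (f x))\<^sup>2 + (norm (g x))\<^sup>2)"
    using f g by (simp add: L2_square_integrable)
qed

lemma L2_inner_commute: "L2_inner \<Omega> f g = L2_inner \<Omega> g f"
  by (simp add: L2_inner_def inner_commute)

lemma L2_inner_nonneg: "0 \<le> L2_inner \<Omega> f f"
  by (simp add: L2_inner_def)

lemma L2_inner_lincomb_left:
  assumes "f \<in> L2 \<Omega>" "g \<in> L2 \<Omega>" "h \<in> L2 \<Omega>"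
  shows "L2_inner \<Omega> (\<lambda>x. f x + c *\<^sub>R g x) h = L2_inner \<Omega> f h + c * L2_inner \<Omega> g h"
  using assms by (simp add: L2_inner_def inner_add_left L2_inner_integrable)

lemma L2_inner_lincomb_right:
  assumes "f \<in> L2 \<Omega>" "g \<in> L2 \<Omega>" "h \<in> L2 \<Omega>"
  shows "L2_inner \<Omega> h (\<lambda>x. f x + c *\<^sub>R g x) = L2_inner \<Omega> h f + c * L2_inner \<Omega> h g"
  using L2_inner_lincomb_left[OF assms] by (simp add: L2_inner_commute)

lemma L2_inner_scaleR: "L2_inner \<Omega> (\<lambda>x. c *\<^sub>R g x) h = c * L2_inner \<Omega> g h"
  by (simp add: L2_inner_def)

lemma L2_inner_cong_AE:
  assumes "f \<in> L2 \<Omega>" "f' \<in> L2 \<Omega>" "g \<in> L2 \<Omega>" "g' \<in> L2 \<Omega>"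
    and "AE x in lebesgue_on \<Omega>. f x = f' x" "AE x in lebesgue_on \<Omega>. g x = g' x"
  shows "L2_inner \<Omega> f g = L2_inner \<Omega> f' g'"
  unfolding L2_inner_def
proof (rule integral_cong_AE)
  show "AE x in lebesgue_on \<Omega>. f x \<bullet> g x = f' x \<bullet> g' x"
    using assms(5,6) by eventually_elim simp
next
  show "(\<lambda>x. f x \<bullet> g x) \<in> borel_measurable (lebesgue_on \<Omega>)" "(\<lambda>x. f' x \<bullet> g' x) \<in> borel_measurable (lebesgue_on \<Omega>)"
    using assms by (simp_all add: L2_inner_integrable borel_measurable_integrable)
qed

lemma L2_inner_self_eq_0:
  assumes "f \<in> L2 \<Omega>" "L2_inner \<Omega> f f = 0" shows "AE x in lebesgue_on \<Omega>. f x = 0"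
  using assms integral_nonneg_eq_0_iff_AE[OF L2_inner_integrable[OF assms(1) assms(1)]]
  by (simp add: L2_inner_def)

section \<open>Weak gradients\<close>

lemma has_weak_gradientD:
  "has_weak_gradient \<Omega> f g \<Longrightarrow> \<phi> \<in> test_functions \<Omega> \<Longrightarrow>
    (LINT x|lebesgue_on \<Omega>. f x * partial_deriv i \<phi> x) = - (LINT x|lebesgue_on \<Omega>. g x $ i * \<phi> x)"
  by (simp add: has_weak_gradient_def)

lemma H1_weak_grad:
  assumes "f \<in> H1 \<Omega>"
  shows "f \<in> L2 \<Omega>" "weak_grad \<Omega> f \<in> L2 \<Omega>" "has_weak_gradient \<Omega> f (weak_grad \<Omega> f)"
proof -
  obtain g where "g \<in> L2 \<Omega> \<and> has_weak_gradient \<Omega> f g" using assms by (auto simp: H1_def)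
  from someI[of "\<lambda>g. g \<in> L2 \<Omega> \<and> has_weak_gradient \<Omega> f g", OF this]
  show "weak_grad \<Omega> f \<in> L2 \<Omega>" "has_weak_gradient \<Omega> f (weak_grad \<Omega> f)" by (simp_all add: weak_grad_def)
  show "f \<in> L2 \<Omega>" using assms by (simp add: H1_def)
qed

text \<open>By translation invariance, the integral of \<open>\<phi> (z + t e) - \<phi> z\<close> is zero, while the Taylor expansion
  gives \<open>t\<close> times the integral of the partial derivative, up to \<open>O(t\<^sup>2)\<close>.\<close>

lemma integral_partial_deriv_eq_0:
  assumes \<phi>: "\<phi> \<in> test_functions \<Omega>"
  shows "(LINT x|lborel. partial_deriv i \<phi> x) = 0"
proof -
  obtain K where K: "0 \<le> K"
    "\<And>z h. \<bar>\<phi> (z + h) - \<phi> z - (\<Sum>i\<in>UNIV. h $ i * partial_deriv i \<phi> z)\<bar> \<le> K * (norm h)\<^sup>2"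
    using test_function_taylor[OF \<phi>] by metis
  note d\<phi> = test_function_partial_deriv[OF \<phi>]
  have "bounded (closure {x. \<phi> x \<noteq> 0})"
    using \<phi> compact_imp_bounded unfolding test_functions_def by blast
  then obtain \<rho> where \<rho>: "\<And>x. x \<in> closure {x. \<phi> x \<noteq> 0} \<Longrightarrow> norm x \<le> \<rho>"
    by (auto simp only: bounded_iff)
  have z: "\<phi> x = 0" if "norm x > \<rho>" for x
    using \<rho>[of x] that closure_subset[of "{x. \<phi> x \<noteq> 0}"] by auto
  have dz: "partial_deriv i \<phi> x = 0" if "norm x > \<rho>" for x
  proof -
    have "((\<lambda>x. 0) has_derivative (\<lambda>h. 0)) (at x)" by simp
    moreover have "open {x. norm x > \<rho>}" by (intro open_Collect_less continuous_intros)
    ultimately have "(\<phi> has_derivative (\<lambda>h. 0)) (at x)"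
      by (rule has_derivative_transform_within_open) (use that z in auto)
    then show ?thesis by (simp add: partial_deriv_eq)
  qed
  \<comment> \<open>For shifts of length at most one, the Taylor remainder vanishes outside this ball.\<close>
  let ?B = "ball (0::real^'a) (\<rho> + 2)"
  define c where "c = K * measure lborel ?B"
  define D where "D = (LINT x|lborel. partial_deriv i \<phi> x)"
  have intB: "integrable lborel (\<lambda>x. indicator ?B x :: real)"
    using emeasure_bounded_finite[OF bounded_ball, of "0::real^'a" "\<rho> + 2"] by simp
  have bnd: "\<bar>t * D\<bar> \<le> c * t\<^sup>2" if t: "\<bar>t\<bar> \<le> 1" for t
  proof -
    let ?h = "t *\<^sub>R axis i 1 :: real^'a"
    have nh: "norm ?h = \<bar>t\<bar>" by (simp add: norm_axis_1)
    have sm: "(\<Sum>j\<in>UNIV. ?h $ j * partial_deriv j \<phi> z) = t * partial_deriv i \<phi> z" for z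
    proof -
      have "(\<Sum>j\<in>UNIV. ?h $ j * partial_deriv j \<phi> z) = (\<Sum>j\<in>UNIV. if j = i then t * partial_deriv j \<phi> z else 0)"
        by (intro sum.cong) (auto simp: axis_def)
      then show ?thesis by simp
    qed
    have [measurable]: "\<phi> \<in> borel_measurable borel" "partial_deriv i \<phi> \<in> borel_measurable borel"
      using \<phi> d\<phi> by auto
    have i1: "integrable lborel (\<lambda>z. \<phi> (z + ?h))"
      using test_function_integrable[OF test_function_translate(1)[OF \<phi>, of "- ?h" UNIV]] by simp
    note i2 = test_function_integrable[OF \<phi>] test_function_integrable[OF d\<phi>]
    have inv: "(LINT z|lborel. \<phi> (z + ?h)) = (LINT z|lborel. \<phi> z)"
      using lborel_integral_reflect[of "\<lambda>x. \<phi> (?h - x)" 0] lborel_integral_reflect[of \<phi> ?h]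
      by (simp add: add.commute)
    have "\<bar>LINT z|lborel. \<phi> (z + ?h) - \<phi> z - t * partial_deriv i \<phi> z\<bar>
        \<le> (LINT z|lborel. (K * t\<^sup>2) * indicator ?B z)"
    proof (rule integral_abs_bound_integral)
      show "\<bar>\<phi> (z + ?h) - \<phi> z - t * partial_deriv i \<phi> z\<bar> \<le> K * t\<^sup>2 * indicator ?B z" for z
      proof (cases "z \<in> ?B")
        case True
        then show ?thesis using K(2)[of z ?h, unfolded sm nh power2_abs] by simp
      next
        case False
        then have "norm z \<ge> \<rho> + 2" by simp
        moreover have "norm z \<le> norm (z + ?h) + norm ?h"
          using norm_triangle_ineq4[of "z + ?h" ?h] by simp
        ultimately have "norm (z + ?h) > \<rho>" "norm z > \<rho>" using nh t by auto
        then show ?thesis using z dz K(1) by simp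
      qed
    qed (use i1 i2 intB in auto)
    moreover have "(LINT z|lborel. \<phi> (z + ?h) - \<phi> z - t * partial_deriv i \<phi> z) = - (t * D)"
      using i1 i2 inv by (simp add: D_def)
    ultimately show ?thesis by (simp add: c_def mult_ac)
  qed
  have "\<bar>D\<bar> \<le> 0"
  proof (rule field_le_epsilon)
    fix e :: real assume "e > 0"
    define t where "t = min 1 (e / (c + 1))"
    have c: "0 \<le> c" using K by (simp add: c_def)
    then have t: "t > 0" "\<bar>t\<bar> \<le> 1" "t \<le> e / (c + 1)" using \<open>e > 0\<close> by (auto simp: t_def)
    have "t * \<bar>D\<bar> \<le> t * (c * t)" using bnd[OF t(2)] t(1) by (simp add: abs_mult power2_eq_square mult_ac)
    then have "\<bar>D\<bar> \<le> c * t" using t(1) by simp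
    also have "\<dots> \<le> (c + 1) * t" using t(1) by (simp add: mult_right_mono)
    also have "\<dots> \<le> e" using t(3) c by (simp add: field_simps)
    finally show "\<bar>D\<bar> \<le> 0 + e" by simp
  qed
  then show ?thesis by (simp add: D_def)
qed

locale bounded_connected_domain =
  fixes \<Omega> :: "(real^'d) set"
  assumes open_domain: "open \<Omega>" and bounded_domain: "bounded \<Omega>"
    and connected_domain: "connected \<Omega>" and domain_nonempty: "\<Omega> \<noteq> {}"
begin

lemma domain_sets: "\<Omega> \<in> sets lebesgue"
  using open_domain by (simp add: borel_open)

lemma domain_lmeasurable: "\<Omega> \<in> lmeasurable"
  using open_domain bounded_domain lmeasurable_open by blast

lemma finite_measure_domain: "finite_measure (lebesgue_on \<Omega>)"
  using finite_measure_lebesgue_on[OF domain_lmeasurable] .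

lemma measure_domain_pos: "0 < measure (lebesgue_on \<Omega>) \<Omega>"
proof -
  have "\<not> negligible \<Omega>" using open_not_negligible open_domain domain_nonempty by blast
  then have "measure lebesgue \<Omega> \<noteq> 0" using negligible_iff_measure0 domain_lmeasurable by blast
  then show ?thesis
    by (simp add: measure_restrict_space domain_sets zero_less_measure_iff)
qed

lemma integrable_AE_bounded:
  fixes f :: "real^'d \<Rightarrow> real"
  assumes "f \<in> borel_measurable (lebesgue_on \<Omega>)" "AE x in lebesgue_on \<Omega>. \<bar>f x\<bar> \<le> B"
  shows "integrable (lebesgue_on \<Omega>) f"
  using finite_measure.integrable_const_bound[OF finite_measure_domain, of f B] assms by simp

lemma AE_bounded_L2:
  fixes f :: "real^'d \<Rightarrow> real"
  assumes f: "f \<in> borel_measurable (lebesgue_on \<Omega>)" "AE x in lebesgue_on \<Omega>. \<bar>f x\<bar> \<le> B"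
  shows "f \<in> L2 \<Omega>"
proof -
  have "AE x in lebesgue_on \<Omega>. \<bar>(f x)\<^sup>2\<bar> \<le> B\<^sup>2"
    using f(2) by eventually_elim (metis abs_ge_zero abs_power2 power2_abs power_mono)
  from integrable_AE_bounded[OF _ this] f(1) show ?thesis by (simp add: L2_def)
qed

lemma L2_const: "(\<lambda>x. c::real) \<in> L2 \<Omega>"
  by (rule AE_bounded_L2[of _ "\<bar>c\<bar>"]) auto

lemma L2_integrable:
  fixes f :: "real^'d \<Rightarrow> real"
  shows "f \<in> L2 \<Omega> \<Longrightarrow> integrable (lebesgue_on \<Omega>) f"
  using L2_inner_integrable[OF _ L2_const[of 1]] by simp

lemma integrable_mult_test_function:
  assumes "integrable (lebesgue_on \<Omega>) f" "\<phi> \<in> test_functions \<Omega>"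
  shows "integrable (lebesgue_on \<Omega>) (\<lambda>x. f x * \<phi> x)"
proof -
  obtain B where "\<And>x. \<bar>\<phi> x\<bar> \<le> B" using test_function_bounded assms by metis
  moreover have "\<phi> \<in> borel_measurable (lebesgue_on \<Omega>)"
    using test_function_borel[OF assms(2)] by (intro measurable_restrict_space1 measurable_completion) simp
  ultimately show ?thesis using assms integrable_mult_bounded by blast
qed

lemma fundamental_lemma_on_domain:
  assumes g: "integrable (lebesgue_on \<Omega>) g"
    and zero: "\<And>\<phi>. \<phi> \<in> test_functions \<Omega> \<Longrightarrow> (LINT x|lebesgue_on \<Omega>. g x * \<phi> x) = 0"
  shows "AE x in lebesgue_on \<Omega>. g x = 0"
proof -
  obtain g' where g': "integrable lborel g'" "AE x in lborel. x \<in> \<Omega> \<longrightarrow> g x = g' x"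
    "\<forall>\<psi> \<in> borel_measurable borel.
       (LINT x|lebesgue_on \<Omega>. g x * \<psi> x) = (LINT x|lborel. g' x * \<psi> x)"
    by (rule lebesgue_on_borel_representative[OF domain_sets g]) (rule that; assumption)
  have "AE x in lborel. x \<in> \<Omega> \<longrightarrow> g' x = 0"
  proof (rule fundamental_lemma_of_variations[OF g'(1) open_domain])
    fix \<phi> assume \<phi>: "\<phi> \<in> test_functions \<Omega>"
    show "(LINT x|lborel. g' x * \<phi> x) = 0"
      using bspec[OF g'(3) test_function_borel[OF \<phi>]] zero[OF \<phi>] by simp
  qed
  with g'(2) have "AE x in lborel. x \<in> \<Omega> \<longrightarrow> g x = 0" by eventually_elim auto
  then show ?thesis by (simp add: AE_lebesgue_on_iff domain_sets)
qed

lemma L2_component: "g \<in> L2 \<Omega> \<Longrightarrow> (\<lambda>x. g x $ i) \<in> L2 \<Omega>" for g :: "real^'d \<Rightarrow> real^'n"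
  by (rule L2_linear_image) (simp_all add: linear_componentwise linear_iff)

text \<open>The components of the difference are orthogonal to all test functions.\<close>

lemma weak_gradient_unique:
  assumes "has_weak_gradient \<Omega> f g" "has_weak_gradient \<Omega> f g'" "g \<in> L2 \<Omega>" "g' \<in> L2 \<Omega>"
  shows "AE x in lebesgue_on \<Omega>. g x = g' x"
proof -
  have "AE x in lebesgue_on \<Omega>. g x $ i - g' x $ i = 0" for i
  proof (rule fundamental_lemma_on_domain)
    have int: "integrable (lebesgue_on \<Omega>) (\<lambda>x. g x $ i)" "integrable (lebesgue_on \<Omega>) (\<lambda>x. g' x $ i)"
      by (intro L2_integrable L2_component assms)+
    then show "integrable (lebesgue_on \<Omega>) (\<lambda>x. g x $ i - g' x $ i)" by simp
    fix \<phi> assume \<phi>: "\<phi> \<in> test_functions \<Omega>"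
    show "(LINT x|lebesgue_on \<Omega>. (g x $ i - g' x $ i) * \<phi> x) = 0"
      using has_weak_gradientD[OF assms(1) \<phi>, of i] has_weak_gradientD[OF assms(2) \<phi>, of i]
      by (simp add: left_diff_distrib integrable_mult_test_function int \<phi>)
  qed
  then have "AE x in lebesgue_on \<Omega>. \<forall>i. g x $ i - g' x $ i = 0"
    by (simp add: AE_all_countable)
  then show ?thesis by eventually_elim (simp add: vec_eq_iff)
qed

lemma has_weak_gradient_lincomb:
  assumes "f \<in> L2 \<Omega>" "g \<in> L2 \<Omega>" "f' \<in> L2 \<Omega>" "g' \<in> L2 \<Omega>"
    and "has_weak_gradient \<Omega> f f'" "has_weak_gradient \<Omega> g g'"
  shows "has_weak_gradient \<Omega> (\<lambda>x. f x + c * g x) (\<lambda>x. f' x + c *\<^sub>R g' x)"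
  unfolding has_weak_gradient_def
proof (intro ballI allI)
  fix \<phi> i assume \<phi>: "\<phi> \<in> test_functions \<Omega>"
  note i1 = integrable_mult_test_function[OF L2_integrable[OF assms(1)] test_function_partial_deriv[OF \<phi>, of i]]
    integrable_mult_test_function[OF L2_integrable[OF assms(2)] test_function_partial_deriv[OF \<phi>, of i]]
    integrable_mult_test_function[OF L2_integrable[OF L2_component[OF assms(3), of i]] \<phi>]
    integrable_mult_test_function[OF L2_integrable[OF L2_component[OF assms(4), of i]] \<phi>]
  show "(LINT x|lebesgue_on \<Omega>. (f x + c * g x) * partial_deriv i \<phi> x) =
        - (LINT x|lebesgue_on \<Omega>. (f' x + c *\<^sub>R g' x) $ i * \<phi> x)"
    using has_weak_gradientD[OF assms(5) \<phi>, of i] has_weak_gradientD[OF assms(6) \<phi>, of i] i1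
    by (simp add: distrib_right mult.assoc)
qed

lemma weak_grad_lincomb:
  assumes "f \<in> H1 \<Omega>" "g \<in> H1 \<Omega>"
  shows "(\<lambda>x. f x + c * g x) \<in> H1 \<Omega>"
    and "AE x in lebesgue_on \<Omega>. weak_grad \<Omega> (\<lambda>x. f x + c * g x) x = weak_grad \<Omega> f x + c *\<^sub>R weak_grad \<Omega> g x"
proof -
  note hw = has_weak_gradient_lincomb[OF H1_weak_grad(1)[OF assms(1)] H1_weak_grad(1)[OF assms(2)]
     H1_weak_grad(2)[OF assms(1)] H1_weak_grad(2)[OF assms(2)] H1_weak_grad(3)[OF assms(1)] H1_weak_grad(3)[OF assms(2)], of c]
  note l2 = L2_lincomb[OF H1_weak_grad(2)[OF assms(1)] H1_weak_grad(2)[OF assms(2)], of c]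
  show H: "(\<lambda>x. f x + c * g x) \<in> H1 \<Omega>"
    using hw l2 L2_lincomb[OF H1_weak_grad(1)[OF assms(1)] H1_weak_grad(1)[OF assms(2)], of c]
    by (auto simp: H1_def)
  show "AE x in lebesgue_on \<Omega>. weak_grad \<Omega> (\<lambda>x. f x + c * g x) x = weak_grad \<Omega> f x + c *\<^sub>R weak_grad \<Omega> g x"
    using weak_gradient_unique[OF H1_weak_grad(3)[OF H] hw H1_weak_grad(2)[OF H] l2] .
qed

lemma weak_grad_AE_const:
  assumes q: "q \<in> H1 \<Omega>" "AE x in lebesgue_on \<Omega>. q x = c"
  shows "AE x in lebesgue_on \<Omega>. weak_grad \<Omega> q x = 0"
proof (rule weak_gradient_unique[OF H1_weak_grad(3)[OF q(1)] _ H1_weak_grad(2)[OF q(1)] L2_zero])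
  show "has_weak_gradient \<Omega> q (\<lambda>x. 0)"
    unfolding has_weak_gradient_def
  proof (intro ballI allI)
    fix \<phi> :: "real^'d \<Rightarrow> real" and i assume \<phi>: "\<phi> \<in> test_functions \<Omega>"
    note d\<phi> = test_function_partial_deriv[OF \<phi>, of i]
    note mb = test_function_borel[OF d\<phi>]
    have m: "partial_deriv i \<phi> \<in> borel_measurable (lebesgue_on \<Omega>)"
      using mb by (intro measurable_restrict_space1 measurable_completion) simp
    have sup: "indicator \<Omega> x * partial_deriv i \<phi> x = partial_deriv i \<phi> x" for x
      using d\<phi> closure_subset[of "{x. partial_deriv i \<phi> x \<noteq> 0}"]
      by (auto simp: test_functions_def indicator_def)
    have "(LINT x|lebesgue_on \<Omega>. q x * partial_deriv i \<phi> x) = (LINT x|lebesgue_on \<Omega>. c * partial_deriv i \<phi> x)"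
      using q m L2_measurable[OF H1_weak_grad(1)[OF q(1)]] by (intro integral_cong_AE) (auto elim: eventually_mono)
    also have "\<dots> = c * (LINT x|lebesgue_on \<Omega>. partial_deriv i \<phi> x)" by simp
    also have "(LINT x|lebesgue_on \<Omega>. partial_deriv i \<phi> x) = (LINT x|lebesgue. indicator \<Omega> x *\<^sub>R partial_deriv i \<phi> x)"
      by (rule integral_restrict_space) (simp add: domain_sets)
    also have "\<dots> = (LINT x|lebesgue. partial_deriv i \<phi> x)" by (simp only: real_scaleR_def sup)
    also have "(LINT x|lebesgue. partial_deriv i \<phi> x) = 0"
      using mb integral_partial_deriv_eq_0[OF \<phi>] by (simp add: integral_completion)
    finally show "(LINT x|lebesgue_on \<Omega>. q x * partial_deriv i \<phi> x) = - (LINT x|lebesgue_on \<Omega>. 0 $ i * \<phi> x)"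
      by simp
  qed
qed

lemma AE_const_if_weak_grad_zero:
  assumes q: "q \<in> H1 \<Omega>" "AE x in lebesgue_on \<Omega>. weak_grad \<Omega> q x = 0"
  obtains c where "AE x in lebesgue_on \<Omega>. q x = c"
proof -
  obtain q' where q': "integrable lborel q'" "AE x in lborel. x \<in> \<Omega> \<longrightarrow> q x = q' x"
    "\<forall>\<psi> \<in> borel_measurable borel.
       (LINT x|lebesgue_on \<Omega>. q x * \<psi> x) = (LINT x|lborel. q' x * \<psi> x)"
    by (rule lebesgue_on_borel_representative[OF domain_sets L2_integrable[OF H1_weak_grad(1)[OF q(1)]]]) (rule that; assumption)
  have zero: "(LINT y|lborel. q' y * partial_deriv i \<phi> y) = 0" if \<phi>: "\<phi> \<in> test_functions \<Omega>" for \<phi> i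
  proof -
    have m: "\<phi> \<in> borel_measurable (lebesgue_on \<Omega>)"
      using test_function_borel[OF \<phi>] by (intro measurable_restrict_space1 measurable_completion) simp
    have "(LINT x|lebesgue_on \<Omega>. weak_grad \<Omega> q x $ i * \<phi> x) = (LINT x|lebesgue_on \<Omega>. 0)"
      using q(2) m L2_measurable[OF L2_component[OF H1_weak_grad(2)[OF q(1)], of i]]
      by (intro integral_cong_AE) (auto elim: eventually_mono)
    then have "(LINT x|lebesgue_on \<Omega>. q x * partial_deriv i \<phi> x) = 0"
      using has_weak_gradientD[OF H1_weak_grad(3)[OF q(1)] \<phi>, of i] by simp
    then show ?thesis using bspec[OF q'(3) test_function_borel[OF test_function_partial_deriv[OF \<phi>, of i]]] by simp
  qed
  obtain c where "AE x in lborel. x \<in> \<Omega> \<longrightarrow> q' x = c"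
    using zero_weak_gradient_imp_constant[OF q'(1) open_domain connected_domain] zero by metis
  with q'(2) have "AE x in lborel. x \<in> \<Omega> \<longrightarrow> q x = c" by eventually_elim auto
  then show ?thesis using that by (simp add: AE_lebesgue_on_iff domain_sets)
qed

end

section \<open>Finite element functions\<close>

lemma finite_element_space_lincomb:
  assumes "finite_element_space \<Omega> S" "f \<in> S" "g \<in> S" shows "(\<lambda>x. f x + c *\<^sub>R g x) \<in> S"
proof -
  obtain N :: nat and b where S: "S = {f. \<exists>c. f = (\<lambda>x. \<Sum>i<N. c i *\<^sub>R b i x)}"
    using assms(1) unfolding finite_element_space_def by blast
  obtain k k' where "f = (\<lambda>x. \<Sum>i<N. k i *\<^sub>R b i x)" "g = (\<lambda>x. \<Sum>i<N. k' i *\<^sub>R b i x)"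
    using assms S by auto
  then have eq: "(\<lambda>x. f x + c *\<^sub>R g x) = (\<lambda>x. \<Sum>i<N. (k i + c * k' i) *\<^sub>R b i x)"
    by (simp add: scaleR_sum_right sum.distrib scaleR_left_distrib)
  show ?thesis unfolding S mem_Collect_eq by (intro exI, rule eq)
qed

lemma finite_element_space_zero:
  assumes "finite_element_space \<Omega> S" shows "(\<lambda>x. 0) \<in> S"
proof -
  obtain N :: nat and b where S: "S = {f. \<exists>c. f = (\<lambda>x. \<Sum>i<N. c i *\<^sub>R b i x)}"
    using assms(1) unfolding finite_element_space_def by blast
  show ?thesis unfolding S by (auto intro!: exI[of _ "\<lambda>i. 0"])
qed

text \<open>Each cell is bounded, so the polynomial that describes \<open>f\<close> on it is bounded; the cells are finitely many
  and cover the domain up to a null set.\<close>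

lemma finite_element_AE_bounded:
  assumes \<Omega>: "bounded \<Omega>" "\<Omega> \<in> sets lebesgue" and S: "finite_element_space \<Omega> S" "f \<in> S"
  obtains B where "AE x in lebesgue_on \<Omega>. norm (f x) \<le> B"
proof -
  have "\<exists>\<T>. mesh \<Omega> \<T> \<and> (\<forall>f \<in> S. \<forall>K \<in> \<T>. \<exists>p. polynomial_function p \<and> (\<forall>x \<in> K. f x = p x))"
    using S(1) unfolding finite_element_space_def by (rule conjunct2)
  then obtain \<T> where T: "mesh \<Omega> \<T>" and p: "\<forall>K \<in> \<T>. \<exists>p. polynomial_function p \<and> (\<forall>x \<in> K. f x = p x)"
    using S(2) by fast
  have "\<exists>B. \<forall>x\<in>K. norm (f x) \<le> B" if K: "K \<in> \<T>" for K
  proof -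
    obtain p where p: "polynomial_function p" "\<forall>x \<in> K. f x = p x" using p K by blast
    have "bounded K" using K T \<Omega> bounded_subset unfolding mesh_def by blast
    then have "compact (closure K)" by simp
    then have "bounded (p ` closure K)"
      using p(1) by (intro compact_imp_bounded compact_continuous_image continuous_on_polymonial_function)
    then obtain B where "\<And>x. x \<in> closure K \<Longrightarrow> norm (p x) \<le> B" by (auto simp: bounded_iff)
    moreover have "x \<in> closure K" if "x \<in> K" for x using that closure_subset[of K] by (rule subsetD[rotated])
    ultimately have "\<forall>x\<in>K. norm (f x) \<le> B" using p(2) by simp
    then show ?thesis by (rule exI)
  qed
  then obtain B where B: "\<forall>K\<in>\<T>. \<forall>x\<in>K. norm (f x) \<le> B K"
    using bchoice[of \<T> "\<lambda>K B. \<forall>x\<in>K. norm (f x) \<le> B"] by blast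
  have fin: "finite \<T>" and neg: "negligible (\<Omega> - \<Union>\<T>)" using T by (auto simp: mesh_def)
  have meas: "\<Omega> \<inter> space lebesgue \<in> sets lebesgue" using \<Omega>(2) by simp
  have "AE x in lebesgue. x \<notin> \<Omega> - \<Union>\<T>"
    by (rule AE_not_in) (use neg in \<open>simp add: negligible_iff_null_sets\<close>)
  then have "AE x in lebesgue_on \<Omega>. norm (f x) \<le> (\<Sum>K\<in>\<T>. \<bar>B K\<bar>)"
    unfolding AE_restrict_space_iff[OF meas]
  proof eventually_elim
    case (elim x)
    show ?case
    proof
      assume "x \<in> \<Omega>"
      then obtain K where K: "K \<in> \<T>" "x \<in> K" using elim by blast
      have "norm (f x) \<le> \<bar>B K\<bar>" using B K by fastforce
      also have "\<dots> \<le> (\<Sum>K\<in>\<T>. \<bar>B K\<bar>)" using fin K by (intro member_le_sum) auto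
      finally show "norm (f x) \<le> (\<Sum>K\<in>\<T>. \<bar>B K\<bar>)" .
    qed
  qed
  then show ?thesis using that by blast
qed

section \<open>Semidefinite forms on spaces of functions\<close>

text \<open>A quadratic polynomial without constant term that is nowhere negative has no linear term: the form
  in which a minimum at \<open>t = 0\<close> is exploited.\<close>

lemma nonneg_linear_plus_square_imp_zero:
  fixes D K :: real
  assumes "\<And>t. 0 \<le> t * D + t\<^sup>2 * K" shows "D = 0"
proof (rule ccontr)
  assume "D \<noteq> 0"
  define k where "k = \<bar>K\<bar> + 1"
  have k: "0 < k" "K < k" by (auto simp: k_def)
  have "0 \<le> (- D / k) * D + (- D / k)\<^sup>2 * K" by (rule assms)
  also have "\<dots> = D\<^sup>2 * (K - k) / k\<^sup>2" using k by (simp add: field_simps power2_eq_square)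
  also have "\<dots> < 0" using k \<open>D \<noteq> 0\<close> by (simp add: divide_less_0_iff mult_less_0_iff)
  finally show False by simp
qed

text \<open>Symmetric positive semidefinite bilinear forms on a linear space of functions with pointwise
  operations. Combinations \<open>p + c q\<close> cover sums and multiples in a single condition.\<close>

locale semidefinite_form =
  fixes S :: "('x \<Rightarrow> 'b::real_vector) set" and B :: "('x \<Rightarrow> 'b) \<Rightarrow> ('x \<Rightarrow> 'b) \<Rightarrow> real"
  assumes lincomb: "p \<in> S \<Longrightarrow> q \<in> S \<Longrightarrow> (\<lambda>x. p x + c *\<^sub>R q x) \<in> S"
    and left: "p \<in> S \<Longrightarrow> q \<in> S \<Longrightarrow> r \<in> S \<Longrightarrow> B (\<lambda>x. p x + c *\<^sub>R q x) r = B p r + c * B q r"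
    and sym: "B p q = B q p"
    and nonneg: "p \<in> S \<Longrightarrow> 0 \<le> B p p"
begin

lemma right: "p \<in> S \<Longrightarrow> q \<in> S \<Longrightarrow> r \<in> S \<Longrightarrow> B r (\<lambda>x. p x + c *\<^sub>R q x) = B r p + c * B r q"
  using left by (simp add: sym)

lemma square:
  assumes "p \<in> S" "q \<in> S"
  shows "B (\<lambda>x. p x + c *\<^sub>R q x) (\<lambda>x. p x + c *\<^sub>R q x) = B p p + 2 * c * B p q + c\<^sup>2 * B q q"
  using assms left[OF assms lincomb[OF assms], of c c] right[OF assms assms(1), of c] right[OF assms assms(2), of c]
  by (simp add: sym[of q p] algebra_simps power2_eq_square)

lemma null_orthogonal:
  assumes "p \<in> S" "q \<in> S" "B q q = 0" shows "B p q = 0"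
proof -
  have "0 \<le> t * (2 * B q p) + t\<^sup>2 * B p p" for t
    using nonneg[OF lincomb[OF assms(2,1)], of t] square[OF assms(2,1), of t] assms(3)
    by (simp add: mult_ac)
  from nonneg_linear_plus_square_imp_zero[OF this] show ?thesis by (simp add: sym)
qed

lemma cauchy_schwarz:
  assumes "p \<in> S" "q \<in> S" shows "B p q \<le> sqrt (B p p) * sqrt (B q q)"
proof (cases "B q q = 0")
  case True
  then show ?thesis using null_orthogonal[OF assms] by simp
next
  case False
  then have pos: "0 < B q q" using nonneg[OF assms(2)] by simp
  define t where "t = - B p q / B q q"
  have "0 \<le> B p p + 2 * t * B p q + t\<^sup>2 * B q q"
    using nonneg[OF lincomb[OF assms], of t] square[OF assms, of t] by simp
  also have "\<dots> = B p p - (B p q)\<^sup>2 / B q q"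
    using pos by (simp add: t_def field_simps power2_eq_square)
  finally have "(B p q)\<^sup>2 \<le> B p p * B q q" using pos by (simp add: field_simps)
  then show ?thesis by (simp add: real_sqrt_mult[symmetric] real_le_rsqrt)
qed

text \<open>Riesz representation for a semidefinite form on a finitely generated space: the functional has to
  vanish on the null vectors of the form. Induction on the number of generators, as in the Gram-Schmidt
  process: subtracting from a new generator its projection onto the span of the previous ones leaves a
  vector orthogonal to that span, along which the representing vector is corrected.\<close>

lemma representation:
  fixes b :: "nat \<Rightarrow> 'x \<Rightarrow> 'b" and N :: nat
  assumes S: "S = {f. \<exists>c. f = (\<lambda>x. \<Sum>i<N. c i *\<^sub>R b i x)}"
    and F: "\<And>p q c. p \<in> S \<Longrightarrow> q \<in> S \<Longrightarrow> F (\<lambda>x. p x + c *\<^sub>R q x) = F p + c * F q"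
    and null: "\<And>q. q \<in> S \<Longrightarrow> B q q = 0 \<Longrightarrow> F q = 0"
  shows "\<exists>r\<in>S. \<forall>q\<in>S. B r q = F q"
proof -
  define T where "T n = {f. \<exists>c. f = (\<lambda>x. \<Sum>i<n. c i *\<^sub>R b i x)}" for n :: nat
  have T_sub: "T n \<subseteq> S" if "n \<le> N" for n
  proof
    fix f assume "f \<in> T n"
    then obtain c where f: "f = (\<lambda>x. \<Sum>i<n. c i *\<^sub>R b i x)" by (auto simp: T_def)
    have "(\<Sum>i<n. c i *\<^sub>R b i x) = (\<Sum>i<N. (if i < n then c i else 0) *\<^sub>R b i x)" for x
      using that by (intro sum.mono_neutral_cong_left) auto
    then have "f = (\<lambda>x. \<Sum>i<N. (if i < n then c i else 0) *\<^sub>R b i x)" by (simp add: f)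
    then show "f \<in> S" unfolding S mem_Collect_eq by (intro exI)
  qed
  have T_lincomb: "(\<lambda>x. f x + c *\<^sub>R g x) \<in> T n" if fg: "f \<in> T n" "g \<in> T n" for f g c n
  proof -
    obtain k k' where k: "f = (\<lambda>x. \<Sum>i<n. k i *\<^sub>R b i x)" "g = (\<lambda>x. \<Sum>i<n. k' i *\<^sub>R b i x)"
      using fg by (auto simp: T_def)
    have eq: "(\<lambda>x. f x + c *\<^sub>R g x) = (\<lambda>x. \<Sum>i<n. (k i + c * k' i) *\<^sub>R b i x)"
      by (simp add: k scaleR_sum_right sum.distrib scaleR_left_distrib)
    show ?thesis unfolding T_def mem_Collect_eq by (intro exI, rule eq)
  qed
  have T_Suc: "\<exists>p\<in>T n. \<exists>c. f = (\<lambda>x. p x + c *\<^sub>R b n x)" if "f \<in> T (Suc n)" for f n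
    using that by (auto simp: T_def)
  have b_T: "b n \<in> T (Suc n)" for n
  proof -
    have "b n x = (\<Sum>i<Suc n. (if i = n then 1 else 0) *\<^sub>R b i x)" for x
      by (simp add: if_distrib[of "\<lambda>a. a *\<^sub>R _"] cong: if_cong)
    then have eq: "b n = (\<lambda>x. \<Sum>i<Suc n. (if i = n then 1 else 0) *\<^sub>R b i x)" by blast
    show ?thesis unfolding T_def mem_Collect_eq by (intro exI, rule eq)
  qed
  have T_mono: "T n \<subseteq> T (Suc n)" for n
  proof
    fix f assume "f \<in> T n"
    then obtain c where f: "f = (\<lambda>x. \<Sum>i<n. c i *\<^sub>R b i x)" by (auto simp: T_def)
    have eq: "f = (\<lambda>x. \<Sum>i<Suc n. (if i < n then c i else 0) *\<^sub>R b i x)" by (simp add: f)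
    show "f \<in> T (Suc n)" unfolding T_def mem_Collect_eq by (intro exI, rule eq)
  qed
  have "\<exists>r\<in>T n. \<forall>q\<in>T n. B r q = F q"
    if "n \<le> N" and "\<And>p q c. p \<in> S \<Longrightarrow> q \<in> S \<Longrightarrow> F (\<lambda>x. p x + c *\<^sub>R q x) = F p + c * F q"
      and "\<And>q. q \<in> S \<Longrightarrow> B q q = 0 \<Longrightarrow> F q = 0" for n F
    using that
  proof (induction n arbitrary: F)
    case 0
    have T0: "T 0 = {\<lambda>x. 0}" by (auto simp: T_def)
    then have "(\<lambda>x. 0) \<in> S" using T_sub[of 0] by simp
    then have "F (\<lambda>x. 0) = 0" "B (\<lambda>x. 0) (\<lambda>x. 0) = 0"
      using "0.prems"(2)[of "\<lambda>x. 0" "\<lambda>x. 0" 1] left[of "\<lambda>x. 0" "\<lambda>x. 0" "\<lambda>x. 0" 1] by simp_all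
    then show ?case using T0 by simp
  next
    case (Suc n)
    note F = Suc.prems(2) and null = Suc.prems(3)
    have sub: "T n \<subseteq> S" "T (Suc n) \<subseteq> S" using T_sub Suc.prems(1) by simp_all
    have bS: "b n \<in> S" using b_T sub by blast
    have n: "n \<le> N" using Suc.prems(1) by simp
    have "\<exists>p\<in>T n. \<forall>q\<in>T n. B p q = B (b n) q"
      by (rule Suc.IH[OF n]) (rule right[OF _ _ bS] null_orthogonal[OF bS]; assumption)+
    then obtain p where p: "p \<in> T n" "\<forall>q\<in>T n. B p q = B (b n) q" by blast
    have "\<exists>r\<in>T n. \<forall>q\<in>T n. B r q = F q"
      by (rule Suc.IH[OF n]) (rule F null; assumption)+
    then obtain r where r: "r \<in> T n" "\<forall>q\<in>T n. B r q = F q" by blast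
    let ?b' = "\<lambda>x. b n x + (- 1) *\<^sub>R p x"
    \<comment> \<open>If the new direction is null, division by zero makes \<open>t = 0\<close>, and no correction is needed since the
      functional vanishes on null vectors.\<close>
    define t where "t = F ?b' / B ?b' ?b'"
    have pS: "p \<in> S" and rS: "r \<in> S" using p(1) r(1) sub by auto
    have b': "?b' \<in> T (Suc n)" using T_lincomb[OF b_T] p(1) T_mono by blast
    then have b'S: "?b' \<in> S" using sub by blast
    have orth: "B ?b' q = 0" if "q \<in> T n" for q
      using left[OF bS pS, of q "-1"] p(2) that sub by auto
    let ?r = "\<lambda>x. r x + t *\<^sub>R ?b' x"
    have tb: "t * B ?b' ?b' = F ?b'"
      using null[OF b'S] by (cases "B ?b' ?b' = 0") (simp_all add: t_def)
    have "B ?r q = F q" if q: "q \<in> T (Suc n)" for q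
    proof -
      obtain q0 c where q0: "q0 \<in> T n" "q = (\<lambda>x. q0 x + c *\<^sub>R b n x)" using T_Suc[OF q] by blast
      let ?q1 = "\<lambda>x. q0 x + c *\<^sub>R p x"
      have q1: "?q1 \<in> T n" using T_lincomb q0 p by blast
      then have q1S: "?q1 \<in> S" using sub by blast
      have qe: "q = (\<lambda>x. ?q1 x + c *\<^sub>R ?b' x)" by (simp add: q0 algebra_simps)
      have "B ?r q = B r q + t * B ?b' q" using left[OF rS b'S] q sub by blast
      also have "B r q = B r ?q1 + c * B r ?b'" unfolding qe by (rule right[OF q1S b'S rS])
      also have "B r ?b' = 0" using orth[OF r(1)] sym by simp
      also have "B ?b' q = B ?b' ?q1 + c * B ?b' ?b'" unfolding qe by (rule right[OF q1S b'S b'S])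
      also have "B ?b' ?q1 = 0" using orth[OF q1] .
      finally have "B ?r q = B r ?q1 + c * (t * B ?b' ?b')" by simp
      also have "\<dots> = F ?q1 + c * F ?b'" using r(2) q1 tb by simp
      also have "\<dots> = F q" unfolding qe using F[OF q1S b'S] by simp
      finally show ?thesis .
    qed
    moreover have "?r \<in> T (Suc n)" using T_lincomb[OF _ b'] r(1) T_mono by blast
    ultimately show ?case by blast
  qed
  from this[of N F] F null show ?thesis unfolding S T_def by auto
qed

end

section \<open>The potential\<close>

lemma convex_tangent_bound:
  fixes \<psi> :: "real \<Rightarrow> real"
  assumes "convex_on UNIV \<psi>" "\<psi> differentiable_on UNIV"
  shows "deriv \<psi> a * h \<le> \<psi> (a + h) - \<psi> a"
proof -
  have "(\<psi> has_real_derivative deriv \<psi> a) (at a)"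
    using assms(2) DERIV_deriv_iff_real_differentiable by (auto simp: differentiable_on_def)
  then have "(a + h - a) * deriv \<psi> a \<le> \<psi> (a + h) - \<psi> a"
    using convex_on_imp_above_tangent[OF assms(1), of a "a + h" "deriv \<psi> a"] by (simp add: mult.commute)
  then show ?thesis by (simp add: mult.commute)
qed

lemma convex_deriv_mono:
  fixes \<psi> :: "real \<Rightarrow> real"
  assumes "convex_on UNIV \<psi>" "\<psi> differentiable_on UNIV" shows "mono (deriv \<psi>)"
proof (rule monoI)
  fix a b :: real assume "a \<le> b"
  have "(deriv \<psi> b - deriv \<psi> a) * (b - a) \<ge> 0"
    using convex_tangent_bound[OF assms, of a "b - a"] convex_tangent_bound[OF assms, of b "a - b"]
    by (simp add: algebra_simps)
  then show "deriv \<psi> a \<le> deriv \<psi> b"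
    using \<open>a \<le> b\<close> by (cases "a = b") (auto simp: zero_le_mult_iff)
qed

text \<open>Mean value theorem, and the one-sided Lipschitz condition at the intermediate point. This quadratic
  bound makes the first variation of the potential energy accessible without exchanging limits and
  integrals.\<close>

lemma lipschitz_deriv_upper_bound:
  fixes \<psi> :: "real \<Rightarrow> real"
  assumes diff: "\<psi> differentiable_on UNIV"
    and lip: "\<And>a b. (deriv \<psi> a - deriv \<psi> b) * (a - b) \<le> L * (a - b)\<^sup>2"
  shows "\<psi> (a + h) - \<psi> a \<le> deriv \<psi> a * h + \<bar>L\<bar> * h\<^sup>2"
proof -
  have der: "(\<psi> has_real_derivative deriv \<psi> x) (at x)" for x
    using diff DERIV_deriv_iff_real_differentiable by (auto simp: differentiable_on_def)
  let ?g = "\<lambda>s. \<psi> (a + s * h)"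
  have "(?g has_real_derivative deriv \<psi> (a + s * h) * h) (at s)" for s
    by (rule DERIV_chain2[OF der]) (auto intro!: derivative_eq_intros)
  then obtain s where s: "0 < s" "s < 1" "?g 1 - ?g 0 = deriv \<psi> (a + s * h) * h"
    using MVT2[of 0 1 ?g "\<lambda>s. deriv \<psi> (a + s * h) * h"] by auto
  have "s * ((deriv \<psi> (a + s * h) - deriv \<psi> a) * h) \<le> L * (s * h)\<^sup>2"
    using lip[of "a + s * h" a] by (simp add: mult_ac)
  also have "\<dots> \<le> s * (\<bar>L\<bar> * h\<^sup>2)"
  proof -
    have "L * (s * h)\<^sup>2 \<le> \<bar>L\<bar> * (s * h)\<^sup>2" by (simp add: mult_right_mono)
    also have "\<dots> = s * (s * (\<bar>L\<bar> * h\<^sup>2))" by (simp add: power2_eq_square mult_ac)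
    also have "\<dots> \<le> s * (1 * (\<bar>L\<bar> * h\<^sup>2))" using s by (intro mult_left_mono mult_right_mono) auto
    finally show ?thesis by simp
  qed
  finally have "(deriv \<psi> (a + s * h) - deriv \<psi> a) * h \<le> \<bar>L\<bar> * h\<^sup>2" using s by simp
  then show ?thesis using s(3) by (simp add: algebra_simps)
qed

section \<open>The discrete dual norm\<close>

text \<open>The member \<open>one\<close> of \<open>Q\<close> serves to shift functions to mean zero, and as the constant test function.\<close>

locale discrete_dual_norm = bounded_connected_domain \<Omega> for \<Omega> :: "(real^'d) set" +
  fixes Q :: "(real^'d \<Rightarrow> real) set" and m :: real and one :: "real^'d \<Rightarrow> real"
  assumes Q_finite_element: "finite_element_space \<Omega> Q" and Q_H1: "Q \<subseteq> H1 \<Omega>"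
    and one_Q: "one \<in> Q" and one_AE: "AE x in lebesgue_on \<Omega>. one x = 1" and m_pos: "0 < m"
begin

lemma Q_lincomb: "p \<in> Q \<Longrightarrow> q \<in> Q \<Longrightarrow> (\<lambda>x. p x + c *\<^sub>R q x) \<in> Q"
  by (rule finite_element_space_lincomb[OF Q_finite_element])

lemma Q_L2: "q \<in> Q \<Longrightarrow> q \<in> L2 \<Omega>"
  and Q_grad_L2: "q \<in> Q \<Longrightarrow> weak_grad \<Omega> q \<in> L2 \<Omega>"
  using Q_H1 H1_weak_grad by blast+

lemma Q_grad_lincomb:
  "p \<in> Q \<Longrightarrow> q \<in> Q \<Longrightarrow>
    AE x in lebesgue_on \<Omega>. weak_grad \<Omega> (\<lambda>x. p x + c *\<^sub>R q x) x = weak_grad \<Omega> p x + c *\<^sub>R weak_grad \<Omega> q x"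
  using weak_grad_lincomb(2) Q_H1 unfolding real_scaleR_def by blast

definition grad_form :: "(real^'d \<Rightarrow> real) \<Rightarrow> (real^'d \<Rightarrow> real) \<Rightarrow> real" where
  "grad_form p q = m * L2_inner \<Omega> (weak_grad \<Omega> p) (weak_grad \<Omega> q)"

lemma grad_inner_lincomb:
  assumes "p \<in> Q" "q \<in> Q" "g \<in> L2 \<Omega>"
  shows "L2_inner \<Omega> (weak_grad \<Omega> (\<lambda>x. p x + c *\<^sub>R q x)) g =
    L2_inner \<Omega> (weak_grad \<Omega> p) g + c * L2_inner \<Omega> (weak_grad \<Omega> q) g"
proof -
  have "L2_inner \<Omega> (weak_grad \<Omega> (\<lambda>x. p x + c *\<^sub>R q x)) g =
      L2_inner \<Omega> (\<lambda>x. weak_grad \<Omega> p x + c *\<^sub>R weak_grad \<Omega> q x) g"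
    using assms by (intro L2_inner_cong_AE Q_grad_lincomb Q_grad_L2 Q_lincomb L2_lincomb) auto
  then show ?thesis using assms by (simp add: L2_inner_lincomb_left Q_grad_L2)
qed

sublocale grad: semidefinite_form Q grad_form
proof
  show "grad_form (\<lambda>x. p x + c *\<^sub>R q x) r = grad_form p r + c * grad_form q r"
    if "p \<in> Q" "q \<in> Q" "r \<in> Q" for p q r c
    using that by (simp only: grad_form_def grad_inner_lincomb Q_grad_L2) (simp add: algebra_simps)
qed (use m_pos Q_lincomb in \<open>auto simp: grad_form_def L2_inner_commute L2_inner_nonneg\<close>)

lemma grad_form_one: "p \<in> Q \<Longrightarrow> grad_form p one = 0"
proof -
  assume p: "p \<in> Q"
  have "AE x in lebesgue_on \<Omega>. weak_grad \<Omega> one x = 0"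
    using weak_grad_AE_const one_Q one_AE Q_H1 by blast
  then have "L2_inner \<Omega> (weak_grad \<Omega> p) (weak_grad \<Omega> one) = L2_inner \<Omega> (weak_grad \<Omega> p) (\<lambda>x. 0)"
    using p one_Q by (intro L2_inner_cong_AE Q_grad_L2 L2_zero) auto
  then show ?thesis by (simp add: grad_form_def L2_inner_def)
qed

lemma integral_eq_inner_one:
  assumes "g \<in> L2 \<Omega>" shows "(LINT x|lebesgue_on \<Omega>. g x) = L2_inner \<Omega> g one"
proof -
  have "L2_inner \<Omega> g one = L2_inner \<Omega> g (\<lambda>x. 1)"
    using one_AE by (intro L2_inner_cong_AE assms Q_L2[OF one_Q] L2_const) auto
  then show ?thesis by (simp add: L2_inner_def)
qed

lemma inner_one_one_pos: "0 < L2_inner \<Omega> one one"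
proof -
  have "L2_inner \<Omega> one one = L2_inner \<Omega> (\<lambda>x. 1) (\<lambda>x. 1::real)"
    using one_Q one_AE by (intro L2_inner_cong_AE Q_L2 L2_const) auto
  then show ?thesis using measure_domain_pos by (simp add: L2_inner_def)
qed

lemma grad_form_null_const:
  assumes "q \<in> Q" "grad_form q q = 0" obtains c where "AE x in lebesgue_on \<Omega>. q x = c"
proof -
  have "AE x in lebesgue_on \<Omega>. weak_grad \<Omega> q x = 0"
    using assms m_pos by (intro L2_inner_self_eq_0 Q_grad_L2) (auto simp: grad_form_def)
  then show ?thesis using AE_const_if_weak_grad_zero[of q] assms Q_H1 that by blast
qed

text \<open>The null vectors of the gradient form are the constants, on which the functional vanishes because \<open>g\<close>
  has mean zero.\<close>

lemma grad_representation:
  assumes g: "g \<in> L2 \<Omega>" "L2_inner \<Omega> g one = 0"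
  obtains r where "r \<in> Q" "\<And>q. q \<in> Q \<Longrightarrow> grad_form r q = L2_inner \<Omega> g q"
proof -
  obtain N :: nat and b where S: "Q = {f. \<exists>c. f = (\<lambda>x. \<Sum>i<N. c i *\<^sub>R b i x)}"
    using Q_finite_element unfolding finite_element_space_def by blast
  have "\<exists>r\<in>Q. \<forall>q\<in>Q. grad_form r q = L2_inner \<Omega> g q"
  proof (rule grad.representation[OF S])
    show "L2_inner \<Omega> g (\<lambda>x. p x + c *\<^sub>R q x) = L2_inner \<Omega> g p + c * L2_inner \<Omega> g q"
      if "p \<in> Q" "q \<in> Q" for p q c
      using that by (intro L2_inner_lincomb_right Q_L2 g(1))
    show "L2_inner \<Omega> g q = 0" if q: "q \<in> Q" "grad_form q q = 0" for q
    proof -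
      obtain c where c: "AE x in lebesgue_on \<Omega>. q x = c" using grad_form_null_const q by blast
      have "L2_inner \<Omega> g q = L2_inner \<Omega> g (\<lambda>x. c *\<^sub>R one x)"
      proof (intro L2_inner_cong_AE[OF g(1) g(1) Q_L2[OF q(1)] L2_scaleR[OF Q_L2[OF one_Q]]])
        show "AE x in lebesgue_on \<Omega>. q x = c *\<^sub>R one x" using c one_AE by eventually_elim simp
      qed simp
      also have "\<dots> = c * L2_inner \<Omega> g one"
        by (simp only: L2_inner_commute[of \<Omega> g] L2_inner_scaleR)
      finally show ?thesis using g(2) by simp
    qed
  qed
  then show ?thesis using that by blast
qed

lemma weighted_norm_eq: "weighted_norm \<Omega> m q = sqrt (grad_form q q)"
proof -
  have "L2_inner \<Omega> (\<lambda>x. sqrt m *\<^sub>R weak_grad \<Omega> q x) (\<lambda>x. sqrt m *\<^sub>R weak_grad \<Omega> q x)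
      = sqrt m * (sqrt m * L2_inner \<Omega> (weak_grad \<Omega> q) (weak_grad \<Omega> q))"
    using L2_inner_commute L2_inner_scaleR by metis
  then show ?thesis using m_pos by (simp add: weighted_norm_def L2_norm_def grad_form_def)
qed

text \<open>Cauchy-Schwarz bounds all quotients, and \<open>r\<close> shifted to mean zero attains the bound: the shift changes
  neither \<open>grad_form r r\<close> nor the value of the functional. If \<open>r\<close> is a null vector, the supremum is the
  inserted \<open>0\<close>.\<close>

lemma dual_norm_eq:
  assumes g: "g \<in> L2 \<Omega>" "L2_inner \<Omega> g one = 0"
    and r: "r \<in> Q" "\<And>q. q \<in> Q \<Longrightarrow> grad_form r q = L2_inner \<Omega> g q"
  shows "dual_norm \<Omega> Q m (L2_inner \<Omega> g) = sqrt (grad_form r r)"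
proof -
  let ?S = "{L2_inner \<Omega> g q / weighted_norm \<Omega> m q |q.
    q \<in> mean_zero \<Omega> Q \<and> \<not> (AE x in lebesgue_on \<Omega>. q x = 0)}"
  have rr: "0 \<le> grad_form r r" using r grad.nonneg by blast
  have up: "y \<le> sqrt (grad_form r r)" if yS: "y \<in> insert 0 ?S" for y
  proof (cases "y = 0")
    case True
    then show ?thesis using rr by simp
  next
    case False
    then obtain q where q: "q \<in> Q" "y = L2_inner \<Omega> g q / sqrt (grad_form q q)"
      using yS by (auto simp: mean_zero_def weighted_norm_eq)
    from q(2) have y: "y = grad_form r q / sqrt (grad_form q q)" by (simp only: r(2)[OF q(1)])
    then have "0 < sqrt (grad_form q q)" using False grad.nonneg[OF q(1)] by (simp add: less_le)
    then show ?thesis using grad.cauchy_schwarz[OF r(1) q(1)] y by (simp add: divide_le_eq)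
  qed
  have mem: "sqrt (grad_form r r) \<in> insert 0 ?S"
  proof (cases "grad_form r r = 0")
    case False
    define c where "c = - L2_inner \<Omega> r one / L2_inner \<Omega> one one"
    define q where "q = (\<lambda>x. r x + c *\<^sub>R one x)"
    have q: "q \<in> Q" using Q_lincomb r(1) one_Q unfolding q_def by blast
    have "(LINT x|lebesgue_on \<Omega>. q x) = L2_inner \<Omega> r one + c * L2_inner \<Omega> one one"
      unfolding integral_eq_inner_one[OF Q_L2[OF q]] unfolding q_def
      by (intro L2_inner_lincomb_left Q_L2 r one_Q)
    then have mz: "q \<in> mean_zero \<Omega> Q"
      using q inner_one_one_pos by (simp add: mean_zero_def c_def)
    have qq: "grad_form q q = grad_form r r"
      unfolding q_def using grad.square[OF r(1) one_Q, of c] grad_form_one r(1) one_Q by simp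
    have gq: "L2_inner \<Omega> g q = grad_form r r"
      using r(2)[OF q] grad.right[OF r(1) one_Q r(1), of c] grad_form_one[OF r(1)] by (simp add: q_def)
    have "\<not> (AE x in lebesgue_on \<Omega>. q x = 0)"
    proof
      assume "AE x in lebesgue_on \<Omega>. q x = 0"
      then have "L2_inner \<Omega> g q = L2_inner \<Omega> g (\<lambda>x. 0)"
        by (intro L2_inner_cong_AE[OF g(1) g(1) Q_L2[OF q] L2_zero]) auto
      then show False using gq False by (simp add: L2_inner_def)
    qed
    moreover have "sqrt (grad_form r r) = L2_inner \<Omega> g q / weighted_norm \<Omega> m q"
      using rr by (simp add: weighted_norm_eq qq gq real_div_sqrt)
    ultimately show ?thesis using mz by blast
  qed simp
  show ?thesis unfolding dual_norm_def using cSup_eq_maximum[OF mem up] by simp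
qed

lemma dual_norm_square:
  assumes g: "g \<in> L2 \<Omega>" "L2_inner \<Omega> g one = 0"
    and r: "r \<in> Q" "\<And>q. q \<in> Q \<Longrightarrow> grad_form r q = L2_inner \<Omega> g q"
  shows "(dual_norm \<Omega> Q m (L2_inner \<Omega> g))\<^sup>2 = grad_form r r"
  using dual_norm_eq[OF assms] grad.nonneg[OF r(1)] by simp

lemma dual_norm_square_increment:
  assumes g: "g \<in> L2 \<Omega>" "L2_inner \<Omega> g one = 0"
    and r: "r \<in> Q" "\<And>q. q \<in> Q \<Longrightarrow> grad_form r q = L2_inner \<Omega> g q"
    and q: "q \<in> Q" "L2_inner \<Omega> q one = 0"
  shows "(dual_norm \<Omega> Q m (L2_inner \<Omega> (\<lambda>x. g x + t *\<^sub>R q x)))\<^sup>2 =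
    (dual_norm \<Omega> Q m (L2_inner \<Omega> g))\<^sup>2 + 2 * t * L2_inner \<Omega> q r + t\<^sup>2 * (dual_norm \<Omega> Q m (L2_inner \<Omega> q))\<^sup>2"
proof -
  obtain p where p: "p \<in> Q" "\<And>s. s \<in> Q \<Longrightarrow> grad_form p s = L2_inner \<Omega> q s"
    using grad_representation[OF Q_L2[OF q(1)] q(2)] by blast
  let ?g = "\<lambda>x. g x + t *\<^sub>R q x" and ?r = "\<lambda>x. r x + t *\<^sub>R p x"
  have "(dual_norm \<Omega> Q m (L2_inner \<Omega> ?g))\<^sup>2 = grad_form ?r ?r"
  proof (rule dual_norm_square)
    show "?g \<in> L2 \<Omega>" by (intro L2_lincomb g Q_L2 q)
    show "L2_inner \<Omega> ?g one = 0"
      using L2_inner_lincomb_left[OF g(1) Q_L2[OF q(1)] Q_L2[OF one_Q], of t] g(2) q(2) by simp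
    show "?r \<in> Q" by (intro Q_lincomb r p)
    show "grad_form ?r s = L2_inner \<Omega> ?g s" if "s \<in> Q" for s
      using grad.left[OF r(1) p(1) that, of t] L2_inner_lincomb_left[OF g(1) Q_L2[OF q(1)] Q_L2[OF that], of t]
        r(2) p(2) that by simp
  qed
  also have "\<dots> = grad_form r r + 2 * t * grad_form p r + t\<^sup>2 * grad_form p p"
    using grad.square[OF r(1) p(1), of t] grad.sym[of r p] by simp
  also have "grad_form p r = L2_inner \<Omega> q r" using p(2) r(1) by blast
  also have "grad_form r r = (dual_norm \<Omega> Q m (L2_inner \<Omega> g))\<^sup>2"
    by (rule dual_norm_square[OF g r, symmetric])
  also have "grad_form p p = (dual_norm \<Omega> Q m (L2_inner \<Omega> q))\<^sup>2"
    by (rule dual_norm_square[OF Q_L2[OF q(1)] q(2) p, symmetric])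
  finally show ?thesis .
qed

text \<open>Finite element functions are bounded almost everywhere, so locally bounded nonlinearities preserve
  square integrability without any growth condition.\<close>

lemma Q_comp_L2:
  assumes s: "s \<in> Q" and g: "g \<in> borel_measurable borel"
    and bd: "\<And>B. \<exists>M. \<forall>x. \<bar>x\<bar> \<le> B \<longrightarrow> \<bar>g x\<bar> \<le> (M::real)"
  shows "(\<lambda>x. g (s x)) \<in> L2 \<Omega>"
proof -
  obtain B where B: "AE x in lebesgue_on \<Omega>. norm (s x) \<le> B"
    using finite_element_AE_bounded[OF bounded_domain domain_sets Q_finite_element s] by blast
  obtain M where M: "\<And>x. \<bar>x\<bar> \<le> B \<Longrightarrow> \<bar>g x\<bar> \<le> M" using bd by blast
  show ?thesis
  proof (rule AE_bounded_L2)
    show "(\<lambda>x. g (s x)) \<in> borel_measurable (lebesgue_on \<Omega>)"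
      using measurable_comp[OF L2_measurable[OF Q_L2[OF s]] g] by (simp add: comp_def)
    show "AE x in lebesgue_on \<Omega>. \<bar>g (s x)\<bar> \<le> M"
      using B by eventually_elim (use M in simp)
  qed
qed

lemma Q_comp_continuous_L2:
  assumes "s \<in> Q" and g: "continuous_on UNIV (g :: real \<Rightarrow> real)" shows "(\<lambda>x. g (s x)) \<in> L2 \<Omega>"
proof (rule Q_comp_L2[OF assms(1)])
  show "g \<in> borel_measurable borel" using g by (rule borel_measurable_continuous_onI)
  fix B :: real
  have "bounded (g ` {-B..B})"
    using g by (intro compact_imp_bounded compact_continuous_image) (auto intro: continuous_on_subset)
  then obtain M where "\<forall>x\<in>{-B..B}. \<bar>g x\<bar> \<le> M" by (auto simp: bounded_iff)
  then show "\<exists>M. \<forall>x. \<bar>x\<bar> \<le> B \<longrightarrow> \<bar>g x\<bar> \<le> M" by (intro exI[of _ M]) (simp add: abs_le_iff)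
qed

lemma Q_comp_mono_L2:
  assumes "s \<in> Q" and g: "mono (g :: real \<Rightarrow> real)" shows "(\<lambda>x. g (s x)) \<in> L2 \<Omega>"
proof (rule Q_comp_L2[OF assms(1)])
  show "g \<in> borel_measurable borel" using g by (rule borel_measurable_mono)
  fix B :: real
  have "\<bar>g x\<bar> \<le> \<bar>g (-B)\<bar> + \<bar>g B\<bar>" if "\<bar>x\<bar> \<le> B" for x
    using monoD[OF g, of "-B" x] monoD[OF g, of x B] that by linarith
  then show "\<exists>M. \<forall>x. \<bar>x\<bar> \<le> B \<longrightarrow> \<bar>g x\<bar> \<le> M" by blast
qed

end

section \<open>The incremental energy and its first variation\<close>

lemma transpose_linear: "linear (transpose :: real^'n^'m \<Rightarrow> real^'m^'n)"
  by (auto simp: linear_iff transpose_def vec_eq_iff)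

text \<open>Written as a sum of linear images of the gradients of the components, the Jacobian inherits measurability
  and square integrability from them.\<close>

lemma weak_jacobian_eq_sum:
  "weak_jacobian \<Omega> u x = (\<Sum>i\<in>UNIV. \<chi> k. if k = i then weak_grad \<Omega> (\<lambda>y. u y $ i) x else 0)"
  by (simp add: weak_jacobian_def vec_eq_iff if_distrib[of "\<lambda>v. v $ _"] cong: if_cong)

lemma weak_jacobian_L2:
  assumes "\<And>i. (\<lambda>y. u y $ i) \<in> H1 \<Omega>" shows "weak_jacobian \<Omega> u \<in> L2 \<Omega>"
proof -
  have "(\<lambda>x. \<chi> k. if k = i then weak_grad \<Omega> (\<lambda>y. u y $ i) x else 0) \<in> L2 \<Omega>" for i
    by (rule L2_linear_image[where A="\<lambda>g. \<chi> k. if k = i then g else 0"])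
      (auto simp: linear_iff vec_eq_iff H1_weak_grad(2)[OF assms])
  then have "(\<lambda>x. \<Sum>i\<in>UNIV. \<chi> k. if k = i then weak_grad \<Omega> (\<lambda>y. u y $ i) x else 0) \<in> L2 \<Omega>"
    by (intro L2_sum) auto
  then show ?thesis by (simp add: weak_jacobian_eq_sum[abs_def])
qed

locale phase_field_step = discrete_dual_norm \<Omega> Q m one
  for \<Omega> :: "(real^'d) set" and Q m one +
  fixes V :: "(real^'d \<Rightarrow> real^'d) set"
    and \<gamma> l \<tau> \<xi> L c\<^sub>l c\<^sub>u :: real
    and \<Psi> \<Psi>\<^sub>c \<Psi>\<^sub>e :: "real \<Rightarrow> real"
    and \<C> :: "real^'d^'d \<Rightarrow> real^'d^'d"
    and R \<phi>\<^sub>0 :: "real^'d \<Rightarrow> real" and f :: "real^'d \<Rightarrow> real^'d"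
  assumes V_finite_element: "finite_element_space \<Omega> V" and V_H1_0: "V \<subseteq> H1_0_vec \<Omega>"
    and \<gamma>_pos: "\<gamma> > 0" and l_pos: "l > 0" and \<tau>_pos: "\<tau> > 0"
    and R_L2: "R \<in> L2 \<Omega>" and f_L2: "f \<in> L2 \<Omega>"
    and potential: "convex_splitting \<Psi> \<Psi>\<^sub>c \<Psi>\<^sub>e L"
    and elasticity: "elasticity_tensor \<Omega> \<C> c\<^sub>l c\<^sub>u"
    and \<phi>\<^sub>0_Q: "\<phi>\<^sub>0 \<in> Q"
begin

lemma V_lincomb: "u \<in> V \<Longrightarrow> v \<in> V \<Longrightarrow> (\<lambda>x. u x + c *\<^sub>R v x) \<in> V"
  by (rule finite_element_space_lincomb[OF V_finite_element])

lemma V_component_H1: "v \<in> V \<Longrightarrow> (\<lambda>y. v y $ i) \<in> H1 \<Omega>"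
  using V_H1_0 by (auto simp: H1_0_vec_def H1_0_def)

lemma V_L2: assumes "v \<in> V" shows "v \<in> L2 \<Omega>"
proof -
  have "(\<lambda>x. (v x $ i) *\<^sub>R (axis i 1 :: real^'d)) \<in> L2 \<Omega>" for i
    by (rule L2_linear_image[where A="\<lambda>t. t *\<^sub>R (axis i 1 :: real^'d)"])
      (auto simp: linear_iff scaleR_left_distrib H1_weak_grad(1)[OF V_component_H1[OF assms]])
  then have sum: "(\<lambda>x. \<Sum>i\<in>UNIV. (v x $ i) *\<^sub>R (axis i 1 :: real^'d)) \<in> L2 \<Omega>" by (intro L2_sum) auto
  have eq: "(\<Sum>i\<in>UNIV. (v x $ i) *\<^sub>R (axis i 1 :: real^'d)) = v x" for x
    using basis_expansion[of "v x"] by (simp only: scalar_mult_eq_scaleR)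
  show ?thesis using sum unfolding eq .
qed

lemma strain_L2:
  assumes "v \<in> V" shows "strain \<Omega> v \<in> L2 \<Omega>"
proof -
  have "linear (\<lambda>M :: real^'d^'d. (1/2) *\<^sub>R (M + transpose M))"
    by (simp add: linear_iff linear_add[OF transpose_linear] linear_cmul[OF transpose_linear] algebra_simps)
  from L2_linear_image[OF this weak_jacobian_L2[OF V_component_H1[OF assms]]]
  show ?thesis by (simp only: strain_def[abs_def])
qed

lemma strain_lincomb:
  assumes "u \<in> V" "v \<in> V"
  shows "AE x in lebesgue_on \<Omega>. strain \<Omega> (\<lambda>x. u x + c *\<^sub>R v x) x = strain \<Omega> u x + c *\<^sub>R strain \<Omega> v x"
proof -
  have "AE x in lebesgue_on \<Omega>. \<forall>i. weak_grad \<Omega> (\<lambda>y. u y $ i + c * v y $ i) x =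
      weak_grad \<Omega> (\<lambda>y. u y $ i) x + c *\<^sub>R weak_grad \<Omega> (\<lambda>y. v y $ i) x"
    unfolding AE_all_countable using assms V_component_H1 weak_grad_lincomb(2) by blast
  then show ?thesis
    by eventually_elim
      (simp add: strain_def weak_jacobian_def vec_eq_iff transpose_def algebra_simps)
qed

abbreviation eps where "eps \<equiv> elastic_strain \<Omega> \<xi>"

lemma swelling_L2:
  assumes "q \<in> L2 \<Omega>" shows "(\<lambda>x. (q x * \<xi>) *\<^sub>R (mat 1 :: real^'d^'d)) \<in> L2 \<Omega>"
  by (rule L2_linear_image[where A="\<lambda>t. (t * \<xi>) *\<^sub>R (mat 1 :: real^'d^'d)", OF _ assms])
    (auto simp: linear_iff algebra_simps)

lemma eps_eq: "eps s w = (\<lambda>x. strain \<Omega> w x + (- 1) *\<^sub>R ((s x * \<xi>) *\<^sub>R mat 1))"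
  by (simp add: elastic_strain_def[abs_def] mult.commute)

lemma eps_L2_sym:
  assumes "s \<in> Q" "w \<in> V" shows "eps s w \<in> L2_sym \<Omega>"
proof -
  have "eps s w \<in> L2 \<Omega>"
    unfolding eps_eq by (intro L2_lincomb strain_L2 swelling_L2 Q_L2 assms)
  moreover have "transpose (eps s w x) = eps s w x" for x
    by (simp add: elastic_strain_def strain_def transpose_def mat_def vec_eq_iff)
  ultimately show ?thesis by (simp add: L2_sym_def)
qed

lemma eps_L2: "s \<in> Q \<Longrightarrow> w \<in> V \<Longrightarrow> eps s w \<in> L2 \<Omega>"
  using eps_L2_sym by (simp add: L2_sym_def)

lemmas elasticity_unfolded = elasticity[unfolded elasticity_tensor_def]

lemmas tensor_linear = elasticity_unfolded[THEN conjunct1]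

lemmas tensor_lower_bound =
  elasticity_unfolded[THEN conjunct2, THEN conjunct2, THEN conjunct2, THEN conjunct1, THEN bspec, THEN conjunct1]

lemmas tensor_symmetric =
  elasticity_unfolded[THEN conjunct2, THEN conjunct2, THEN conjunct2, THEN conjunct2, THEN bspec, THEN bspec]

lemma tensor_L2: "e \<in> L2 \<Omega> \<Longrightarrow> (\<lambda>x. \<C> (e x)) \<in> L2 \<Omega>"
  by (rule L2_linear_image[OF tensor_linear])

lemma eps_lincomb:
  assumes "s \<in> Q" "q \<in> Q" "w \<in> V" "v \<in> V"
  shows "AE x in lebesgue_on \<Omega>.
    eps (\<lambda>x. s x + c *\<^sub>R q x) (\<lambda>x. w x + c *\<^sub>R v x) x = eps s w x + c *\<^sub>R eps q v x"
  using strain_lincomb[OF assms(3,4), of c]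
  by eventually_elim (simp add: elastic_strain_def algebra_simps)

definition elastic_form :: "(real^'d \<Rightarrow> real^'d^'d) \<Rightarrow> (real^'d \<Rightarrow> real^'d^'d) \<Rightarrow> real" where
  "elastic_form e e' = L2_inner \<Omega> (\<lambda>x. \<C> (e x)) e'"

lemma elastic_form_sym: "e \<in> L2_sym \<Omega> \<Longrightarrow> e' \<in> L2_sym \<Omega> \<Longrightarrow> elastic_form e e' = elastic_form e' e"
  unfolding elastic_form_def by (rule tensor_symmetric)

lemma elastic_form_nonneg:
  assumes "e \<in> L2_sym \<Omega>" shows "0 \<le> elastic_form e e"
proof -
  have "0 < c\<^sub>l" using elasticity_unfolded[THEN conjunct2, THEN conjunct1] .
  then have "0 \<le> c\<^sub>l * (L2_norm \<Omega> e)\<^sup>2" by simp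
  also have "\<dots> \<le> elastic_form e e" unfolding elastic_form_def by (rule tensor_lower_bound[OF assms])
  finally show ?thesis .
qed

lemma elastic_energy_increment:
  fixes t :: real
  assumes "s \<in> Q" "q \<in> Q" "w \<in> V" "v \<in> V"
  defines "e \<equiv> eps (\<lambda>x. s x + t *\<^sub>R q x) (\<lambda>x. w x + t *\<^sub>R v x)"
  shows "elastic_form e e = elastic_form (eps s w) (eps s w)
    + 2 * t * elastic_form (eps s w) (eps q v) + t\<^sup>2 * elastic_form (eps q v) (eps q v)"
proof -
  let ?a = "eps s w" and ?b = "eps q v"
  have L: "?a \<in> L2 \<Omega>" "?b \<in> L2 \<Omega>" "e \<in> L2 \<Omega>"
    unfolding e_def by (intro eps_L2 Q_lincomb V_lincomb assms(1-4))+
  let ?e = "\<lambda>x. ?a x + t *\<^sub>R ?b x"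
  have ae: "AE x in lebesgue_on \<Omega>. e x = ?e x" unfolding e_def by (rule eps_lincomb[OF assms(1-4)])
  have Ce: "(\<lambda>x. \<C> (?e x)) = (\<lambda>x. \<C> (?a x) + t *\<^sub>R \<C> (?b x))"
    by (simp add: linear_add[OF tensor_linear] linear_cmul[OF tensor_linear])
  have "elastic_form e e = elastic_form ?e ?e"
    unfolding elastic_form_def using ae
    by (intro L2_inner_cong_AE tensor_L2 L2_lincomb L) (auto elim: eventually_mono)
  also have "\<dots> = L2_inner \<Omega> (\<lambda>x. \<C> (?a x)) ?e + t * L2_inner \<Omega> (\<lambda>x. \<C> (?b x)) ?e"
    unfolding elastic_form_def Ce by (intro L2_inner_lincomb_left tensor_L2 L2_lincomb L)
  also have "L2_inner \<Omega> (\<lambda>x. \<C> (?a x)) ?e = elastic_form ?a ?a + t * elastic_form ?a ?b"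
    unfolding elastic_form_def by (intro L2_inner_lincomb_right tensor_L2 L)
  also have "L2_inner \<Omega> (\<lambda>x. \<C> (?b x)) ?e = elastic_form ?b ?a + t * elastic_form ?b ?b"
    unfolding elastic_form_def by (intro L2_inner_lincomb_right tensor_L2 L)
  also have "elastic_form ?b ?a = elastic_form ?a ?b"
    by (intro elastic_form_sym eps_L2_sym assms)
  finally show ?thesis by (simp add: algebra_simps power2_eq_square)
qed

lemma gradient_energy_increment:
  fixes t :: real
  assumes "s \<in> Q" "q \<in> Q"
  defines "s' \<equiv> \<lambda>x. s x + t *\<^sub>R q x"
  shows "L2_inner \<Omega> (weak_grad \<Omega> s') (weak_grad \<Omega> s') = L2_inner \<Omega> (weak_grad \<Omega> s) (weak_grad \<Omega> s)
    + 2 * t * L2_inner \<Omega> (weak_grad \<Omega> s) (weak_grad \<Omega> q)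
    + t\<^sup>2 * L2_inner \<Omega> (weak_grad \<Omega> q) (weak_grad \<Omega> q)"
proof -
  have "m * L2_inner \<Omega> (weak_grad \<Omega> s') (weak_grad \<Omega> s') = m * (L2_inner \<Omega> (weak_grad \<Omega> s) (weak_grad \<Omega> s)
    + 2 * t * L2_inner \<Omega> (weak_grad \<Omega> s) (weak_grad \<Omega> q)
    + t\<^sup>2 * L2_inner \<Omega> (weak_grad \<Omega> q) (weak_grad \<Omega> q))"
    using grad.square[OF assms(1,2), of t] unfolding s'_def grad_form_def by (simp only: distrib_left mult_ac)
  then show ?thesis using m_pos by simp
qed

lemma potential_facts:
  shows convex_\<Psi>\<^sub>c: "convex_on UNIV \<Psi>\<^sub>c" and diff_\<Psi>\<^sub>c: "\<Psi>\<^sub>c differentiable_on UNIV"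
    and convex_\<Psi>\<^sub>e: "convex_on UNIV \<Psi>\<^sub>e" and diff_\<Psi>\<^sub>e: "\<Psi>\<^sub>e differentiable_on UNIV"
    and lipschitz_\<Psi>\<^sub>c: "(deriv \<Psi>\<^sub>c a - deriv \<Psi>\<^sub>c b) * (a - b) \<le> L * (a - b)\<^sup>2"
  using potential by (auto simp: convex_splitting_def)

lemma \<Psi>\<^sub>c_L2: "s \<in> Q \<Longrightarrow> (\<lambda>x. \<Psi>\<^sub>c (s x)) \<in> L2 \<Omega>"
  and deriv_\<Psi>\<^sub>c_L2: "s \<in> Q \<Longrightarrow> (\<lambda>x. deriv \<Psi>\<^sub>c (s x)) \<in> L2 \<Omega>"
  and deriv_\<Psi>\<^sub>e_L2: "s \<in> Q \<Longrightarrow> (\<lambda>x. deriv \<Psi>\<^sub>e (s x)) \<in> L2 \<Omega>"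
  using Q_comp_continuous_L2[OF _ differentiable_imp_continuous_on[OF diff_\<Psi>\<^sub>c]]
    Q_comp_mono_L2[OF _ convex_deriv_mono[OF convex_\<Psi>\<^sub>c diff_\<Psi>\<^sub>c]]
    Q_comp_mono_L2[OF _ convex_deriv_mono[OF convex_\<Psi>\<^sub>e diff_\<Psi>\<^sub>e]] by blast+

lemma potential_energy_increment:
  fixes t :: real
  assumes s: "s \<in> Q" and q: "q \<in> Q"
  defines "d \<equiv> (LINT x|lebesgue_on \<Omega>. \<Psi>\<^sub>c (s x + t *\<^sub>R q x)) - (LINT x|lebesgue_on \<Omega>. \<Psi>\<^sub>c (s x))"
  shows "t * L2_inner \<Omega> (\<lambda>x. deriv \<Psi>\<^sub>c (s x)) q \<le> d"
    and "d \<le> t * L2_inner \<Omega> (\<lambda>x. deriv \<Psi>\<^sub>c (s x)) q + t\<^sup>2 * (\<bar>L\<bar> * L2_inner \<Omega> q q)"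
proof -
  have i1: "integrable (lebesgue_on \<Omega>) (\<lambda>x. \<Psi>\<^sub>c (s x))"
    and i2: "integrable (lebesgue_on \<Omega>) (\<lambda>x. \<Psi>\<^sub>c (s x + t *\<^sub>R q x))"
    by (intro L2_integrable \<Psi>\<^sub>c_L2 Q_lincomb s q)+
  have i3: "integrable (lebesgue_on \<Omega>) (\<lambda>x. deriv \<Psi>\<^sub>c (s x) * q x)"
    and i4: "integrable (lebesgue_on \<Omega>) (\<lambda>x. q x * q x)"
    using L2_inner_integrable[OF deriv_\<Psi>\<^sub>c_L2[OF s] Q_L2[OF q]] L2_inner_integrable[OF Q_L2[OF q] Q_L2[OF q]] by simp_all
  have d: "d = (LINT x|lebesgue_on \<Omega>. \<Psi>\<^sub>c (s x + t *\<^sub>R q x) - \<Psi>\<^sub>c (s x))"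
    unfolding d_def using i1 i2 by simp
  have "(LINT x|lebesgue_on \<Omega>. t * (deriv \<Psi>\<^sub>c (s x) * q x)) \<le> d"
    unfolding d
  proof (rule integral_mono)
    show "t * (deriv \<Psi>\<^sub>c (s x) * q x) \<le> \<Psi>\<^sub>c (s x + t *\<^sub>R q x) - \<Psi>\<^sub>c (s x)" for x
      using convex_tangent_bound[OF convex_\<Psi>\<^sub>c diff_\<Psi>\<^sub>c, of "s x" "t * q x"] by (simp add: mult_ac)
  qed (use i1 i2 i3 in auto)
  then show "t * L2_inner \<Omega> (\<lambda>x. deriv \<Psi>\<^sub>c (s x)) q \<le> d" by (simp add: L2_inner_def)
  have "d \<le> (LINT x|lebesgue_on \<Omega>. t * (deriv \<Psi>\<^sub>c (s x) * q x) + t\<^sup>2 * \<bar>L\<bar> * (q x * q x))"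
    unfolding d
  proof (rule integral_mono)
    show "\<Psi>\<^sub>c (s x + t *\<^sub>R q x) - \<Psi>\<^sub>c (s x) \<le> t * (deriv \<Psi>\<^sub>c (s x) * q x) + t\<^sup>2 * \<bar>L\<bar> * (q x * q x)" for x
      using lipschitz_deriv_upper_bound[OF diff_\<Psi>\<^sub>c lipschitz_\<Psi>\<^sub>c, of "s x" "t * q x"]
      by (simp add: mult_ac power2_eq_square)
  qed (use i1 i2 i3 i4 in auto)
  also have "\<dots> = t * (LINT x|lebesgue_on \<Omega>. deriv \<Psi>\<^sub>c (s x) * q x) + t\<^sup>2 * \<bar>L\<bar> * (LINT x|lebesgue_on \<Omega>. q x * q x)"
    using i3 i4 by simp
  finally show "d \<le> t * L2_inner \<Omega> (\<lambda>x. deriv \<Psi>\<^sub>c (s x)) q + t\<^sup>2 * (\<bar>L\<bar> * L2_inner \<Omega> q q)"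
    by (simp add: L2_inner_def mult.assoc)
qed

lemma convex_energy_eq:
  assumes s: "s \<in> Q" and w: "w \<in> V"
  shows "convex_energy \<Omega> \<gamma> l \<xi> \<Psi>\<^sub>c \<C> s w = \<gamma> / l * (LINT x|lebesgue_on \<Omega>. \<Psi>\<^sub>c (s x))
    + \<gamma> * l / 2 * L2_inner \<Omega> (weak_grad \<Omega> s) (weak_grad \<Omega> s)
    + 1/2 * elastic_form (eps s w) (eps s w)"
proof -
  note i1 = L2_integrable[OF \<Psi>\<^sub>c_L2[OF s]]
  note i2 = L2_inner_integrable[OF Q_grad_L2[OF s] Q_grad_L2[OF s]]
  note i3 = L2_inner_integrable[OF tensor_L2[OF eps_L2[OF s w]] eps_L2[OF s w]]
  have "convex_energy \<Omega> \<gamma> l \<xi> \<Psi>\<^sub>c \<C> s w = (LINT x|lebesgue_on \<Omega>. \<gamma> / l * \<Psi>\<^sub>c (s x)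
      + \<gamma> * l / 2 * (weak_grad \<Omega> s x \<bullet> weak_grad \<Omega> s x) + 1/2 * (\<C> (eps s w x) \<bullet> eps s w x))"
    by (simp add: convex_energy_def power2_norm_eq_inner inner_commute[of "\<C> _"])
  also have "\<dots> = \<gamma> / l * (LINT x|lebesgue_on \<Omega>. \<Psi>\<^sub>c (s x))
      + \<gamma> * l / 2 * (LINT x|lebesgue_on \<Omega>. weak_grad \<Omega> s x \<bullet> weak_grad \<Omega> s x)
      + 1/2 * (LINT x|lebesgue_on \<Omega>. \<C> (eps s w x) \<bullet> eps s w x)"
    using i1 i2 i3 by simp
  finally show ?thesis by (simp add: L2_inner_def elastic_form_def)
qed

abbreviation energy where
  "energy \<equiv> incremental_energy \<Omega> Q \<gamma> l \<tau> m \<xi> \<Psi>\<^sub>c \<Psi>\<^sub>e \<C> R f \<phi>\<^sub>0"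

definition residual :: "(real^'d \<Rightarrow> real) \<Rightarrow> real^'d \<Rightarrow> real" where
  "residual s x = s x - \<phi>\<^sub>0 x - \<tau> * R x"

lemma residual_eq: "residual s = (\<lambda>x. (s x + (- 1) *\<^sub>R \<phi>\<^sub>0 x) + (- \<tau>) *\<^sub>R R x)"
  by (simp add: residual_def[abs_def])

lemma residual_L2: "s \<in> Q \<Longrightarrow> residual s \<in> L2 \<Omega>"
  unfolding residual_eq by (intro L2_lincomb Q_L2 \<phi>\<^sub>0_Q R_L2)

lemma residual_inner:
  assumes "s \<in> Q" "g \<in> L2 \<Omega>"
  shows "L2_inner \<Omega> (residual s) g = \<tau> * (L2_inner \<Omega> (\<lambda>x. (s x - \<phi>\<^sub>0 x) / \<tau>) g - L2_inner \<Omega> R g)"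
proof -
  have d: "(\<lambda>x. s x + (- 1) *\<^sub>R \<phi>\<^sub>0 x) \<in> L2 \<Omega>" by (intro L2_lincomb Q_L2 assms \<phi>\<^sub>0_Q)
  have "L2_inner \<Omega> (residual s) g = L2_inner \<Omega> (\<lambda>x. s x + (- 1) *\<^sub>R \<phi>\<^sub>0 x) g + (- \<tau>) * L2_inner \<Omega> R g"
    unfolding residual_eq by (rule L2_inner_lincomb_left[OF d R_L2 assms(2)])
  moreover have "L2_inner \<Omega> (\<lambda>x. (s x - \<phi>\<^sub>0 x) / \<tau>) g = (1/\<tau>) * L2_inner \<Omega> (\<lambda>x. s x + (- 1) *\<^sub>R \<phi>\<^sub>0 x) g"
    using L2_inner_scaleR[of \<Omega> "1/\<tau>" "\<lambda>x. s x + (- 1) *\<^sub>R \<phi>\<^sub>0 x" g] by simp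
  ultimately show ?thesis using \<tau>_pos by (simp add: right_diff_distrib)
qed

lemma admissible_iff:
  "s \<in> admissible \<Omega> Q \<tau> R \<phi>\<^sub>0 \<longleftrightarrow> s \<in> Q \<and> L2_inner \<Omega> (residual s) one = 0"
proof (cases "s \<in> Q")
  case True
  have "(\<lambda>x. (1/\<tau>) *\<^sub>R (s x + (- 1) *\<^sub>R \<phi>\<^sub>0 x)) \<in> L2 \<Omega>"
    by (intro L2_scaleR L2_lincomb Q_L2 True \<phi>\<^sub>0_Q)
  then have d: "(\<lambda>x. (s x - \<phi>\<^sub>0 x) / \<tau>) \<in> L2 \<Omega>" by simp
  show ?thesis
    unfolding admissible_def mem_Collect_eq integral_eq_inner_one[OF d] integral_eq_inner_one[OF R_L2]
    using True residual_inner[OF True Q_L2[OF one_Q]] \<tau>_pos by simp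
qed (simp add: admissible_def)

text \<open>The derivatives of the energy in the directions \<open>(q, 0)\<close> and \<open>(0, v)\<close>, where \<open>r\<close> stands for the
  representative of the residual, which gives the derivative of the squared dual norm.\<close>

definition phase_variation ::
    "(real^'d \<Rightarrow> real) \<Rightarrow> (real^'d \<Rightarrow> real^'d) \<Rightarrow> (real^'d \<Rightarrow> real) \<Rightarrow> (real^'d \<Rightarrow> real) \<Rightarrow> real" where
  "phase_variation \<phi> u r q = L2_inner \<Omega> q r / \<tau>
     + \<gamma> / l * L2_inner \<Omega> (\<lambda>x. deriv \<Psi>\<^sub>c (\<phi> x) - deriv \<Psi>\<^sub>e (\<phi>\<^sub>0 x)) q
     + \<gamma> * l * L2_inner \<Omega> (weak_grad \<Omega> \<phi>) (weak_grad \<Omega> q)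
     - L2_inner \<Omega> (\<lambda>x. \<C> (eps \<phi> u x)) (\<lambda>x. (q x * \<xi>) *\<^sub>R mat 1)"

definition displacement_variation ::
    "(real^'d \<Rightarrow> real) \<Rightarrow> (real^'d \<Rightarrow> real^'d) \<Rightarrow> (real^'d \<Rightarrow> real^'d) \<Rightarrow> real" where
  "displacement_variation \<phi> u v = L2_inner \<Omega> (\<lambda>x. \<C> (eps \<phi> u x)) (strain \<Omega> v) - L2_inner \<Omega> f v"

text \<open>An upper bound for the second-order part of the energy increment; all its terms are exact except the
  one with \<open>L\<close>, which estimates the potential.\<close>

definition remainder :: "(real^'d \<Rightarrow> real) \<Rightarrow> (real^'d \<Rightarrow> real^'d) \<Rightarrow> real" where
  "remainder q v = (dual_norm \<Omega> Q m (L2_inner \<Omega> q))\<^sup>2 / (2 * \<tau>) + \<gamma> / l * (\<bar>L\<bar> * L2_inner \<Omega> q q)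
     + \<gamma> * l / 2 * L2_inner \<Omega> (weak_grad \<Omega> q) (weak_grad \<Omega> q) + elastic_form (eps q v) (eps q v) / 2"

lemma deriv_split_L2: "\<phi> \<in> Q \<Longrightarrow> (\<lambda>x. deriv \<Psi>\<^sub>c (\<phi> x) - deriv \<Psi>\<^sub>e (\<phi>\<^sub>0 x)) \<in> L2 \<Omega>"
  using L2_lincomb[OF deriv_\<Psi>\<^sub>c_L2 deriv_\<Psi>\<^sub>e_L2[OF \<phi>\<^sub>0_Q], of \<phi> "-1"] by simp

lemma phase_variation_lincomb:
  assumes "\<phi> \<in> Q" "u \<in> V" "r \<in> Q" "p \<in> Q" "q \<in> Q"
  shows "phase_variation \<phi> u r (\<lambda>x. p x + c *\<^sub>R q x) = phase_variation \<phi> u r p + c * phase_variation \<phi> u r q"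
proof -
  have sw: "(\<lambda>x. ((p x + c *\<^sub>R q x) * \<xi>) *\<^sub>R (mat 1 :: real^'d^'d)) =
      (\<lambda>x. (p x * \<xi>) *\<^sub>R mat 1 + c *\<^sub>R ((q x * \<xi>) *\<^sub>R mat 1))"
    by (simp add: algebra_simps)
  have "L2_inner \<Omega> (weak_grad \<Omega> \<phi>) (weak_grad \<Omega> (\<lambda>x. p x + c *\<^sub>R q x)) =
      L2_inner \<Omega> (weak_grad \<Omega> \<phi>) (weak_grad \<Omega> p) + c * L2_inner \<Omega> (weak_grad \<Omega> \<phi>) (weak_grad \<Omega> q)"
    using grad_inner_lincomb[OF assms(4,5) Q_grad_L2[OF assms(1)]] by (simp add: L2_inner_commute)
  moreover have "L2_inner \<Omega> (\<lambda>x. p x + c *\<^sub>R q x) r = L2_inner \<Omega> p r + c * L2_inner \<Omega> q r"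
    by (intro L2_inner_lincomb_left Q_L2 assms)
  moreover have "L2_inner \<Omega> (\<lambda>x. deriv \<Psi>\<^sub>c (\<phi> x) - deriv \<Psi>\<^sub>e (\<phi>\<^sub>0 x)) (\<lambda>x. p x + c *\<^sub>R q x) =
      L2_inner \<Omega> (\<lambda>x. deriv \<Psi>\<^sub>c (\<phi> x) - deriv \<Psi>\<^sub>e (\<phi>\<^sub>0 x)) p + c * L2_inner \<Omega> (\<lambda>x. deriv \<Psi>\<^sub>c (\<phi> x) - deriv \<Psi>\<^sub>e (\<phi>\<^sub>0 x)) q"
    by (intro L2_inner_lincomb_right Q_L2 assms deriv_split_L2)
  moreover have "L2_inner \<Omega> (\<lambda>x. \<C> (eps \<phi> u x)) (\<lambda>x. ((p x + c *\<^sub>R q x) * \<xi>) *\<^sub>R mat 1) =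
      L2_inner \<Omega> (\<lambda>x. \<C> (eps \<phi> u x)) (\<lambda>x. (p x * \<xi>) *\<^sub>R mat 1)
      + c * L2_inner \<Omega> (\<lambda>x. \<C> (eps \<phi> u x)) (\<lambda>x. (q x * \<xi>) *\<^sub>R mat 1)"
    unfolding sw by (intro L2_inner_lincomb_right tensor_L2 eps_L2 swelling_L2 Q_L2 assms)
  ultimately show ?thesis
    unfolding phase_variation_def by (simp only:) (simp add: algebra_simps add_divide_distrib)
qed

lemma displacement_variation_lincomb:
  assumes "\<phi> \<in> Q" "u \<in> V" "w \<in> V" "v \<in> V"
  shows "displacement_variation \<phi> u (\<lambda>x. w x + c *\<^sub>R v x) =
    displacement_variation \<phi> u w + c * displacement_variation \<phi> u v"
proof -
  have L: "(\<lambda>x. \<C> (eps \<phi> u x)) \<in> L2 \<Omega>" by (intro tensor_L2 eps_L2 assms)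
  have "L2_inner \<Omega> (\<lambda>x. \<C> (eps \<phi> u x)) (strain \<Omega> (\<lambda>x. w x + c *\<^sub>R v x)) =
      L2_inner \<Omega> (\<lambda>x. \<C> (eps \<phi> u x)) (\<lambda>x. strain \<Omega> w x + c *\<^sub>R strain \<Omega> v x)"
    using strain_lincomb[OF assms(3,4), of c] L
    by (intro L2_inner_cong_AE L2_lincomb strain_L2 V_lincomb assms) auto
  also have "\<dots> = L2_inner \<Omega> (\<lambda>x. \<C> (eps \<phi> u x)) (strain \<Omega> w) + c * L2_inner \<Omega> (\<lambda>x. \<C> (eps \<phi> u x)) (strain \<Omega> v)"
    by (intro L2_inner_lincomb_right strain_L2 assms L)
  moreover have "L2_inner \<Omega> f (\<lambda>x. w x + c *\<^sub>R v x) = L2_inner \<Omega> f w + c * L2_inner \<Omega> f v"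
    by (intro L2_inner_lincomb_right V_L2 assms f_L2)
  ultimately show ?thesis by (simp add: displacement_variation_def algebra_simps)
qed

text \<open>The lower bound expresses convexity of the energy along the direction, the upper bound differentiability
  with a quadratic remainder.\<close>

lemma energy_increment:
  fixes t :: real
  assumes \<phi>: "\<phi> \<in> admissible \<Omega> Q \<tau> R \<phi>\<^sub>0" and u: "u \<in> V"
    and r: "r \<in> Q" "\<And>q. q \<in> Q \<Longrightarrow> grad_form r q = L2_inner \<Omega> (residual \<phi>) q"
    and q: "q \<in> Q" "L2_inner \<Omega> q one = 0" and v: "v \<in> V"
  defines "d \<equiv> energy (\<lambda>x. \<phi> x + t *\<^sub>R q x) (\<lambda>x. u x + t *\<^sub>R v x) - energy \<phi> u"
    and "D \<equiv> phase_variation \<phi> u r q + displacement_variation \<phi> u v"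
  shows "t * D \<le> d" and "d \<le> t * D + t\<^sup>2 * remainder q v"
proof -
  have \<phi>Q: "\<phi> \<in> Q" and \<phi>1: "L2_inner \<Omega> (residual \<phi>) one = 0" using \<phi> admissible_iff by auto
  let ?\<phi>' = "\<lambda>x. \<phi> x + t *\<^sub>R q x" and ?u' = "\<lambda>x. u x + t *\<^sub>R v x"
  have \<phi>'Q: "?\<phi>' \<in> Q" and u'V: "?u' \<in> V" by (intro Q_lincomb \<phi>Q q V_lincomb u v)+
  have en: "energy s w = (dual_norm \<Omega> Q m (L2_inner \<Omega> (residual s)))\<^sup>2 / (2 * \<tau>)
     + (\<gamma> / l * (LINT x|lebesgue_on \<Omega>. \<Psi>\<^sub>c (s x))
    + \<gamma> * l / 2 * L2_inner \<Omega> (weak_grad \<Omega> s) (weak_grad \<Omega> s)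
    + 1/2 * elastic_form (eps s w) (eps s w))
     - \<gamma> / l * L2_inner \<Omega> (\<lambda>x. deriv \<Psi>\<^sub>e (\<phi>\<^sub>0 x)) s - L2_inner \<Omega> f w" if "s \<in> Q" "w \<in> V" for s w
    unfolding incremental_energy_def convex_energy_eq[OF that] residual_def[abs_def] by simp
  have res: "residual ?\<phi>' = (\<lambda>x. residual \<phi> x + t *\<^sub>R q x)" by (simp add: residual_def fun_eq_iff)
  define pd where "pd = (LINT x|lebesgue_on \<Omega>. \<Psi>\<^sub>c (?\<phi>' x)) - (LINT x|lebesgue_on \<Omega>. \<Psi>\<^sub>c (\<phi> x))"
  define A where "A = (dual_norm \<Omega> Q m (L2_inner \<Omega> q))\<^sup>2"
  define G where "G = L2_inner \<Omega> (weak_grad \<Omega> q) (weak_grad \<Omega> q)"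
  define E where "E = elastic_form (eps q v) (eps q v)"
  define P where "P = L2_inner \<Omega> (\<lambda>x. deriv \<Psi>\<^sub>c (\<phi> x)) q"
  define P0 where "P0 = L2_inner \<Omega> (\<lambda>x. deriv \<Psi>\<^sub>e (\<phi>\<^sub>0 x)) q"
  define S where "S = L2_inner \<Omega> (\<lambda>x. \<C> (eps \<phi> u x)) (strain \<Omega> v)"
  define W where "W = L2_inner \<Omega> (\<lambda>x. \<C> (eps \<phi> u x)) (\<lambda>x. (q x * \<xi>) *\<^sub>R mat 1)"
  have e1: "(dual_norm \<Omega> Q m (L2_inner \<Omega> (residual ?\<phi>')))\<^sup>2 = (dual_norm \<Omega> Q m (L2_inner \<Omega> (residual \<phi>)))\<^sup>2
      + 2 * t * L2_inner \<Omega> q r + t\<^sup>2 * A"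
    unfolding res A_def by (rule dual_norm_square_increment[OF residual_L2[OF \<phi>Q] \<phi>1 r q])
  note e2 = gradient_energy_increment[OF \<phi>Q q(1), of t, folded G_def]
  note e3 = elastic_energy_increment[OF \<phi>Q q(1) u v, of t, folded E_def]
  have e4: "elastic_form (eps \<phi> u) (eps q v) = S - W"
  proof -
    have "elastic_form (eps \<phi> u) (eps q v) = S + (- 1) * W"
      unfolding elastic_form_def S_def W_def eps_eq[of q v]
      by (intro L2_inner_lincomb_right tensor_L2 eps_L2 strain_L2 swelling_L2 Q_L2 \<phi>Q q u v)
    then show ?thesis by simp
  qed
  have e5: "L2_inner \<Omega> (\<lambda>x. deriv \<Psi>\<^sub>e (\<phi>\<^sub>0 x)) ?\<phi>' = L2_inner \<Omega> (\<lambda>x. deriv \<Psi>\<^sub>e (\<phi>\<^sub>0 x)) \<phi> + t * P0"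
    unfolding P0_def by (intro L2_inner_lincomb_right Q_L2 deriv_\<Psi>\<^sub>e_L2 \<phi>\<^sub>0_Q \<phi>Q q)
  have e6: "L2_inner \<Omega> f ?u' = L2_inner \<Omega> f u + t * L2_inner \<Omega> f v"
    by (intro L2_inner_lincomb_right V_L2 u v f_L2)
  have e7: "L2_inner \<Omega> (\<lambda>x. deriv \<Psi>\<^sub>c (\<phi> x) - deriv \<Psi>\<^sub>e (\<phi>\<^sub>0 x)) q = P - P0"
    using L2_inner_lincomb_left[OF deriv_\<Psi>\<^sub>c_L2[OF \<phi>Q] deriv_\<Psi>\<^sub>e_L2[OF \<phi>\<^sub>0_Q] Q_L2[OF q(1)], of "-1"]
    by (simp add: P_def P0_def)
  have D: "D = L2_inner \<Omega> q r / \<tau> + \<gamma> / l * (P - P0) + \<gamma> * l * L2_inner \<Omega> (weak_grad \<Omega> \<phi>) (weak_grad \<Omega> q)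
      - W + (S - L2_inner \<Omega> f v)"
    unfolding D_def phase_variation_def displacement_variation_def e7 S_def W_def by simp
  have rem: "remainder q v = A / (2 * \<tau>) + \<gamma> / l * (\<bar>L\<bar> * L2_inner \<Omega> q q) + \<gamma> * l / 2 * G + E / 2"
    by (simp add: remainder_def A_def G_def E_def)
  have dd: "d = t * D + t\<^sup>2 * (A / (2 * \<tau>) + \<gamma> * l / 2 * G + E / 2) + \<gamma> / l * (pd - t * P)"
    unfolding d_def en[OF \<phi>Q u] en[OF \<phi>'Q u'V] e1 e2 e3 e4 e5 e6 D pd_def
    using \<tau>_pos l_pos by (simp add: field_simps)
  have gl: "0 < \<gamma> / l" using \<gamma>_pos l_pos by simp
  have lower: "0 \<le> \<gamma> / l * (pd - t * P)"
    using potential_energy_increment(1)[OF \<phi>Q q(1), of t, folded pd_def P_def] gl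
    by (intro mult_nonneg_nonneg) simp_all
  have upper: "\<gamma> / l * (pd - t * P) \<le> \<gamma> / l * (t\<^sup>2 * (\<bar>L\<bar> * L2_inner \<Omega> q q))"
    using potential_energy_increment(2)[OF \<phi>Q q(1), of t, folded pd_def P_def] gl
    by (intro mult_left_mono) simp_all
  have "0 \<le> A" "0 \<le> G" "0 \<le> E"
    unfolding A_def G_def E_def using elastic_form_nonneg[OF eps_L2_sym[OF q(1) v]] L2_inner_nonneg by auto
  then have "0 \<le> t\<^sup>2 * (A / (2 * \<tau>) + \<gamma> * l / 2 * G + E / 2)"
    using \<tau>_pos \<gamma>_pos l_pos by simp
  then show "t * D \<le> d" unfolding dd using lower by linarith
  show "d \<le> t * D + t\<^sup>2 * remainder q v"
    unfolding dd rem using upper by (simp add: algebra_simps)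
qed

text \<open>If \<open>(\<phi>, u)\<close> is a minimizer, the upper bound on the increment is nonnegative for all steps \<open>t\<close>, which
  forces the first variation to vanish. Conversely, any competitor is reached with step \<open>1\<close>, and the lower
  bound on the increment is the first variation.\<close>

lemma minimizer_iff_stationary:
  assumes \<phi>: "\<phi> \<in> admissible \<Omega> Q \<tau> R \<phi>\<^sub>0" and u: "u \<in> V"
    and r: "r \<in> Q" "\<And>q. q \<in> Q \<Longrightarrow> grad_form r q = L2_inner \<Omega> (residual \<phi>) q"
  shows "solves_minimization_problem \<Omega> Q V \<gamma> l \<tau> m \<xi> \<Psi>\<^sub>c \<Psi>\<^sub>e \<C> R f \<phi>\<^sub>0 \<phi> u \<longleftrightarrow>
    (\<forall>q\<in>Q. L2_inner \<Omega> q one = 0 \<longrightarrow> phase_variation \<phi> u r q = 0) \<and>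
    (\<forall>v\<in>V. displacement_variation \<phi> u v = 0)" (is "?min \<longleftrightarrow> ?stat")
proof -
  have \<phi>Q: "\<phi> \<in> Q" and \<phi>1: "L2_inner \<Omega> (residual \<phi>) one = 0" using \<phi> admissible_iff by auto
  have min_iff: "?min \<longleftrightarrow> (\<forall>s\<in>admissible \<Omega> Q \<tau> R \<phi>\<^sub>0. \<forall>w\<in>V. energy \<phi> u \<le> energy s w)"
    unfolding solves_minimization_problem_def is_arg_min_def using \<phi> u by (auto simp: not_less)
  have step: "residual (\<lambda>x. s x + c *\<^sub>R q x) = (\<lambda>x. residual s x + c *\<^sub>R q x)" for s q c
    by (simp add: residual_def fun_eq_iff)
  show ?thesis
  proof
    assume ?min
    have D0: "phase_variation \<phi> u r q + displacement_variation \<phi> u v = 0"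
      if q: "q \<in> Q" "L2_inner \<Omega> q one = 0" and v: "v \<in> V" for q v
    proof (rule nonneg_linear_plus_square_imp_zero)
      fix t
      have "L2_inner \<Omega> (residual (\<lambda>x. \<phi> x + t *\<^sub>R q x)) one = 0"
        unfolding step using L2_inner_lincomb_left[OF residual_L2[OF \<phi>Q] Q_L2[OF q(1)] Q_L2[OF one_Q], of t] \<phi>1 q(2)
        by simp
      then have "(\<lambda>x. \<phi> x + t *\<^sub>R q x) \<in> admissible \<Omega> Q \<tau> R \<phi>\<^sub>0"
        using Q_lincomb[OF \<phi>Q q(1)] by (simp only: admissible_iff)
      then have "0 \<le> energy (\<lambda>x. \<phi> x + t *\<^sub>R q x) (\<lambda>x. u x + t *\<^sub>R v x) - energy \<phi> u"
        using \<open>?min\<close> min_iff V_lincomb[OF u v] by simp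
      also note energy_increment(2)[OF \<phi> u r q v]
      finally show "0 \<le> t * (phase_variation \<phi> u r q + displacement_variation \<phi> u v) + t\<^sup>2 * remainder q v" .
    qed
    have zQ: "(\<lambda>x. 0) \<in> Q" and zV: "(\<lambda>x. 0) \<in> V"
      using finite_element_space_zero Q_finite_element V_finite_element by blast+
    have "phase_variation \<phi> u r (\<lambda>x. 0) = 0"
      using phase_variation_lincomb[OF \<phi>Q u r(1) zQ zQ, of 1] by simp
    moreover have "displacement_variation \<phi> u (\<lambda>x. 0) = 0"
      using displacement_variation_lincomb[OF \<phi>Q u zV zV, of 1] by simp
    moreover have "L2_inner \<Omega> (\<lambda>x. 0) one = 0" by (simp add: L2_inner_def)
    ultimately show ?stat
      using D0[OF _ _ zV] D0[OF zQ] by auto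
  next
    assume stat: ?stat
    have "energy \<phi> u \<le> energy s w" if s: "s \<in> admissible \<Omega> Q \<tau> R \<phi>\<^sub>0" and w: "w \<in> V" for s w
    proof -
      define q where "q = (\<lambda>x. s x + (- 1) *\<^sub>R \<phi> x)"
      define v where "v = (\<lambda>x. w x + (- 1) *\<^sub>R u x)"
      have sQ: "s \<in> Q" and s1: "L2_inner \<Omega> (residual s) one = 0" using s admissible_iff by auto
      have q: "q \<in> Q" and v: "v \<in> V" unfolding q_def v_def by (intro Q_lincomb sQ \<phi>Q V_lincomb w u)+
      have "q = (\<lambda>x. residual s x + (- 1) *\<^sub>R residual \<phi> x)" by (simp add: q_def residual_def fun_eq_iff)
      then have "L2_inner \<Omega> q one = L2_inner \<Omega> (residual s) one + (- 1) * L2_inner \<Omega> (residual \<phi>) one"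
        using L2_inner_lincomb_left[OF residual_L2[OF sQ] residual_L2[OF \<phi>Q] Q_L2[OF one_Q], of "-1"] by simp
      then have q1: "L2_inner \<Omega> q one = 0" using s1 \<phi>1 by simp
      have "s = (\<lambda>x. \<phi> x + 1 *\<^sub>R q x)" "w = (\<lambda>x. u x + 1 *\<^sub>R v x)" by (simp_all add: q_def v_def)
      then have "1 * (phase_variation \<phi> u r q + displacement_variation \<phi> u v) \<le> energy s w - energy \<phi> u"
        using energy_increment(1)[OF \<phi> u r q q1 v, of 1] by simp
      then show ?thesis using stat q q1 v by simp
    qed
    then show ?min using min_iff by blast
  qed
qed

text \<open>After multiplication with \<open>- \<tau>\<close>, the chemical potential plays the role of the representative of the
  residual, and the three equations become statements about that representative and the first variation.\<close>

lemma discrete_problem_iff: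
  assumes \<phi>: "\<phi> \<in> Q" and u: "u \<in> V" and \<mu>: "\<mu> \<in> Q"
  defines "r \<equiv> \<lambda>x. (- \<tau>) *\<^sub>R \<mu> x"
  shows "solves_discrete_problem \<Omega> Q V \<gamma> l \<tau> m \<xi> \<Psi>\<^sub>c \<Psi>\<^sub>e \<C> R f \<phi>\<^sub>0 \<phi> \<mu> u \<longleftrightarrow>
    (\<forall>q\<in>Q. grad_form r q = L2_inner \<Omega> (residual \<phi>) q) \<and>
    (\<forall>q\<in>Q. phase_variation \<phi> u r q = 0) \<and> (\<forall>v\<in>V. displacement_variation \<phi> u v = 0)"
proof -
  have zQ: "(\<lambda>x. 0) \<in> Q" using finite_element_space_zero Q_finite_element by blast
  have gr: "grad_form r q = - \<tau> * grad_form \<mu> q" if "q \<in> Q" for q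
    using grad.left[OF zQ \<mu> that, of "- \<tau>"] grad.left[OF zQ zQ that, of 1] by (simp add: r_def)
  have gm: "L2_inner \<Omega> (\<lambda>x. m *\<^sub>R weak_grad \<Omega> \<mu> x) (weak_grad \<Omega> q) = grad_form \<mu> q" for q
    by (simp add: grad_form_def L2_inner_scaleR)
  have eq1: "L2_inner \<Omega> (\<lambda>x. (\<phi> x - \<phi>\<^sub>0 x) / \<tau>) q
        + L2_inner \<Omega> (\<lambda>x. m *\<^sub>R weak_grad \<Omega> \<mu> x) (weak_grad \<Omega> q) - L2_inner \<Omega> R q = 0 \<longleftrightarrow>
      grad_form r q = L2_inner \<Omega> (residual \<phi>) q" if q: "q \<in> Q" for q
    unfolding gm gr[OF q] residual_inner[OF \<phi> Q_L2[OF q]] using \<tau>_pos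
    by (simp only: mult_minus_left minus_mult_right mult_cancel_left) auto
  have "L2_inner \<Omega> q r / \<tau> = - L2_inner \<Omega> \<mu> q" for q
    using \<tau>_pos by (simp only: L2_inner_commute[of \<Omega> q] r_def L2_inner_scaleR) simp
  then have eq2: "L2_inner \<Omega> \<mu> q - \<gamma> * l * L2_inner \<Omega> (weak_grad \<Omega> \<phi>) (weak_grad \<Omega> q)
        - \<gamma> / l * L2_inner \<Omega> (\<lambda>x. deriv \<Psi>\<^sub>c (\<phi> x) - deriv \<Psi>\<^sub>e (\<phi>\<^sub>0 x)) q
        + L2_inner \<Omega> (\<lambda>x. \<C> (eps \<phi> u x)) (\<lambda>x. (q x * \<xi>) *\<^sub>R mat 1) = - phase_variation \<phi> u r q" for q
    unfolding phase_variation_def by simp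
  show ?thesis
    unfolding solves_discrete_problem_def eq2 using \<phi> u \<mu> eq1
    by (simp add: displacement_variation_def)
qed

lemma minimization_iff_discrete_problem:
  "solves_minimization_problem \<Omega> Q V \<gamma> l \<tau> m \<xi> \<Psi>\<^sub>c \<Psi>\<^sub>e \<C> R f \<phi>\<^sub>0 \<phi> u \<longleftrightarrow>
    (\<exists>\<mu>\<in>Q. solves_discrete_problem \<Omega> Q V \<gamma> l \<tau> m \<xi> \<Psi>\<^sub>c \<Psi>\<^sub>e \<C> R f \<phi>\<^sub>0 \<phi> \<mu> u)"
proof
  assume min: "solves_minimization_problem \<Omega> Q V \<gamma> l \<tau> m \<xi> \<Psi>\<^sub>c \<Psi>\<^sub>e \<C> R f \<phi>\<^sub>0 \<phi> u"
  then have \<phi>: "\<phi> \<in> admissible \<Omega> Q \<tau> R \<phi>\<^sub>0" and u: "u \<in> V"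
    by (auto simp: solves_minimization_problem_def is_arg_min_def)
  then have \<phi>Q: "\<phi> \<in> Q" and \<phi>1: "L2_inner \<Omega> (residual \<phi>) one = 0" using admissible_iff by auto
  obtain r where r: "r \<in> Q" "\<And>q. q \<in> Q \<Longrightarrow> grad_form r q = L2_inner \<Omega> (residual \<phi>) q"
    using grad_representation[OF residual_L2[OF \<phi>Q] \<phi>1] by blast
  have stat: "\<And>q. q \<in> Q \<Longrightarrow> L2_inner \<Omega> q one = 0 \<Longrightarrow> phase_variation \<phi> u r q = 0"
      "\<And>v. v \<in> V \<Longrightarrow> displacement_variation \<phi> u v = 0"
    using min minimizer_iff_stationary[OF \<phi> u r] by blast+
  define a where "a = L2_inner \<Omega> one one"
  have a: "a > 0" using inner_one_one_pos by (simp add: a_def)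
  \<comment> \<open>The variation vanishes on mean-zero functions, so it is a multiple of the mean; \<open>c\<close> is the constant
    to be added to \<open>- r / \<tau>\<close> in order to cancel it.\<close>
  define c where "c = phase_variation \<phi> u r one / a"
  have var: "phase_variation \<phi> u r q = c * L2_inner \<Omega> q one" if q: "q \<in> Q" for q
  proof -
    let ?k = "- (L2_inner \<Omega> q one / a)"
    have "L2_inner \<Omega> (\<lambda>x. q x + ?k *\<^sub>R one x) one = L2_inner \<Omega> q one + ?k * a"
      unfolding a_def by (intro L2_inner_lincomb_left Q_L2 q one_Q)
    then have "phase_variation \<phi> u r (\<lambda>x. q x + ?k *\<^sub>R one x) = 0"
      using a by (intro stat Q_lincomb q one_Q) simp
    then show ?thesis
      using phase_variation_lincomb[OF \<phi>Q u r(1) q one_Q, of ?k] a by (simp add: c_def field_simps)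
  qed
  define \<mu> where "\<mu> = (\<lambda>x. (- 1 / \<tau>) *\<^sub>R (r x + (- \<tau> * c) *\<^sub>R one x))"
  let ?r = "\<lambda>x. r x + (- \<tau> * c) *\<^sub>R one x"
  have zQ: "(\<lambda>x. 0) \<in> Q" using finite_element_space_zero Q_finite_element by blast
  have r'Q: "?r \<in> Q" by (intro Q_lincomb r one_Q)
  have \<mu>Q: "\<mu> \<in> Q" using Q_lincomb[OF zQ r'Q, of "- 1 / \<tau>"] by (simp add: \<mu>_def)
  have r': "(\<lambda>x. (- \<tau>) *\<^sub>R \<mu> x) = ?r" using \<tau>_pos by (simp add: \<mu>_def)
  have "grad_form ?r q = L2_inner \<Omega> (residual \<phi>) q" if "q \<in> Q" for q
    using grad.left[OF r(1) one_Q that, of "- \<tau> * c"] grad_form_one[OF that] grad.sym[of one q] r(2)[OF that] by simp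
  moreover have "phase_variation \<phi> u ?r q = 0" if q: "q \<in> Q" for q
  proof -
    have "L2_inner \<Omega> q ?r = L2_inner \<Omega> q r + (- \<tau> * c) * L2_inner \<Omega> q one"
      by (intro L2_inner_lincomb_right Q_L2 r one_Q q)
    then have "phase_variation \<phi> u ?r q = phase_variation \<phi> u r q - c * L2_inner \<Omega> q one"
      unfolding phase_variation_def using \<tau>_pos by (simp only:) (simp add: field_simps)
    then show ?thesis using var[OF q] by simp
  qed
  ultimately have "solves_discrete_problem \<Omega> Q V \<gamma> l \<tau> m \<xi> \<Psi>\<^sub>c \<Psi>\<^sub>e \<C> R f \<phi>\<^sub>0 \<phi> \<mu> u"
    unfolding discrete_problem_iff[OF \<phi>Q u \<mu>Q] r' using stat(2) by blast
  then show "\<exists>\<mu>\<in>Q. solves_discrete_problem \<Omega> Q V \<gamma> l \<tau> m \<xi> \<Psi>\<^sub>c \<Psi>\<^sub>e \<C> R f \<phi>\<^sub>0 \<phi> \<mu> u"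
    using \<mu>Q by blast
next
  assume "\<exists>\<mu>\<in>Q. solves_discrete_problem \<Omega> Q V \<gamma> l \<tau> m \<xi> \<Psi>\<^sub>c \<Psi>\<^sub>e \<C> R f \<phi>\<^sub>0 \<phi> \<mu> u"
  then obtain \<mu> where \<mu>: "\<mu> \<in> Q" and P: "solves_discrete_problem \<Omega> Q V \<gamma> l \<tau> m \<xi> \<Psi>\<^sub>c \<Psi>\<^sub>e \<C> R f \<phi>\<^sub>0 \<phi> \<mu> u"
    by blast
  then have \<phi>Q: "\<phi> \<in> Q" and u: "u \<in> V" by (auto simp: solves_discrete_problem_def)
  define r where "r = (\<lambda>x. (- \<tau>) *\<^sub>R \<mu> x)"
  have zQ: "(\<lambda>x. 0) \<in> Q" using finite_element_space_zero Q_finite_element by blast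
  have rQ: "r \<in> Q" using Q_lincomb[OF zQ \<mu>, of "- \<tau>"] by (simp add: r_def)
  note eqs = P[unfolded discrete_problem_iff[OF \<phi>Q u \<mu>], folded r_def]
  have "L2_inner \<Omega> (residual \<phi>) one = 0"
    using eqs one_Q grad_form_one[OF rQ] by auto
  then have \<phi>: "\<phi> \<in> admissible \<Omega> Q \<tau> R \<phi>\<^sub>0" using \<phi>Q admissible_iff by blast
  have "grad_form r q = L2_inner \<Omega> (residual \<phi>) q" if "q \<in> Q" for q using eqs that by blast
  from minimizer_iff_stationary[OF \<phi> u rQ this] eqs
  show "solves_minimization_problem \<Omega> Q V \<gamma> l \<tau> m \<xi> \<Psi>\<^sub>c \<Psi>\<^sub>e \<C> R f \<phi>\<^sub>0 \<phi> u" by blast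
qed

end

theorem proposition1:
  fixes \<Omega> :: "(real^'d) set"
    and Q :: "(real^'d \<Rightarrow> real) set"
    and V :: "(real^'d \<Rightarrow> real^'d) set"
    and \<gamma> l \<tau> m \<xi> L c\<^sub>l c\<^sub>u :: real
    and \<Psi> \<Psi>\<^sub>c \<Psi>\<^sub>e :: "real \<Rightarrow> real"
    and \<C> :: "real^'d^'d \<Rightarrow> real^'d^'d"
    and R \<phi>\<^sub>0 \<phi> :: "real^'d \<Rightarrow> real"
    and f u :: "real^'d \<Rightarrow> real^'d"
  assumes "lipschitz_domain \<Omega>"
    and "finite_element_space \<Omega> Q" and "Q \<subseteq> H1 \<Omega>"
    and "\<exists>q \<in> Q. AE x in lebesgue_on \<Omega>. q x = 1"
    and "finite_element_space \<Omega> V" and "V \<subseteq> H1_0_vec \<Omega>"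
    and "\<gamma> > 0" and "l > 0" and "\<tau> > 0" and "m > 0"
    and "R \<in> L2 \<Omega>" and "f \<in> L2 \<Omega>"
    and "convex_splitting \<Psi> \<Psi>\<^sub>c \<Psi>\<^sub>e L"
    and "elasticity_tensor \<Omega> \<C> c\<^sub>l c\<^sub>u"
    and "\<phi>\<^sub>0 \<in> Q"
  shows "solves_minimization_problem \<Omega> Q V \<gamma> l \<tau> m \<xi> \<Psi>\<^sub>c \<Psi>\<^sub>e \<C> R f \<phi>\<^sub>0 \<phi> u \<longleftrightarrow>
         (\<exists>\<mu> \<in> Q. solves_discrete_problem \<Omega> Q V \<gamma> l \<tau> m \<xi> \<Psi>\<^sub>c \<Psi>\<^sub>e \<C> R f \<phi>\<^sub>0 \<phi> \<mu> u)"
proof -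
  obtain one where one: "one \<in> Q" "AE x in lebesgue_on \<Omega>. one x = 1" using assms(4) by blast
  interpret phase_field_step \<Omega> Q m one V \<gamma> l \<tau> \<xi> L c\<^sub>l c\<^sub>u \<Psi> \<Psi>\<^sub>c \<Psi>\<^sub>e \<C> R \<phi>\<^sub>0 f
    by unfold_locales (use assms one in \<open>auto simp: lipschitz_domain_def\<close>)
  show ?thesis by (rule minimization_iff_discrete_problem)
qed

end
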